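(* Let $a,b,\sigma,\rho$ be real constants, $q\in(0,1)$, and let $(X(t))_{t\ge 0}$ be the unique process satisfying the stochastic pantograph equation $$dX(t)=\{aX(t)+bX(qt)\}\,dt+\{\sigma X(t)+\rho X(qt)\}\,dB(t),\quad t\ge 0,\qquad X(0)=X_0 .$$ (i) Let $\rho=0$ and $\mathbb{E}[|X_0|^2]<\infty$. If $a<0$, there exist a real constant $\alpha$ and a positive constant $C$ such that $$\mathbb{E}(|X(t)|)\le C\,\mathbb{E}(|X_0|)\,(1+t)^{\alpha}\quad\text{for } t\ge 0,$$ where $\alpha$ is given by $$\alpha=\frac{1}{\log q}\log\left(\frac{-a}{|b|}\right).$$ (ii) Let $\rho\neq 0$ and $\mathbb{E}[|X_0|^4]<\infty$. If $2a+\sigma^2<0$, there exist a real constant $\alpha$ and a positive constant $C$ such that $$\mathbb{E}(|X(t)|^2)\le C\,\mathbb{E}(|X_0|^2)\,(1+t)^{\alpha}\quad\text{for } t\ge 0,$$ where $\alpha$ is given by $$\alpha=\frac{2}{\log q}\log\left(\frac{1}{\rho^2}\left(\sqrt{|b+\sigma\rho|^2-\rho^2(2a+\sigma^2)}-|b+\sigma\rho|\right)\right).$$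
   Context: $(B(t))_{t\ge0}$ is a standard one-dimensional Wiener process on a filtered probability space $(\Omega,\mathcal{F},\mathbb{P})$, the filtration being the natural filtration of $B$. The initial value $X_0$ is a real random variable, independent of $B$, with $\mathbb{E}(|X_0|^2)<\infty$. The process $X$ is the pathwise unique strong solution of the equation (understood in the integrated Itô sense); its existence and uniqueness are known. *)

theory Defs
  imports "HOL-Probability.Probability"
begin

definition process_sigma :: "'a measure \<Rightarrow> real set \<Rightarrow> (real \<Rightarrow> 'a \<Rightarrow> real) \<Rightarrow> 'a measure" where
  "process_sigma M I B =
     sigma (space M) (\<Union>s\<in>I. {B s -` A \<inter> space M | A. A \<in> sets borel})"

definition wiener_process :: "'a measure \<Rightarrow> (real \<Rightarrow> 'a \<Rightarrow> real) \<Rightarrow> bool" where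
  "wiener_process M B \<longleftrightarrow>
     prob_space M \<and>
     (\<forall>t\<ge>0. B t \<in> borel_measurable M) \<and>
     (AE \<omega> in M. B 0 \<omega> = 0) \<and>
     (AE \<omega> in M. continuous_on {0..} (\<lambda>t. B t \<omega>)) \<and>
     (\<forall>s t. 0 \<le> s \<and> s < t \<longrightarrow>
        distributed M lborel (\<lambda>\<omega>. B t \<omega> - B s \<omega>) (normal_density 0 (sqrt (t - s))) \<and>
        prob_space.indep_set M
          (sets (vimage_algebra (space M) (\<lambda>\<omega>. B t \<omega> - B s \<omega>) borel))
          (sets (process_sigma M {0..s} B)))"

text \<open>
  A solution starting at a nondegenerate random \<open>X0\<close> cannot be adapted to the natural
  filtration of \<open>B\<close> alone, so \<open>X0\<close> is adjoined at time \<open>0\<close>, together with the null sets.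
\<close>

definition natural_filtration ::
  "'a measure \<Rightarrow> ('a \<Rightarrow> real) \<Rightarrow> (real \<Rightarrow> 'a \<Rightarrow> real) \<Rightarrow> real \<Rightarrow> 'a measure" where
  "natural_filtration M X0 B t =
     sigma (space M)
       (sets (vimage_algebra (space M) X0 borel) \<union> sets (process_sigma M {0..t} B) \<union> null_sets M)"

definition simple_integrand ::
  "'a measure \<Rightarrow> (real \<Rightarrow> 'a measure) \<Rightarrow> nat \<Rightarrow> (nat \<Rightarrow> real) \<Rightarrow> (nat \<Rightarrow> 'a \<Rightarrow> real) \<Rightarrow> bool" where
  "simple_integrand M F n \<tau> \<xi> \<longleftrightarrow>
     0 \<le> \<tau> 0 \<and>
     (\<forall>i<n. \<tau> i \<le> \<tau> (Suc i)) \<and>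
     (\<forall>i<n. \<xi> i \<in> borel_measurable (F (\<tau> i)) \<and> (\<exists>K. \<forall>\<omega>\<in>space M. \<bar>\<xi> i \<omega>\<bar> \<le> K))"

definition simple_process ::
  "nat \<Rightarrow> (nat \<Rightarrow> real) \<Rightarrow> (nat \<Rightarrow> 'a \<Rightarrow> real) \<Rightarrow> real \<Rightarrow> 'a \<Rightarrow> real" where
  "simple_process n \<tau> \<xi> s \<omega> = (\<Sum>i<n. \<xi> i \<omega> * indicator {\<tau> i<..\<tau> (Suc i)} s)"

definition simple_ito_integral ::
  "(real \<Rightarrow> 'a \<Rightarrow> real) \<Rightarrow> nat \<Rightarrow> (nat \<Rightarrow> real) \<Rightarrow> (nat \<Rightarrow> 'a \<Rightarrow> real) \<Rightarrow> real \<Rightarrow> 'a \<Rightarrow> real" where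
  "simple_ito_integral B n \<tau> \<xi> t \<omega> =
     (\<Sum>i<n. \<xi> i \<omega> * (B (min (\<tau> (Suc i)) t) \<omega> - B (min (\<tau> i) t) \<omega>))"

definition ito_integrand ::
  "'a measure \<Rightarrow> (real \<Rightarrow> 'a measure) \<Rightarrow> (real \<Rightarrow> 'a \<Rightarrow> real) \<Rightarrow> real \<Rightarrow> bool" where
  "ito_integrand M F H t \<longleftrightarrow>
     (\<lambda>(s, \<omega>). H s \<omega>) \<in> borel_measurable (restrict_space lborel {0..t} \<Otimes>\<^sub>M M) \<and>
     (\<forall>s\<in>{0..t}. H s \<in> borel_measurable (F s)) \<and>
     (AE \<omega> in M. (\<integral>\<^sup>+ s\<in>{0..t}. ennreal ((H s \<omega>)\<^sup>2) \<partial>lborel) < \<infinity>)"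

text \<open>
  The Ito integral over \<open>[0, t]\<close> of a measurable adapted process with almost surely
  square-integrable paths: the limit in probability of the integrals of simple processes that
  approximate \<open>H\<close> in \<open>L\<^sup>2[0, t]\<close> in probability. It is determined up to almost sure
  equality and does not depend on the approximating sequence, hence the relational form.
\<close>

definition has_ito_integral ::
  "'a measure \<Rightarrow> (real \<Rightarrow> 'a measure) \<Rightarrow> (real \<Rightarrow> 'a \<Rightarrow> real) \<Rightarrow>
   (real \<Rightarrow> 'a \<Rightarrow> real) \<Rightarrow> real \<Rightarrow> ('a \<Rightarrow> real) \<Rightarrow> bool" where
  "has_ito_integral M F B H t Y \<longleftrightarrow>
     ito_integrand M F H t \<and>
     Y \<in> borel_measurable M \<and>
     (\<exists>n \<tau> \<xi>.
        (\<forall>k. simple_integrand M F (n k) (\<tau> k) (\<xi> k)) \<and>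
        (\<forall>\<epsilon>>0. (\<lambda>k. measure M {\<omega> \<in> space M. ennreal \<epsilon> <
            (\<integral>\<^sup>+ s\<in>{0..t}.
               ennreal ((simple_process (n k) (\<tau> k) (\<xi> k) s \<omega> - H s \<omega>)\<^sup>2) \<partial>lborel)})
          \<longlonglongrightarrow> 0) \<and>
        (\<forall>\<epsilon>>0. (\<lambda>k. measure M {\<omega> \<in> space M. \<epsilon> <
            \<bar>simple_ito_integral B (n k) (\<tau> k) (\<xi> k) t \<omega> - Y \<omega>\<bar>})
          \<longlonglongrightarrow> 0))"

definition pantograph_solution ::
  "'a measure \<Rightarrow> (real \<Rightarrow> 'a \<Rightarrow> real) \<Rightarrow> real \<Rightarrow> real \<Rightarrow> real \<Rightarrow> real \<Rightarrow> real \<Rightarrow>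
   ('a \<Rightarrow> real) \<Rightarrow> (real \<Rightarrow> 'a \<Rightarrow> real) \<Rightarrow> bool" where
  "pantograph_solution M B a b \<sigma> \<rho> q X0 X \<longleftrightarrow>
     (\<forall>t\<ge>0. X t \<in> borel_measurable (natural_filtration M X0 B t)) \<and>
     (AE \<omega> in M. continuous_on {0..} (\<lambda>t. X t \<omega>)) \<and>
     (AE \<omega> in M. X 0 \<omega> = X0 \<omega>) \<and>
     (\<forall>t\<ge>0. \<exists>Y.
        has_ito_integral M (natural_filtration M X0 B) B
          (\<lambda>s \<omega>. \<sigma> * X s \<omega> + \<rho> * X (q * s) \<omega>) t Y \<and>
        (AE \<omega> in M. X t \<omega> =
           X0 \<omega> + (LINT s:{0..t}|lborel. a * X s \<omega> + b * X (q * s) \<omega>) + Y \<omega>))"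

end

theory Submission
  imports Defs
begin

text \<open>
  Let \<open>v(t)\<close> be \<open>E|X(t)|\<close> in case (i) and \<open>E|X(t)|\<^sup>2\<close> in case (ii). Both satisfy
  \<open>v(t) \<le> v(s) + (t - s) (- A v(s) + B v(q s)) + O((t - s)\<^sup>3\<^sup>/\<^sup>2)\<close> for \<open>s < t\<close>, where \<open>\<alpha>\<close> solves
  \<open>B q\<^sup>\<alpha> = A\<close>, and \<open>v\<close> is compared with the supersolutions \<open>(t - 1)\<^sup>\<alpha>\<close> if \<open>\<alpha> \<ge> 0\<close> and \<open>(t + c)\<^sup>\<alpha>\<close>,
  with \<open>c\<close> large, if \<open>\<alpha> < 0\<close>.

  The inequality for \<open>v\<close> needs no Ito formula. On a short interval write
  \<open>X(t) = X(s) + (t - s) D(s) + H(s) (B(t) - B(s)) + R\<close> with drift \<open>D\<close> and diffusion coefficient \<open>H\<close>;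
  then \<open>E R\<^sup>2 = O((t - s)\<^sup>2)\<close>, and \<open>E \<xi> R = O((t - s)\<^sup>3\<^sup>/\<^sup>2)\<close> for square integrable \<open>\<xi>\<close> known at time
  \<open>s\<close>. Squaring gives case (ii), with \<open>2 x y \<le> z x\<^sup>2 + y\<^sup>2 / z\<close> for the mixed term. In case (i) \<open>H = \<sigma> X\<close>,
  so \<open>|X(t)|\<close> is \<open>\<plusminus> X(t)\<close>, with the sign of \<open>X(s)\<close>, up to the event that the sign changes; that
  event contributes \<open>O((t - s)\<^sup>3\<^sup>/\<^sup>2)\<close>, because the noise degenerates where \<open>X\<close> is small.

  All moment bounds are obtained by Fatou's lemma from discrete martingale transforms: along suitable
  partitions the sums of \<open>D dt + H dB\<close> with left end points converge almost surely to the increments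
  of \<open>X\<close>. Finiteness of the second moments follows by cutting the coefficients off on the event
  that the path has exceeded a level \<open>N\<close>.
\<close>

section \<open>Linear pantograph inequalities\<close>

text \<open>The definition gives the Ito integral separately for every \<open>t\<close>, as a limit
  in probability of integrals of simple processes about which nothing else is known; neither an
  isometry nor a martingale in \<open>t\<close> comes with it. The last sections therefore show
  that, for the continuous integrands of the equation, sums with left end points converge in
  probability along all partitions of mesh O(1 / k) that contain the jump times of the k-th simple
  process. Partitions common to \<open>s\<close> and \<open>t\<close> give the equation for
  increments, and a subsequence gives almost sure convergence. Of the exponent 3/2 it only matters
  that it is larger than 1: n steps of length 1 / n then contribute a total error that tends to 0,
  which is what a comparison argument needs in place of a derivative of \<open>v\<close>. A power
  w(t) = t^\<alpha> with B q^\<alpha> = A makes - A w(t) + B w(q t) vanish, while its derivative is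
  of lower order; the shift of the argument decides the sign at this lower order.\<close>

lemma nonincreasing_of_superlinear_increments:
  fixes g :: "real \<Rightarrow> real"
  assumes st: "s \<le> t" and \<delta>: "0 < \<delta>"
    and step: "\<And>u u'. s \<le> u \<Longrightarrow> u < u' \<Longrightarrow> u' \<le> t \<Longrightarrow> u' - u \<le> \<delta> \<Longrightarrow>
                 g u' \<le> g u + C * ((u' - u) * sqrt (u' - u))"
  shows "g t \<le> g s"
proof (cases "s = t")
  case False
  with st have st: "s < t" by simp
  define h where "h n = (t - s) / real n" for n :: nat
  \<comment> \<open>The n errors C h^(3/2) add up to n h C sqrt h = C (t - s) sqrt h, which tends to
    0 as the number of steps grows. This stands in for integrating a nonpositive derivative.\<close>
  have bound: "g t \<le> g s + C * ((t - s) * sqrt (h n))" if n: "n > 0" "h n \<le> \<delta>" for n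
  proof -
    have hpos: "h n > 0" using st n by (simp add: h_def)
    have "g (s + real i * h n) \<le> g s + real i * (C * (h n * sqrt (h n)))" if "i \<le> n" for i
      using that
    proof (induction i)
      case (Suc i)
      have "s + real (Suc i) * h n \<le> s + real n * h n"
        using Suc.prems hpos by (intro add_left_mono mult_right_mono) auto
      also have "\<dots> = t" using n by (simp add: h_def)
      finally have le: "s + real (Suc i) * h n \<le> t" .
      have "g (s + real (Suc i) * h n) \<le> g (s + real i * h n) + C * (h n * sqrt (h n))"
        using step[of "s + real i * h n" "s + real (Suc i) * h n"] le hpos n
        by (simp add: algebra_simps)
      with Suc show ?case by (simp add: algebra_simps)
    qed simp
    from this[of n] have "g (s + real n * h n) \<le> g s + real n * (C * (h n * sqrt (h n)))" by simp
    moreover have *: "real n * h n = t - s" using n by (simp add: h_def)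
    moreover have "real n * (C * (h n * sqrt (h n))) = C * ((real n * h n) * sqrt (h n))" by simp
    ultimately show ?thesis unfolding * by simp
  qed
  have h0: "h \<longlonglongrightarrow> 0" unfolding h_def by (rule lim_const_over_n)
  have "(\<lambda>n. g s + C * ((t - s) * sqrt (h n))) \<longlonglongrightarrow> g s + C * ((t - s) * sqrt 0)"
    by (intro tendsto_intros h0)
  moreover have "\<forall>\<^sub>F n in sequentially. g t \<le> g s + C * ((t - s) * sqrt (h n))"
    using order_tendstoD(2)[OF h0 \<delta>] eventually_gt_at_top[of 0]
    by eventually_elim (auto intro: bound)
  ultimately have "g t \<le> g s + C * ((t - s) * sqrt 0)"
    by (rule tendsto_lowerbound) simp
  then show ?thesis by simp
qed simp

text \<open>After scaling to u = x / y this is convexity of a negative power: ln u <= u - 1 is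
  reversed by \<alpha> < 0, and 1 + z <= exp z is applied to z = \<alpha> ln u. It serves both to
  bound the increment of the decaying supersolution over a step h and to compare powers at t + c and
  t + c / q.\<close>

lemma powr_tangent_le:
  fixes x y \<alpha> :: real
  assumes "\<alpha> < 0" "0 < x" "0 < y"
  shows "y powr \<alpha> + \<alpha> * y powr (\<alpha> - 1) * (x - y) \<le> x powr \<alpha>"
proof -
  define u where "u = x / y"
  have u: "u > 0" using assms by (simp add: u_def)
  have "1 + \<alpha> * (u - 1) \<le> 1 + \<alpha> * ln u"
    using ln_le_minus_one[OF u] assms by (simp add: mult_left_mono_neg)
  also have "\<dots> \<le> u powr \<alpha>"
    using u exp_ge_add_one_self[of "\<alpha> * ln u"] by (simp add: powr_def)
  finally have "y powr \<alpha> * (1 + \<alpha> * (u - 1)) \<le> y powr \<alpha> * u powr \<alpha>"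
    by (intro mult_left_mono) auto
  also have "\<dots> = x powr \<alpha>"
    using assms by (simp add: u_def powr_divide)
  also have "y powr \<alpha> * (1 + \<alpha> * (u - 1)) = y powr \<alpha> + \<alpha> * y powr (\<alpha> - 1) * (x - y)"
    using assms by (simp add: u_def powr_diff field_simps)
  finally show ?thesis .
qed

text \<open>\<open>step\<close> replaces the differential inequality v' <= - A v + B v(q t), so that
  no differentiability of moments has to be shown. \<open>C\<close> and \<open>\<delta>\<close> may
  depend on \<open>T\<close>, because the moments of the process are at first bounded on bounded
  time intervals only.\<close>

locale pantograph_inequality =
  fixes v :: "real \<Rightarrow> real" and A B q :: real
  assumes q: "0 < q" "q < 1" and A: "0 < A" and B: "0 \<le> B"
    and cont: "continuous_on {0..} v" and v_nonneg: "\<And>t. 0 \<le> t \<Longrightarrow> 0 \<le> v t"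
    and step: "\<And>T. \<exists>C \<delta>. 0 < \<delta> \<and> (\<forall>s t. 0 \<le> s \<longrightarrow> s < t \<longrightarrow> t \<le> T \<longrightarrow> t - s \<le> \<delta> \<longrightarrow>
      v t \<le> v s + (t - s) * (- A * v s + B * v (q * s)) + C * ((t - s) * sqrt (t - s)))"
begin

text \<open>Method of steps: the delayed argument of a time up to t0 / q^(n + 1) is at most t0 /
  q^n, where the comparison is already known, so the delay term favours \<open>w\<close>. What
  remains is a comparison without delay: wherever v exceeds w, - A v is at most - A w, and the
  difference cannot grow.\<close>

lemma compare_supersolution:
  assumes t0: "0 < t0" and cont_w: "continuous_on {t0..} w"
    and w: "\<And>t h. t0 \<le> t \<Longrightarrow> 0 < h \<Longrightarrow> w t + h * (- A * w t + B * w (q * t)) \<le> w (t + h)"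
    and init: "\<And>t. q * t0 \<le> t \<Longrightarrow> t \<le> t0 \<Longrightarrow> v t \<le> w t"
    and t: "q * t0 \<le> t"
  shows "v t \<le> w t"
proof -
  have main: "v t \<le> w t" if "q * t0 \<le> t" "t \<le> t0 / q ^ n" for n t
    using that
  proof (induction n arbitrary: t)
    case 0
    then show ?case using init by simp
  next
    case (Suc n)
    have prev: "v (q * u) \<le> w (q * u)" if "t0 \<le> u" "u \<le> t" for u
    proof (rule Suc.IH)
      show "q * t0 \<le> q * u" using that q by (intro mult_left_mono) auto
      have "q * u \<le> q * (t0 / q ^ Suc n)" using that Suc.prems q by (intro mult_left_mono) auto
      also have "\<dots> = t0 / q ^ n" using q by simp
      finally show "q * u \<le> t0 / q ^ n" .
    qed
    show ?case
    proof (rule ccontr)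
      assume "\<not> v t \<le> w t"
      define d where "d u = v u - w u" for u
      have dt: "d t > 0" using \<open>\<not> v t \<le> w t\<close> by (simp add: d_def)
      have tt0: "t0 < t" using init[OF Suc.prems(1)] \<open>\<not> v t \<le> w t\<close> by force
      have cd: "continuous_on {t0..t} d" unfolding d_def
        using t0 by (intro continuous_intros continuous_on_subset[OF cont] continuous_on_subset[OF cont_w]) auto
      \<comment> \<open>The supremum \<open>s\<close> of this set is the last time with v <= w. By
        continuity the difference is 0 at \<open>s\<close> and positive afterwards, so it would have
        to rise from 0 to \<open>d t\<close> although each increment is bounded by a multiple of the
        3/2 power of its step.\<close>
      define S where "S = {t0..t} \<inter> d -` {..0}"
      have clS: "closed S" unfolding S_def
        by (rule continuous_closed_preimage[OF cd]) auto
      have "t0 \<in> S" using init[of t0] q t0 tt0 by (auto simp: S_def d_def mult_le_cancel_right2)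
      have bdd: "bdd_above S" by (auto simp: S_def)
      define s where "s = Sup S"
      have sS: "s \<in> S" unfolding s_def
        using clS \<open>t0 \<in> S\<close> bdd by (intro closed_contains_Sup) auto
      then have s: "t0 \<le> s" "s \<le> t" "d s \<le> 0" by (auto simp: S_def)
      have pos: "d u > 0" if "s < u" "u \<le> t" for u
      proof (rule ccontr)
        assume "\<not> d u > 0"
        then have "u \<in> S" using that s by (auto simp: S_def)
        then have "u \<le> s" unfolding s_def using bdd by (intro cSup_upper)
        with that show False by simp
      qed
      have ds: "d s = 0"
      proof (rule ccontr)
        assume "d s \<noteq> 0"
        have "\<exists>x\<ge>s. x \<le> t \<and> d x = 0"
          using s dt by (intro IVT' continuous_on_subset[OF cd]) auto
        then obtain x where "s \<le> x" "x \<le> t" "d x = 0" by auto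
        with pos[of x] \<open>d s \<noteq> 0\<close> show False by (cases "x = s") auto
      qed
      obtain C \<delta> where \<delta>: "0 < \<delta>" and st: "\<And>s u. 0 \<le> s \<Longrightarrow> s < u \<Longrightarrow> u \<le> t \<Longrightarrow> u - s \<le> \<delta> \<Longrightarrow>
          v u \<le> v s + (u - s) * (- A * v s + B * v (q * s)) + C * ((u - s) * sqrt (u - s))"
        using step[of t] by blast
      have "d t \<le> d s"
      proof (rule nonincreasing_of_superlinear_increments[where g = d and s = s and t = t and C = C and \<delta> = \<delta>])
        fix u u' assume u: "s \<le> u" "u < u'" "u' \<le> t" "u' - u \<le> \<delta>"
        have du: "0 \<le> d u" using pos[of u] ds u by (cases "u = s") auto
        have "v u' \<le> v u + (u' - u) * (- A * v u + B * v (q * u)) + C * ((u' - u) * sqrt (u' - u))"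
          using u s t0 by (intro st) auto
        moreover have "w u + (u' - u) * (- A * w u + B * w (q * u)) \<le> w u'"
          using w[of u "u' - u"] u s by simp
        moreover have "A * w u \<le> A * v u" using du A by (simp add: d_def)
        moreover have "B * v (q * u) \<le> B * w (q * u)" using prev[of u] u s B by (intro mult_left_mono) auto
        moreover have "(u' - u) * (- A * v u + B * v (q * u)) \<le> (u' - u) * (- A * w u + B * w (q * u))"
          using u calculation by (intro mult_left_mono) auto
        ultimately show "d u' \<le> d u + C * ((u' - u) * sqrt (u' - u))"
          unfolding d_def by linarith
      qed (use s \<delta> in auto)
      with ds dt show False by simp
    qed
  qed
  obtain n where "t / t0 < (1 / q) ^ n"
    using real_arch_pow[of "1 / q" "t / t0"] q by auto
  then have "t \<le> t0 / q ^ n" using t0 q by (simp add: field_simps)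
  with main t show ?thesis by blast
qed

text \<open>\<open>compare_supersolution\<close> wants an initial interval [q t0, t0] with t0 > 0,
  whereas here only the value at 0 is at hand. Enlarging the factor \<open>v 0\<close> by
  \<open>\<epsilon>\<close> gives a strict inequality at 0, which by continuity persists on an
  interval. Its length depends on \<open>\<epsilon>\<close>, but the conclusion does not and
  survives the limit. The case v 0 = 0 is included.\<close>

lemma compare_positive_supersolution:
  assumes cont_w: "continuous_on {0..} w"
    and w: "\<And>t h. 0 \<le> t \<Longrightarrow> 0 < h \<Longrightarrow> w t + h * (- A * w t + B * w (q * t)) \<le> w (t + h)"
    and w0: "w 0 = 1" and t: "0 \<le> t"
  shows "v t \<le> v 0 * w t"
proof -
  have eps: "v t \<le> (v 0 + \<epsilon>) * w t" if \<epsilon>: "\<epsilon> > 0" for \<epsilon>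
  proof -
    define W where "W u = (v 0 + \<epsilon>) * w u" for u
    have cW: "continuous_on {0..} W" unfolding W_def by (intro continuous_intros cont_w)
    have "continuous_on {0..} (\<lambda>u. W u - v u)" by (intro continuous_intros cont cW)
    then have "((\<lambda>u. W u - v u) \<longlongrightarrow> W 0 - v 0) (at 0 within {0..})"
      by (auto simp: continuous_on_def)
    moreover have "W 0 - v 0 > 0" using \<epsilon> w0 by (simp add: W_def)
    ultimately have "\<forall>\<^sub>F u in at 0 within {0..}. W u - v u > 0"
      by (rule order_tendstoD(1))
    then obtain \<delta> where \<delta>: "\<delta> > 0" "\<And>u. 0 < u \<Longrightarrow> u < \<delta> \<Longrightarrow> v u < W u"
      by (auto simp: eventually_at dist_real_def)
    have small: "v u \<le> W u" if "0 \<le> u" "u < \<delta>" for u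
      using \<delta>(2)[of u] that \<open>W 0 - v 0 > 0\<close> by (cases "u = 0") auto
    show ?thesis
    proof (cases "t < \<delta> / 2")
      case True
      then show ?thesis using small[of t] t \<delta> by (simp add: W_def)
    next
      case False
      have "v t \<le> W t"
      proof (rule compare_supersolution[of "\<delta> / 2"])
        show "continuous_on {\<delta> / 2..} W" using \<delta> by (intro continuous_on_subset[OF cW]) auto
        fix u h :: real assume "\<delta> / 2 \<le> u" "0 < h"
        then have "(v 0 + \<epsilon>) * (w u + h * (- A * w u + B * w (q * u))) \<le> (v 0 + \<epsilon>) * w (u + h)"
          using \<delta> \<epsilon> v_nonneg[of 0] by (intro mult_left_mono w) auto
        then show "W u + h * (- A * W u + B * W (q * u)) \<le> W (u + h)"
          by (simp add: W_def algebra_simps)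
      next
        have "q * (\<delta> / 2) \<le> \<delta> / 2" using q \<delta> by (intro mult_left_le_one_le) auto
        then show "q * (\<delta> / 2) \<le> t" using False by linarith
      next
        fix u assume "q * (\<delta> / 2) \<le> u" "u \<le> \<delta> / 2"
        moreover have "0 < q * (\<delta> / 2)" using q \<delta> by simp
        ultimately show "v u \<le> W u" using \<delta> by (intro small) linarith+
      qed (use \<delta> in auto)
      then show ?thesis by (simp add: W_def)
    qed
  qed
  have "((\<lambda>\<epsilon>. (v 0 + \<epsilon>) * w t) \<longlongrightarrow> (v 0 + 0) * w t) (at_right 0)"
    by (intro tendsto_intros)
  moreover have "\<forall>\<^sub>F \<epsilon> in at_right 0. v t \<le> (v 0 + \<epsilon>) * w t"
    using eps by (auto simp: eventually_at_filter)
  ultimately have "v t \<le> (v 0 + 0) * w t"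
    by (rule tendsto_lowerbound) simp
  then show ?thesis by simp
qed

text \<open>exp (B t) does not decrease, so its delayed value is at most the present one and its
  growth rate B alone pays for the delay term; the damping by A is dropped. The bound is used on a
  bounded time range and, for B = 0, as v t <= v 0.\<close>

lemma exp_bound: "0 \<le> t \<Longrightarrow> v t \<le> v 0 * exp (B * t)"
proof (rule compare_positive_supersolution)
  fix t h :: real assume t: "0 \<le> t" "0 < h"
  have "q * t \<le> t" using q t by (simp add: mult_left_le_one_le)
  then have "B * (q * t) \<le> B * t" using B by (intro mult_left_mono) auto
  then have "B * exp (B * (q * t)) \<le> B * exp (B * t)" using B by (intro mult_left_mono) auto
  moreover have "0 \<le> A * exp (B * t)" using A by simp
  ultimately have "- A * exp (B * t) + B * exp (B * (q * t)) \<le> B * exp (B * t)"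
    by linarith
  then have "exp (B * t) + h * (- A * exp (B * t) + B * exp (B * (q * t))) \<le> exp (B * t) + h * (B * exp (B * t))"
    using t by (intro add_left_mono mult_left_mono) auto
  also have "\<dots> = exp (B * t) * (1 + B * h)" by (simp add: algebra_simps)
  also have "\<dots> \<le> exp (B * t) * exp (B * h)" by (intro mult_left_mono exp_ge_add_one_self) auto
  also have "\<dots> = exp (B * (t + h))" by (simp add: algebra_simps exp_add)
  finally show "exp (B * t) + h * (- A * exp (B * t) + B * exp (B * (q * t))) \<le> exp (B * (t + h))" .
qed (auto intro!: continuous_intros)

text \<open>With B q^\<alpha> = A the two terms of the inequality cancel on t^\<alpha> to leading
  order, and a shift of the argument settles the rest. For \<alpha> < 0 the shift must also beat the
  negative derivative of the power; for \<alpha> >= 0 the power does not decrease and a shift by 1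
  to the left is enough.\<close>

lemma polynomial_bound:
  assumes \<alpha>: "B * q powr \<alpha> = A"
  shows "\<exists>C>0. \<forall>t\<ge>0. v t \<le> C * v 0 * (1 + t) powr \<alpha>"
proof (cases "\<alpha> < 0")
  case True
  \<comment> \<open>Since B (q t + c)^\<alpha> = A (t + c / q)^\<alpha>, the right-hand side for
    \<open>w\<close> is A times a difference of powers at points c (1 / q - 1) apart, of absolute
    value at least - \<alpha> A c (1 / q - 1) (t + c / q)^(\<alpha> - 1). It has to reach - \<alpha>
    (t + c)^(\<alpha> - 1), and \<open>c\<close> is large enough for that; the factor q^(1 -
    \<alpha>) pays for passing from t + c / q to t + c. The summand 1 gives c >= 1, used when t + c
    is replaced by 1 + t.\<close>
  define c where "c = 1 + 1 / (A * (1 / q - 1) * q powr (1 - \<alpha>))"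
  have den: "A * (1 / q - 1) * q powr (1 - \<alpha>) > 0" using A q by simp
  have c: "c \<ge> 1" unfolding c_def using den by simp
  have cA: "1 \<le> A * (c * (1 / q - 1) * q powr (1 - \<alpha>))"
    using den by (simp add: c_def algebra_simps)
  define w where "w t = ((t + c) / c) powr \<alpha>" for t
  have key: "v t \<le> v 0 * w t" if "0 \<le> t" for t
  proof (rule compare_positive_supersolution)
    show "continuous_on {0..} w" unfolding w_def using c
      by (intro continuous_intros ballI) (auto simp: add_nonneg_eq_0_iff)
    show "w 0 = 1" using c by (simp add: w_def)
    fix t h :: real assume t: "0 \<le> t" "0 < h"
    define y where "y = t + c"
    have y: "y > 0" using t c by (simp add: y_def)
    have yq: "t + c / q \<le> y / q" "t + c / q > 0"
      using t c q by (auto simp: y_def field_simps intro: add_nonneg_pos add_pos_nonneg mult_left_le_one_le)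
    have "(y / q) powr (\<alpha> - 1) \<le> (t + c / q) powr (\<alpha> - 1)"
      using yq True by (intro powr_mono2') auto
    moreover have "(y / q) powr (\<alpha> - 1) = q powr (1 - \<alpha>) * y powr (\<alpha> - 1)"
      using powr_minus_divide[of q "\<alpha> - 1"] by (simp add: powr_divide)
    ultimately have mono: "q powr (1 - \<alpha>) * y powr (\<alpha> - 1) \<le> (t + c / q) powr (\<alpha> - 1)" by simp
    have tan: "(t + c / q) powr \<alpha> + \<alpha> * (t + c / q) powr (\<alpha> - 1) * (y - (t + c / q)) \<le> y powr \<alpha>"
      using powr_tangent_le[OF True y yq(2)] .
    have "- \<alpha> * y powr (\<alpha> - 1) * 1 \<le> - \<alpha> * y powr (\<alpha> - 1) * (A * (c * (1 / q - 1) * q powr (1 - \<alpha>)))"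
      using True by (intro mult_left_mono cA) (auto intro!: mult_nonpos_nonneg)
    also have "\<dots> = A * (- \<alpha> * (c * (1 / q - 1))) * (q powr (1 - \<alpha>) * y powr (\<alpha> - 1))"
      by (simp add: algebra_simps)
    also have "\<dots> \<le> A * (- \<alpha> * (c * (1 / q - 1))) * (t + c / q) powr (\<alpha> - 1)"
      using A True c q by (intro mult_left_mono mono mult_nonneg_nonneg) auto
    also have "\<dots> = A * (\<alpha> * (t + c / q) powr (\<alpha> - 1) * (y - (t + c / q)))"
      by (simp add: y_def algebra_simps)
    also have "\<dots> \<le> A * (y powr \<alpha> - (t + c / q) powr \<alpha>)"
      using tan A by (intro mult_left_mono) auto
    also have "\<dots> = A * y powr \<alpha> - B * (q * t + c) powr \<alpha>"
    proof -
      have "q * t + c = q * (t + c / q)" using q by (simp add: distrib_left)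
      then have "(q * t + c) powr \<alpha> = q powr \<alpha> * (t + c / q) powr \<alpha>"
        by (simp only: powr_mult)
      then show ?thesis by (simp add: algebra_simps flip: \<alpha>)
    qed
    finally have deriv: "- A * y powr \<alpha> + B * (q * t + c) powr \<alpha> \<le> \<alpha> * y powr (\<alpha> - 1)" by simp
    have "y powr \<alpha> + h * (- A * y powr \<alpha> + B * (q * t + c) powr \<alpha>) \<le> y powr \<alpha> + h * (\<alpha> * y powr (\<alpha> - 1))"
      using deriv t by (intro add_left_mono mult_left_mono) auto
    also have "\<dots> \<le> (t + h + c) powr \<alpha>"
      using powr_tangent_le[OF True _ y, of "t + h + c"] t c by (simp add: y_def algebra_simps)
    finally have "(y powr \<alpha> + h * (- A * y powr \<alpha> + B * (q * t + c) powr \<alpha>)) / c powr \<alpha> \<le> (t + h + c) powr \<alpha> / c powr \<alpha>"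
      by (intro divide_right_mono) auto
    moreover have "w u = (u + c) powr \<alpha> / c powr \<alpha>" if "u \<ge> 0" for u
      using c that by (simp add: w_def powr_divide)
    ultimately show "w t + h * (- A * w t + B * w (q * t)) \<le> w (t + h)"
      using t q by (simp add: y_def add_divide_distrib diff_divide_distrib algebra_simps)
  qed (rule that)
  show ?thesis
  proof (intro exI[of _ "(1 / c) powr \<alpha>"] conjI allI impI)
    fix t :: real assume t: "0 \<le> t"
    have "w t \<le> ((1 + t) / c) powr \<alpha>" unfolding w_def
      using True c t by (intro powr_mono2' divide_right_mono) auto
    also have "\<dots> = (1 / c) powr \<alpha> * (1 + t) powr \<alpha>"
      using c t by (simp add: powr_divide)
    finally have "v 0 * w t \<le> v 0 * ((1 / c) powr \<alpha> * (1 + t) powr \<alpha>)"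
      using v_nonneg[of 0] by (intro mult_left_mono) auto
    with key[OF t] show "v t \<le> (1 / c) powr \<alpha> * v 0 * (1 + t) powr \<alpha>" by (simp add: mult_ac)
  qed (use c in auto)
next
  case False
  \<comment> \<open>The comparison will start at t0 = 2 / q, so that its initial interval is
    [2, 2 / q]. There t - 1 >= 1, hence the power is at least 1, while \<open>exp_bound\<close>
    keeps v below v 0 * K.\<close>
  define K where "K = exp (B * (2 / q))"
  have K: "K > 0" "v 0 * K \<ge> 0" using v_nonneg[of 0] by (auto simp: K_def)
  have q2: "2 \<le> 2 / q" using q by (simp add: field_simps)
  have small: "v t \<le> v 0 * K" if "0 \<le> t" "t \<le> 2 / q" for t
  proof -
    have "v t \<le> v 0 * exp (B * t)" using that by (intro exp_bound)
    also have "\<dots> \<le> v 0 * K" unfolding K_def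
      using mult_left_mono[OF that(2) B] v_nonneg[of 0] by (intro mult_left_mono) auto
    finally show ?thesis .
  qed
  have large: "v t \<le> v 0 * K * (t - 1) powr \<alpha>" if "2 \<le> t" for t
  proof (rule compare_supersolution[of "2 / q" "\<lambda>t. v 0 * K * (t - 1) powr \<alpha>"])
    show "continuous_on {2 / q..} (\<lambda>t. v 0 * K * (t - 1) powr \<alpha>)"
      using q2 by (intro continuous_intros) auto
  next
    fix t h :: real assume t: "2 / q \<le> t" "0 < h"
    have t2: "2 \<le> t" using t q2 by linarith
    have t2q: "2 \<le> q * t" using t q by (simp add: field_simps)
    \<comment> \<open>At the delayed time the shift by 1 becomes a shift by 1 / q > 1. Hence - A
      w(t) + B w(q t) is nonpositive, while w does not decrease.\<close>
    have "q * (t - 1 / q) = q * t - 1" using q by (simp add: field_simps)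
    then have "(q * t - 1) powr \<alpha> = q powr \<alpha> * (t - 1 / q) powr \<alpha>"
      using q t2 by (metis powr_mult)
    then have "B * (q * t - 1) powr \<alpha> = A * (t - 1 / q) powr \<alpha>"
      by (simp add: mult.assoc flip: \<alpha>)
    also have "\<dots> \<le> A * (t - 1) powr \<alpha>"
      using False A t q by (intro mult_left_mono powr_mono2) (auto simp: field_simps)
    finally have "h * (- A * (t - 1) powr \<alpha> + B * (q * t - 1) powr \<alpha>) \<le> 0"
      using t by (simp add: mult_nonneg_nonpos)
    moreover have "(t - 1) powr \<alpha> \<le> (t + h - 1) powr \<alpha>"
      using False t t2 by (intro powr_mono2) auto
    ultimately have "v 0 * K * ((t - 1) powr \<alpha> + h * (- A * (t - 1) powr \<alpha> + B * (q * t - 1) powr \<alpha>))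
        \<le> v 0 * K * (t + h - 1) powr \<alpha>"
      using K by (intro mult_left_mono) auto
    then show "v 0 * K * (t - 1) powr \<alpha> + h * (- A * (v 0 * K * (t - 1) powr \<alpha>) + B * (v 0 * K * (q * t - 1) powr \<alpha>))
        \<le> v 0 * K * (t + h - 1) powr \<alpha>"
      by (simp add: algebra_simps)
  next
    fix t assume "q * (2 / q) \<le> t" "t \<le> 2 / q"
    then have t: "2 \<le> t" "t \<le> 2 / q" using q by auto
    have "1 \<le> (t - 1) powr \<alpha>" using t False by (intro ge_one_powr_ge_zero) auto
    with K have "v 0 * K * 1 \<le> v 0 * K * (t - 1) powr \<alpha>" by (intro mult_left_mono) auto
    with small[of t] t show "v t \<le> v 0 * K * (t - 1) powr \<alpha>" by simp
  qed (use q that in auto)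
  show ?thesis
  proof (intro exI[of _ K] conjI allI impI)
    fix t :: real assume t: "0 \<le> t"
    show "v t \<le> K * v 0 * (1 + t) powr \<alpha>"
    proof (cases "t \<le> 2")
      case True
      have "1 \<le> (1 + t) powr \<alpha>" using t False by (intro ge_one_powr_ge_zero) auto
      with K have "v 0 * K * 1 \<le> v 0 * K * (1 + t) powr \<alpha>" by (intro mult_left_mono) auto
      with small[of t] t True q2 show ?thesis by (simp add: mult_ac)
    next
      case False': False
      have "v 0 * K * (t - 1) powr \<alpha> \<le> v 0 * K * (1 + t) powr \<alpha>"
        using K False False' by (intro mult_left_mono powr_mono2) auto
      with large[of t] False' show ?thesis by (simp add: mult_ac)
    qed
  qed (use K in auto)
qed

end

section \<open>Square integrable random variables\<close>

definition L2 :: "'a measure \<Rightarrow> ('a \<Rightarrow> real) set" where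
  "L2 M = {f \<in> borel_measurable M. integrable M (\<lambda>x. (f x)\<^sup>2)}"

lemma L2_measurable [measurable_dest]: "f \<in> L2 M \<Longrightarrow> f \<in> borel_measurable M"
  and L2_integrable_power2: "f \<in> L2 M \<Longrightarrow> integrable M (\<lambda>x. (f x)\<^sup>2)"
  by (auto simp: L2_def)

lemma L2_bound:
  assumes "f \<in> borel_measurable M" "integrable M g" "\<And>x. x \<in> space M \<Longrightarrow> (f x)\<^sup>2 \<le> g x"
  shows "f \<in> L2 M"
  unfolding L2_def
proof (intro CollectI conjI)
  show "integrable M (\<lambda>x. (f x)\<^sup>2)"
    using assms(1) by (intro Bochner_Integration.integrable_bound[OF assms(2)] AE_I2)
      (auto intro: order_trans[OF assms(3)])
qed (rule assms)

lemma L2_mult_integrable: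
  assumes "f \<in> L2 M" "g \<in> L2 M"
  shows "integrable M (\<lambda>x. f x * g x)"
proof (rule Bochner_Integration.integrable_bound)
  show "integrable M (\<lambda>x. (f x)\<^sup>2 + (g x)\<^sup>2)"
    using assms by (auto dest: L2_integrable_power2)
  show "(\<lambda>x. f x * g x) \<in> borel_measurable M" using assms by (auto dest: L2_measurable)
  have "2 * \<bar>a * b\<bar> \<le> a\<^sup>2 + b\<^sup>2" for a b :: real
    using sum_squares_bound[of "\<bar>a\<bar>" "\<bar>b\<bar>"] by (simp add: abs_mult)
  then have "\<bar>a * b\<bar> \<le> a\<^sup>2 + b\<^sup>2" for a b :: real
    by (smt (verit) abs_ge_zero)
  then show "AE x in M. norm (f x * g x) \<le> norm ((f x)\<^sup>2 + (g x)\<^sup>2)"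
    by (intro AE_I2) auto
qed

lemma L2_cmult [intro]: "f \<in> L2 M \<Longrightarrow> (\<lambda>x. c * f x) \<in> L2 M"
  by (auto simp: L2_def power_mult_distrib)

lemma L2_cmult_right [intro]: "f \<in> L2 M \<Longrightarrow> (\<lambda>x. f x * c) \<in> L2 M"
  by (auto simp: L2_def power_mult_distrib)

lemma L2_add [intro]:
  assumes "f \<in> L2 M" "g \<in> L2 M"
  shows "(\<lambda>x. f x + g x) \<in> L2 M"
proof -
  have "integrable M (\<lambda>x. (f x)\<^sup>2 + (g x)\<^sup>2 + 2 * (f x * g x))"
    using assms
    by (intro Bochner_Integration.integrable_add integrable_mult_right L2_mult_integrable L2_integrable_power2)
  then show ?thesis using assms by (auto simp: L2_def power2_sum algebra_simps)
qed

lemma L2_diff [intro]: "f \<in> L2 M \<Longrightarrow> g \<in> L2 M \<Longrightarrow> (\<lambda>x. f x - g x) \<in> L2 M"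
  using L2_add[of f M "\<lambda>x. - 1 * g x"] L2_cmult[of g M "-1"] by simp

lemma L2_zero [intro, simp]: "(\<lambda>x. 0) \<in> L2 M"
  by (auto simp: L2_def)

lemma L2_sum [intro]: "(\<And>i. i \<in> I \<Longrightarrow> f i \<in> L2 M) \<Longrightarrow> (\<lambda>x. \<Sum>i\<in>I. f i x) \<in> L2 M"
  by (induction I rule: infinite_finite_induct) auto

lemma L2_indicator_mult [intro]:
  assumes "A \<in> sets M" "f \<in> L2 M"
  shows "(\<lambda>x. indicator A x * f x) \<in> L2 M"
  using assms by (intro L2_bound[OF _ L2_integrable_power2[OF assms(2)]]) (auto simp: indicator_def dest: L2_measurable)

lemma (in prob_space) L2_const [intro, simp]: "(\<lambda>x. c) \<in> L2 M"
  by (auto simp: L2_def)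

lemma (in prob_space) L2_integrable:
  assumes "f \<in> L2 M"
  shows "integrable M f"
  using L2_mult_integrable[OF assms L2_const[of 1]] by simp

abbreviation (in prob_space) second_moment :: "('a \<Rightarrow> real) \<Rightarrow> real" where
  "second_moment f \<equiv> expectation (\<lambda>\<omega>. (f \<omega>)\<^sup>2)"

lemma sum_power2_le: "(c * x + d * y)\<^sup>2 \<le> 2 * (c\<^sup>2 * x\<^sup>2 + d\<^sup>2 * y\<^sup>2)" for c d x y :: real
  using sum_squares_bound[of "c * x" "d * y"] by (simp add: power2_sum power_mult_distrib)

lemma (in prob_space) expectation_sum_power2_le:
  assumes "f \<in> L2 M" "g \<in> L2 M" "expectation (\<lambda>\<omega>. (f \<omega>)\<^sup>2) \<le> S" "expectation (\<lambda>\<omega>. (g \<omega>)\<^sup>2) \<le> S"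
  shows "expectation (\<lambda>\<omega>. (c * f \<omega> + d * g \<omega>)\<^sup>2) \<le> 2 * (c\<^sup>2 + d\<^sup>2) * S"
proof -
  have "expectation (\<lambda>\<omega>. (c * f \<omega> + d * g \<omega>)\<^sup>2) \<le> expectation (\<lambda>\<omega>. 2 * (c\<^sup>2 * (f \<omega>)\<^sup>2 + d\<^sup>2 * (g \<omega>)\<^sup>2))"
    using assms L2_integrable_power2[OF L2_add[OF L2_cmult[OF assms(1), of c] L2_cmult[OF assms(2), of d]]]
    by (intro integral_mono sum_power2_le integrable_mult_right Bochner_Integration.integrable_add L2_integrable_power2) auto
  also have "\<dots> = 2 * (c\<^sup>2 * expectation (\<lambda>\<omega>. (f \<omega>)\<^sup>2) + d\<^sup>2 * expectation (\<lambda>\<omega>. (g \<omega>)\<^sup>2))"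
    using assms by (simp add: L2_integrable_power2)
  also have "\<dots> \<le> 2 * (c\<^sup>2 * S + d\<^sup>2 * S)"
    using assms by (intro mult_left_mono add_mono) auto
  finally show ?thesis by (simp add: algebra_simps)
qed

lemma (in prob_space) expectation_abs_diff_le:
  fixes f g :: "'a \<Rightarrow> real"
  assumes "integrable M f" "integrable M g"
  shows "\<bar>expectation f - expectation g\<bar> \<le> expectation (\<lambda>\<omega>. \<bar>f \<omega> - g \<omega>\<bar>)"
  using assms integral_abs_bound[of M "\<lambda>\<omega>. f \<omega> - g \<omega>"] by simp

text \<open>Fatou's lemma for the squares: a uniform bound on second moments passes to the limit.
  The event \<open>E\<close> is meant for cut-off sums, whose limit is identified only where the
  cut-off has not acted.\<close>

lemma (in prob_space) L2_limit_on_event: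
  assumes E [measurable]: "E \<in> events" and Z [measurable]: "Z \<in> borel_measurable M"
    and u: "\<And>k::nat. u k \<in> L2 M" and bound: "\<And>k. expectation (\<lambda>x. (u k x)\<^sup>2) \<le> c"
    and lim: "AE x in M. x \<in> E \<longrightarrow> (\<lambda>k. u k x) \<longlonglongrightarrow> Z x"
  shows "(\<lambda>x. indicator E x * Z x) \<in> L2 M"
    and "expectation (\<lambda>x. (indicator E x * Z x)\<^sup>2) \<le> c"
proof -
  note [measurable] = u[THEN L2_measurable]
  have c: "0 \<le> c" using bound[of 0] by (rule order_trans[rotated]) simp
  have "(\<integral>\<^sup>+x. ennreal ((indicator E x * Z x)\<^sup>2) \<partial>M)
      \<le> (\<integral>\<^sup>+x. liminf (\<lambda>k. ennreal ((u k x)\<^sup>2)) \<partial>M)"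
  proof (rule nn_integral_mono_AE)
    show "AE x in M. ennreal ((indicator E x * Z x)\<^sup>2) \<le> liminf (\<lambda>k. ennreal ((u k x)\<^sup>2))"
      using lim
    proof eventually_elim
      case (elim x)
      show ?case
      proof (cases "x \<in> E")
        case True
        then have "(\<lambda>k. ennreal ((u k x)\<^sup>2)) \<longlonglongrightarrow> ennreal ((Z x)\<^sup>2)"
          using elim by (intro tendsto_ennrealI tendsto_power) auto
        then have "liminf (\<lambda>k. ennreal ((u k x)\<^sup>2)) = ennreal ((Z x)\<^sup>2)"
          by (intro lim_imp_Liminf) auto
        then show ?thesis using True by simp
      qed simp
    qed
  qed
  also have "\<dots> \<le> liminf (\<lambda>k. \<integral>\<^sup>+x. ennreal ((u k x)\<^sup>2) \<partial>M)"
    by (rule nn_integral_liminf) measurable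
  also have "\<dots> \<le> liminf (\<lambda>k::nat. ennreal c)"
  proof (rule Liminf_mono, rule always_eventually, rule allI)
    fix k
    have "(\<integral>\<^sup>+x. ennreal ((u k x)\<^sup>2) \<partial>M) = ennreal (expectation (\<lambda>x. (u k x)\<^sup>2))"
      using u by (intro nn_integral_eq_integral) (auto dest: L2_integrable_power2)
    also have "\<dots> \<le> ennreal c" using bound by (intro ennreal_leI)
    finally show "(\<integral>\<^sup>+x. ennreal ((u k x)\<^sup>2) \<partial>M) \<le> ennreal c" .
  qed
  finally have le: "(\<integral>\<^sup>+x. ennreal ((indicator E x * Z x)\<^sup>2) \<partial>M) \<le> ennreal c"
    by (simp add: Liminf_const)
  have int: "integrable M (\<lambda>x. (indicator E x * Z x)\<^sup>2)"
    by (rule integrableI_nonneg) (use le in \<open>auto intro: le_less_trans\<close>)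
  then show "(\<lambda>x. indicator E x * Z x) \<in> L2 M" by (simp add: L2_def)
  have "ennreal (expectation (\<lambda>x. (indicator E x * Z x)\<^sup>2)) \<le> ennreal c"
    using le by (subst (asm) nn_integral_eq_integral[OF int]) auto
  then show "expectation (\<lambda>x. (indicator E x * Z x)\<^sup>2) \<le> c" using c by simp
qed

section \<open>Step integrals with respect to a Wiener process\<close>

lemma Int_stable_vimage: "Int_stable {f -` A \<inter> S | A. A \<in> sets N}"
proof (rule Int_stableI, safe)
  fix A C assume "A \<in> sets N" "C \<in> sets N"
  then show "\<exists>D. f -` A \<inter> S \<inter> (f -` C \<inter> S) = f -` D \<inter> S \<and> D \<in> sets N"
    by (intro exI[of _ "A \<inter> C"]) auto
qed

text \<open>The points increase strictly because the law and the independence of a Wiener increment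
  are stated for s < t. Values of \<open>p\<close> beyond index \<open>m\<close> are free, so that a
  partition of [0, t] passing through \<open>s\<close> restricts to one of [0, s] with the same
  \<open>p\<close>.\<close>

definition time_partition :: "real \<Rightarrow> real \<Rightarrow> nat \<Rightarrow> (nat \<Rightarrow> real) \<Rightarrow> bool" where
  "time_partition s t m p \<longleftrightarrow> p 0 = s \<and> p m = t \<and> (\<forall>i<m. p i < p (Suc i))"

lemma time_partition_mono:
  assumes "time_partition s t m p" "i \<le> j" "j \<le> m"
  shows "p i \<le> p j"
  using assms(2,3)
proof (induction j)
  case (Suc j)
  then have "i \<le> j \<Longrightarrow> p i \<le> p j" "p j < p (Suc j)" using assms(1) by (auto simp: time_partition_def)
  with Suc.prems show ?case by (cases "i = Suc j") auto
qed auto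

text \<open>An abstract filtration hides from the estimates that the concrete one also contains
  \<open>X0\<close> and the null sets. Independence of a future increment from the past is stated
  for pairs of events, the form in which a generator argument delivers it.\<close>

locale wiener_filtration = prob_space M for M :: "'a measure" +
  fixes F :: "real \<Rightarrow> 'a measure" and B :: "real \<Rightarrow> 'a \<Rightarrow> real"
  assumes subalg: "0 \<le> s \<Longrightarrow> subalgebra M (F s)"
    and filtration_mono: "0 \<le> s \<Longrightarrow> s \<le> t \<Longrightarrow> sets (F s) \<subseteq> sets (F t)"
    and B_adapted: "0 \<le> t \<Longrightarrow> B t \<in> borel_measurable (F t)"
    and B_distributed: "0 \<le> s \<Longrightarrow> s < t \<Longrightarrow>
      distributed M lborel (\<lambda>\<omega>. B t \<omega> - B s \<omega>) (normal_density 0 (sqrt (t - s)))"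
    and B_indep: "0 \<le> s \<Longrightarrow> s < t \<Longrightarrow> A \<in> sets (F s) \<Longrightarrow> C \<in> sets borel \<Longrightarrow>
      prob (A \<inter> ((\<lambda>\<omega>. B t \<omega> - B s \<omega>) -` C \<inter> space M)) =
      prob A * prob ((\<lambda>\<omega>. B t \<omega> - B s \<omega>) -` C \<inter> space M)"
begin

lemma adapted_measurable: "0 \<le> s \<Longrightarrow> G \<in> borel_measurable (F s) \<Longrightarrow> G \<in> borel_measurable M"
  by (rule measurable_from_subalg[OF subalg])

lemma adapted_mono:
  assumes "0 \<le> s" "s \<le> t" "G \<in> borel_measurable (F s)"
  shows "G \<in> borel_measurable (F t)"
proof (rule measurable_from_subalg[OF _ assms(3)])
  show "subalgebra (F t) (F s)"
    using subalg[of s] subalg[of t] filtration_mono[of s t] assms by (auto simp: subalgebra_def)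
qed

lemma B_measurable [measurable]: "0 \<le> t \<Longrightarrow> B t \<in> borel_measurable M"
  using B_adapted adapted_measurable by blast

lemma filtration_events: "0 \<le> s \<Longrightarrow> A \<in> sets (F s) \<Longrightarrow> A \<in> events"
  using subalg[of s] by (auto simp: subalgebra_def)

lemma space_filtration: "0 \<le> s \<Longrightarrow> space (F s) = space M"
  using subalg[of s] by (auto simp: subalgebra_def)

lemma increment_indep_var:
  assumes s: "0 \<le> s" "s < t" and G: "G \<in> borel_measurable (F s)"
  shows "indep_var borel G borel (\<lambda>\<omega>. B t \<omega> - B s \<omega>)"
  unfolding indep_var_eq
proof (intro conjI indep_set_sigma_sets)
  have [measurable]: "G \<in> borel_measurable M" "B t \<in> borel_measurable M" "B s \<in> borel_measurable M"
    using s G by (auto intro: adapted_measurable)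
  show "random_variable borel G" "random_variable borel (\<lambda>\<omega>. B t \<omega> - B s \<omega>)" by measurable
  show "indep_set {G -` A \<inter> space M |A. A \<in> sets borel}
     {(\<lambda>\<omega>. B t \<omega> - B s \<omega>) -` A \<inter> space M |A. A \<in> sets borel}"
  proof (rule indep_setI, safe)
    fix A C :: "real set" assume A: "A \<in> sets borel" and C: "C \<in> sets borel"
    show "G -` A \<inter> space M \<in> events" using A by measurable
    show "(\<lambda>\<omega>. B t \<omega> - B s \<omega>) -` A \<inter> space M \<in> events" using A by measurable
    have "G -` A \<inter> space M \<in> sets (F s)"
      using measurable_sets[OF G A] s by (simp add: space_filtration)
    from B_indep[OF s this C]
    show "prob (G -` A \<inter> space M \<inter> ((\<lambda>\<omega>. B t \<omega> - B s \<omega>) -` C \<inter> space M)) =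
      prob (G -` A \<inter> space M) * prob ((\<lambda>\<omega>. B t \<omega> - B s \<omega>) -` C \<inter> space M)" .
  qed
  show "Int_stable {G -` A \<inter> space M |A. A \<in> sets borel}"
    "Int_stable {(\<lambda>\<omega>. B t \<omega> - B s \<omega>) -` A \<inter> space M |A. A \<in> sets borel}"
    by (rule Int_stable_vimage)+
qed

text \<open>The fourth moment serves to bound, in \<open>first_moment_step\<close>, the contribution
  of noise increments so large that they reverse the sign of X.\<close>

lemma increment_moments:
  assumes s: "0 \<le> s" "s < t"
  shows "integrable M (\<lambda>\<omega>. (B t \<omega> - B s \<omega>) ^ k)"
    and "expectation (\<lambda>\<omega>. B t \<omega> - B s \<omega>) = 0"
    and "expectation (\<lambda>\<omega>. (B t \<omega> - B s \<omega>)\<^sup>2) = t - s"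
    and "expectation (\<lambda>\<omega>. (B t \<omega> - B s \<omega>) ^ 4) = 3 * (t - s)\<^sup>2"
proof -
  have pos: "sqrt (t - s) > 0" using s by simp
  note D = B_distributed[OF s]
  have I: "integrable lborel (\<lambda>x. normal_density 0 (sqrt (t - s)) x * x ^ k)" for k
    using integrable_normal_moment[OF pos, of 0 k] by simp
  show "integrable M (\<lambda>\<omega>. (B t \<omega> - B s \<omega>) ^ k)"
    using distributed_integrable[OF D, of "\<lambda>x. x ^ k"] I[of k] by simp
  have E: "expectation (\<lambda>\<omega>. (B t \<omega> - B s \<omega>) ^ k) = (\<integral>x. normal_density 0 (sqrt (t - s)) x * x ^ k \<partial>lborel)" for k
    using distributed_integral[OF D, of "\<lambda>x. x ^ k"] by simp
  show "expectation (\<lambda>\<omega>. B t \<omega> - B s \<omega>) = 0"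
    using E[of 1] integral_normal_moment_nz_1[OF pos, of 0] by simp
  show "expectation (\<lambda>\<omega>. (B t \<omega> - B s \<omega>)\<^sup>2) = t - s"
    using E[of 2] integral_normal_moment_even[OF pos, of 0 1] s by simp
  show "expectation (\<lambda>\<omega>. (B t \<omega> - B s \<omega>) ^ 4) = 3 * (t - s)\<^sup>2"
    using E[of 4] integral_normal_moment_even[OF pos, of 0 2] s
    by (simp add: fact_numeral power2_eq_square field_simps)
qed

lemma adapted_times_increment:
  assumes s: "0 \<le> s" "s < t" and G: "G \<in> borel_measurable (F s)" "integrable M G"
  shows "integrable M (\<lambda>\<omega>. G \<omega> * (B t \<omega> - B s \<omega>) ^ k)"
    and "expectation (\<lambda>\<omega>. G \<omega> * (B t \<omega> - B s \<omega>) ^ k) = expectation G * expectation (\<lambda>\<omega>. (B t \<omega> - B s \<omega>) ^ k)"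
proof -
  have "indep_var borel ((\<lambda>x. x) \<circ> G) borel ((\<lambda>x. x ^ k) \<circ> (\<lambda>\<omega>. B t \<omega> - B s \<omega>))"
    by (rule indep_var_compose[OF increment_indep_var[OF s G(1)]]) auto
  then have I: "indep_var borel G borel (\<lambda>\<omega>. (B t \<omega> - B s \<omega>) ^ k)" by (simp add: comp_def)
  note * = indep_var_integrable[OF I G(2) increment_moments(1)[OF s]]
    indep_var_lebesgue_integral[OF I G(2) increment_moments(1)[OF s]]
  show "integrable M (\<lambda>\<omega>. G \<omega> * (B t \<omega> - B s \<omega>) ^ k)" using * by simp
  show "expectation (\<lambda>\<omega>. G \<omega> * (B t \<omega> - B s \<omega>) ^ k) = expectation G * expectation (\<lambda>\<omega>. (B t \<omega> - B s \<omega>) ^ k)"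
    using * by simp
qed

lemma increment_orthogonal:
  assumes "0 \<le> s" "s < t" "G \<in> borel_measurable (F s)" "integrable M G"
  shows "integrable M (\<lambda>\<omega>. G \<omega> * (B t \<omega> - B s \<omega>))"
    and "expectation (\<lambda>\<omega>. G \<omega> * (B t \<omega> - B s \<omega>)) = 0"
  using adapted_times_increment[OF assms, of 1] increment_moments(2)[OF assms(1,2)] by simp_all

lemma increment_isometry:
  assumes s: "0 \<le> s" "s < t" and G: "G \<in> borel_measurable (F s)" "G \<in> L2 M"
  shows "(\<lambda>\<omega>. G \<omega> * (B t \<omega> - B s \<omega>)) \<in> L2 M"
    and "expectation (\<lambda>\<omega>. (G \<omega> * (B t \<omega> - B s \<omega>))\<^sup>2) = (t - s) * second_moment G"
proof -
  have [measurable]: "G \<in> borel_measurable (F s)" "B t \<in> borel_measurable M" "B s \<in> borel_measurable M"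
    using s G by auto
  have G2: "(\<lambda>\<omega>. (G \<omega>)\<^sup>2) \<in> borel_measurable (F s)" by measurable
  note * = adapted_times_increment[OF s G2 L2_integrable_power2[OF G(2)], of 2]
  show "(\<lambda>\<omega>. G \<omega> * (B t \<omega> - B s \<omega>)) \<in> L2 M"
    using *(1) L2_measurable[OF G(2)] by (auto simp: L2_def power_mult_distrib)
  show "expectation (\<lambda>\<omega>. (G \<omega> * (B t \<omega> - B s \<omega>))\<^sup>2) = (t - s) * second_moment G"
    using *(2) increment_moments(3)[OF s] by (simp add: power_mult_distrib)
qed

text \<open>Discrete Ito isometry. All clauses share one induction: the new summand is orthogonal to
  every square integrable variable known at time p m, and applying this to S m itself takes the
  measurability and square integrability of S m from the induction hypothesis.\<close>

lemma martingale_transform: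
  fixes p :: "nat \<Rightarrow> real" and g :: "nat \<Rightarrow> 'a \<Rightarrow> real"
  defines "S \<equiv> \<lambda>m \<omega>. \<Sum>i<m. g i \<omega> * (B (p (Suc i)) \<omega> - B (p i) \<omega>)"
  assumes p0: "0 \<le> p 0" and p: "\<And>i. i < m \<Longrightarrow> p i < p (Suc i)"
    and g: "\<And>i. i < m \<Longrightarrow> g i \<in> borel_measurable (F (p i))" "\<And>i. i < m \<Longrightarrow> g i \<in> L2 M"
  shows "p 0 \<le> p m \<and> S m \<in> borel_measurable (F (p m)) \<and> S m \<in> L2 M \<and>
    second_moment (S m) = (\<Sum>i<m. (p (Suc i) - p i) * second_moment (g i)) \<and>
    (\<forall>\<xi>\<in>L2 M. \<xi> \<in> borel_measurable (F (p 0)) \<longrightarrow> expectation (\<lambda>\<omega>. \<xi> \<omega> * S m \<omega>) = 0)"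
  using p g
proof (induction m)
  case 0
  then show ?case by (simp add: S_def)
next
  case (Suc m)
  then have IH: "p 0 \<le> p m" "S m \<in> borel_measurable (F (p m))" "S m \<in> L2 M"
    "second_moment (S m) = (\<Sum>i<m. (p (Suc i) - p i) * second_moment (g i))"
    "\<And>\<xi>. \<xi> \<in> L2 M \<Longrightarrow> \<xi> \<in> borel_measurable (F (p 0)) \<Longrightarrow> expectation (\<lambda>\<omega>. \<xi> \<omega> * S m \<omega>) = 0"
    by auto
  have lt: "p m < p (Suc m)" and pm: "0 \<le> p m" using Suc.prems(1) IH(1) p0 by auto
  have gm: "g m \<in> borel_measurable (F (p m))" "g m \<in> L2 M" using Suc.prems by auto
  define W where "W \<omega> = g m \<omega> * (B (p (Suc m)) \<omega> - B (p m) \<omega>)" for \<omega>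
  have W: "W \<in> L2 M" "second_moment W = (p (Suc m) - p m) * second_moment (g m)"
    using increment_isometry[OF pm lt gm] by (simp_all add: W_def[abs_def])
  have S: "S (Suc m) = (\<lambda>\<omega>. S m \<omega> + W \<omega>)" by (simp add: S_def W_def fun_eq_iff)
  have orth: "expectation (\<lambda>\<omega>. \<xi> \<omega> * W \<omega>) = 0" if "\<xi> \<in> L2 M" "\<xi> \<in> borel_measurable (F (p m))" for \<xi>
  proof -
    have "(\<lambda>\<omega>. \<xi> \<omega> * g m \<omega>) \<in> borel_measurable (F (p m))" using that gm by measurable
    from increment_orthogonal(2)[OF pm lt this L2_mult_integrable[OF that(1) gm(2)]]
    show ?thesis by (simp add: W_def mult.assoc)
  qed
  have meas: "S (Suc m) \<in> borel_measurable (F (p (Suc m)))"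
  proof -
    have [measurable]: "S m \<in> borel_measurable (F (p (Suc m)))" "g m \<in> borel_measurable (F (p (Suc m)))"
      "B (p m) \<in> borel_measurable (F (p (Suc m)))" "B (p (Suc m)) \<in> borel_measurable (F (p (Suc m)))"
      using pm lt IH(2) gm(1) B_adapted by (auto intro: adapted_mono[of "p m"])
    show ?thesis unfolding S W_def by measurable
  qed
  have "expectation (\<lambda>\<omega>. (S (Suc m) \<omega>)\<^sup>2) = expectation (\<lambda>\<omega>. (S m \<omega>)\<^sup>2 + (W \<omega>)\<^sup>2 + 2 * (S m \<omega> * W \<omega>))"
    by (simp add: S power2_sum algebra_simps)
  also have "\<dots> = second_moment (S m) + second_moment W + 2 * expectation (\<lambda>\<omega>. S m \<omega> * W \<omega>)"
    using L2_mult_integrable[OF IH(3) W(1)] IH(3) W(1) by (simp add: L2_integrable_power2)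
  finally have E2: "expectation (\<lambda>\<omega>. (S (Suc m) \<omega>)\<^sup>2) =
      (\<Sum>i<Suc m. (p (Suc i) - p i) * second_moment (g i))"
    using orth[OF IH(3,2)] IH(4) W(2) by simp
  have "expectation (\<lambda>\<omega>. \<xi> \<omega> * S (Suc m) \<omega>) = 0" if "\<xi> \<in> L2 M" "\<xi> \<in> borel_measurable (F (p 0))" for \<xi>
  proof -
    have "expectation (\<lambda>\<omega>. \<xi> \<omega> * S (Suc m) \<omega>) = expectation (\<lambda>\<omega>. \<xi> \<omega> * S m \<omega>) + expectation (\<lambda>\<omega>. \<xi> \<omega> * W \<omega>)"
      using L2_mult_integrable[OF that(1) IH(3)] L2_mult_integrable[OF that(1) W(1)]
      by (simp add: S distrib_left)
    then show ?thesis using IH(5)[OF that] orth[OF that(1) adapted_mono[OF p0 IH(1) that(2)]] by simp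
  qed
  with meas E2 IH(1,3) W(1) lt show ?case by (auto simp: S)
qed

text \<open>Of the cross terms, that of \<xi> with the noise has mean 0, that of \<xi> with the
  drift is split by 2 x y <= \<mu> x^2 + y^2 / \<mu>, and that of drift with noise by 2 x y <= x^2 +
  y^2. Keeping \<mu> free later gives access to mixed moments with the past: for these the
  coefficient of the second moment of \<xi> must come close to 1.\<close>

lemma drift_noise_sum_bound:
  fixes m :: nat and p :: "nat \<Rightarrow> real" and d g :: "nat \<Rightarrow> 'a \<Rightarrow> real"
  defines "Z \<equiv> \<lambda>\<omega>. \<Sum>i<m. d i \<omega> * (p (Suc i) - p i) + g i \<omega> * (B (p (Suc i)) \<omega> - B (p i) \<omega>)"
  assumes p0: "0 \<le> p 0" and p: "\<And>i. i < m \<Longrightarrow> p i < p (Suc i)"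
    and g: "\<And>i. i < m \<Longrightarrow> g i \<in> borel_measurable (F (p i))" "\<And>i. i < m \<Longrightarrow> g i \<in> L2 M"
    and d: "\<And>i. i < m \<Longrightarrow> d i \<in> L2 M"
    and \<delta>: "\<And>i. i < m \<Longrightarrow> second_moment (d i) \<le> \<delta>"
    and \<gamma>: "\<And>i. i < m \<Longrightarrow> second_moment (g i) \<le> \<gamma>"
    and \<xi>: "\<xi> \<in> L2 M" "\<xi> \<in> borel_measurable (F (p 0))" and \<mu>: "\<mu> > 0"
  shows "(\<lambda>\<omega>. \<xi> \<omega> + Z \<omega>) \<in> L2 M"
    and "expectation (\<lambda>\<omega>. (\<xi> \<omega> + Z \<omega>)\<^sup>2) \<le>
      (1 + \<mu>) * second_moment \<xi> + (1 / \<mu> + 2) * ((p m - p 0)\<^sup>2 * \<delta>) + 2 * ((p m - p 0) * \<gamma>)"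
proof -
  define P where "P \<omega> = (\<Sum>i<m. d i \<omega> * (p (Suc i) - p i))" for \<omega>
  define Q where "Q \<omega> = (\<Sum>i<m. g i \<omega> * (B (p (Suc i)) \<omega> - B (p i) \<omega>))" for \<omega>
  have Z: "Z \<omega> = P \<omega> + Q \<omega>" for \<omega> by (simp add: Z_def P_def Q_def sum.distrib)
  have mt: "p 0 \<le> p m" "Q \<in> L2 M"
    "second_moment Q = (\<Sum>i<m. (p (Suc i) - p i) * second_moment (g i))"
    "\<And>\<xi>. \<xi> \<in> L2 M \<Longrightarrow> \<xi> \<in> borel_measurable (F (p 0)) \<Longrightarrow> expectation (\<lambda>\<omega>. \<xi> \<omega> * Q \<omega>) = 0"
    using martingale_transform[of p m g, OF p0 p g] unfolding Q_def[abs_def] by auto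
  have Q: "Q \<in> L2 M" using mt by simp
  have P: "P \<in> L2 M" unfolding P_def using d by (intro L2_sum L2_cmult_right) auto
  show "(\<lambda>\<omega>. \<xi> \<omega> + Z \<omega>) \<in> L2 M" unfolding Z using P Q \<xi> by (intro L2_add)
  have tel: "(\<Sum>i<m. p (Suc i) - p i) = p m - p 0"
    by (rule sum_lessThan_telescope)
  have Q2: "second_moment Q \<le> (p m - p 0) * \<gamma>"
  proof -
    have "second_moment Q = (\<Sum>i<m. (p (Suc i) - p i) * second_moment (g i))"
      using mt by simp
    also have "\<dots> \<le> (\<Sum>i<m. (p (Suc i) - p i) * \<gamma>)"
      using p \<gamma> by (intro sum_mono mult_left_mono) (auto simp: less_imp_le)
    finally show ?thesis by (simp add: tel flip: sum_distrib_right)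
  qed
  have P2: "second_moment P \<le> (p m - p 0)\<^sup>2 * \<delta>"
  proof -
    \<comment> \<open>Cauchy-Schwarz after splitting each step length into two square roots. The
      resulting bound involves only the total length p m - p 0 and not the number of steps, as the
      passage to the limit requires.\<close>
    have "(P \<omega>)\<^sup>2 \<le> (p m - p 0) * (\<Sum>i<m. (p (Suc i) - p i) * (d i \<omega>)\<^sup>2)" for \<omega>
    proof -
      have "(P \<omega>)\<^sup>2 = (\<Sum>i<m. sqrt (p (Suc i) - p i) * (sqrt (p (Suc i) - p i) * d i \<omega>))\<^sup>2"
        unfolding P_def using p
        by (intro arg_cong[where f = "\<lambda>x. x\<^sup>2"] sum.cong refl) (auto simp: less_imp_le simp flip: mult.assoc)
      also have "\<dots> \<le> (\<Sum>i<m. (sqrt (p (Suc i) - p i))\<^sup>2) * (\<Sum>i<m. (sqrt (p (Suc i) - p i) * d i \<omega>)\<^sup>2)"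
        by (rule Cauchy_Schwarz_ineq_sum)
      also have "(\<Sum>i<m. (sqrt (p (Suc i) - p i))\<^sup>2) = p m - p 0"
        unfolding tel[symmetric] using p by (intro sum.cong) (auto simp: less_imp_le)
      also have "(\<Sum>i<m. (sqrt (p (Suc i) - p i) * d i \<omega>)\<^sup>2) = (\<Sum>i<m. (p (Suc i) - p i) * (d i \<omega>)\<^sup>2)"
        using p by (intro sum.cong) (auto simp: less_imp_le power_mult_distrib)
      finally show ?thesis .
    qed
    then have "second_moment P \<le> expectation (\<lambda>\<omega>. (p m - p 0) * (\<Sum>i<m. (p (Suc i) - p i) * (d i \<omega>)\<^sup>2))"
      using P d
      by (intro integral_mono integrable_mult_right Bochner_Integration.integrable_sum L2_integrable_power2) auto
    also have "\<dots> = (p m - p 0) * (\<Sum>i<m. (p (Suc i) - p i) * second_moment (d i))"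
      using d by (simp add: L2_integrable_power2)
    also have "\<dots> \<le> (p m - p 0) * (\<Sum>i<m. (p (Suc i) - p i) * \<delta>)"
      using p \<delta> mt by (intro mult_left_mono sum_mono) (auto simp: less_imp_le)
    finally show ?thesis by (simp add: tel power2_eq_square mult.assoc flip: sum_distrib_right)
  qed
  have pw: "(\<xi> \<omega> + Z \<omega>)\<^sup>2 \<le> (1 + \<mu>) * (\<xi> \<omega>)\<^sup>2 + (1 / \<mu> + 2) * (P \<omega>)\<^sup>2 + 2 * (Q \<omega>)\<^sup>2 + 2 * (\<xi> \<omega> * Q \<omega>)" for \<omega>
  proof -
    have "0 \<le> (\<mu> * \<xi> \<omega> - P \<omega>)\<^sup>2 / \<mu> + (P \<omega> - Q \<omega>)\<^sup>2" using \<mu> by simp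
    also have "\<dots> = \<mu> * (\<xi> \<omega>)\<^sup>2 + (P \<omega>)\<^sup>2 / \<mu> - 2 * \<xi> \<omega> * P \<omega> + (P \<omega> - Q \<omega>)\<^sup>2"
      using \<mu> by (simp add: field_simps power2_eq_square)
    finally show ?thesis unfolding Z by (simp add: power2_eq_square algebra_simps)
  qed
  have \<xi>Q: "integrable M (\<lambda>\<omega>. \<xi> \<omega> * Q \<omega>)" by (rule L2_mult_integrable[OF \<xi>(1) Q])
  have "expectation (\<lambda>\<omega>. (\<xi> \<omega> + Z \<omega>)\<^sup>2) \<le> expectation (\<lambda>\<omega>. (1 + \<mu>) * (\<xi> \<omega>)\<^sup>2 + (1 / \<mu> + 2) * (P \<omega>)\<^sup>2 + 2 * (Q \<omega>)\<^sup>2 + 2 * (\<xi> \<omega> * Q \<omega>))"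
    using \<open>(\<lambda>\<omega>. \<xi> \<omega> + Z \<omega>) \<in> L2 M\<close> P Q \<xi> \<xi>Q pw
    by (intro integral_mono Bochner_Integration.integrable_add integrable_mult_right) (auto dest: L2_integrable_power2)
  also have "\<dots> = (1 + \<mu>) * second_moment \<xi> + (1 / \<mu> + 2) * second_moment P + 2 * second_moment Q"
    using P Q \<xi> \<xi>Q mt by (simp add: L2_integrable_power2)
  also have "\<dots> \<le> (1 + \<mu>) * second_moment \<xi> + (1 / \<mu> + 2) * ((p m - p 0)\<^sup>2 * \<delta>) + 2 * ((p m - p 0) * \<gamma>)"
    using P2 Q2 \<mu> by (intro add_mono mult_left_mono) auto
  finally show "expectation (\<lambda>\<omega>. (\<xi> \<omega> + Z \<omega>)\<^sup>2) \<le>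
      (1 + \<mu>) * second_moment \<xi> + (1 / \<mu> + 2) * ((p m - p 0)\<^sup>2 * \<delta>) + 2 * ((p m - p 0) * \<gamma>)" .
qed

abbreviation riemann_ito_sum :: "nat \<Rightarrow> (nat \<Rightarrow> real) \<Rightarrow> (real \<Rightarrow> 'a \<Rightarrow> real) \<Rightarrow> (real \<Rightarrow> 'a \<Rightarrow> real) \<Rightarrow> 'a \<Rightarrow> real" where
  "riemann_ito_sum m p d g \<omega> \<equiv>
    \<Sum>i<m. d (p i) \<omega> * (p (Suc i) - p i) + g (p i) \<omega> * (B (p (Suc i)) \<omega> - B (p i) \<omega>)"

text \<open>The quantitative substitute for the Ito isometry: \<open>Z\<close> plays the role of
  \<open>\<integral>\<^sub>s\<^sup>t d\<^sub>u du + \<integral>\<^sub>s\<^sup>t g\<^sub>u dB\<^sub>u\<close>, and the noise part is orthogonal to the past \<open>\<xi>\<close>.\<close>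

lemma drift_noise_limit_bound:
  fixes d g :: "real \<Rightarrow> 'a \<Rightarrow> real" and p :: "nat \<Rightarrow> nat \<Rightarrow> real"
  assumes s: "0 \<le> s" and part: "\<And>k. time_partition s t (m k) (p k)"
    and g: "\<And>u. s \<le> u \<Longrightarrow> u \<le> t \<Longrightarrow> g u \<in> borel_measurable (F u)" "\<And>u. s \<le> u \<Longrightarrow> u \<le> t \<Longrightarrow> g u \<in> L2 M"
    and d: "\<And>u. s \<le> u \<Longrightarrow> u \<le> t \<Longrightarrow> d u \<in> L2 M"
    and \<delta>: "\<And>u. s \<le> u \<Longrightarrow> u \<le> t \<Longrightarrow> second_moment (d u) \<le> \<delta>"
    and \<gamma>: "\<And>u. s \<le> u \<Longrightarrow> u \<le> t \<Longrightarrow> second_moment (g u) \<le> \<gamma>"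
    and \<xi>: "\<xi> \<in> L2 M" "\<xi> \<in> borel_measurable (F s)" and \<mu>: "\<mu> > 0"
    and E: "E \<in> events" and Z: "Z \<in> borel_measurable M"
    and lim: "AE \<omega> in M. \<omega> \<in> E \<longrightarrow> (\<lambda>k. riemann_ito_sum (m k) (p k) d g \<omega>) \<longlonglongrightarrow> Z \<omega>"
  shows "(\<lambda>\<omega>. indicator E \<omega> * (\<xi> \<omega> + Z \<omega>)) \<in> L2 M"
    and "expectation (\<lambda>\<omega>. (indicator E \<omega> * (\<xi> \<omega> + Z \<omega>))\<^sup>2) \<le>
      (1 + \<mu>) * second_moment \<xi> + (1 / \<mu> + 2) * ((t - s)\<^sup>2 * \<delta>) + 2 * ((t - s) * \<gamma>)"
proof -
  define u where "u k \<omega> = \<xi> \<omega> + (riemann_ito_sum (m k) (p k) d g \<omega>)" for k \<omega>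
  have pk: "p k 0 = s" "p k (m k) = t" "\<And>i. i < m k \<Longrightarrow> p k i < p k (Suc i)"
    "\<And>i. i < m k \<Longrightarrow> s \<le> p k i \<and> p k i \<le> t" for k
    using part[of k] time_partition_mono[OF part, of 0 _ k] time_partition_mono[OF part, of _ "m k" k]
    by (auto simp: time_partition_def)
  have u: "u k \<in> L2 M" "second_moment (u k) \<le>
      (1 + \<mu>) * second_moment \<xi> + (1 / \<mu> + 2) * ((t - s)\<^sup>2 * \<delta>) + 2 * ((t - s) * \<gamma>)" for k
    unfolding u_def
    using drift_noise_sum_bound[of "p k" "m k" "\<lambda>i. g (p k i)" "\<lambda>i. d (p k i)" \<delta> \<gamma> \<xi> \<mu>]
      s pk(1,2)[of k] pk(3,4)[of _ k] g d \<delta> \<gamma> \<xi> \<mu> by simp_all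
  have "AE \<omega> in M. \<omega> \<in> E \<longrightarrow> (\<lambda>k. u k \<omega>) \<longlonglongrightarrow> \<xi> \<omega> + Z \<omega>"
    using lim by eventually_elim (auto simp: u_def intro!: tendsto_intros)
  moreover have "(\<lambda>\<omega>. \<xi> \<omega> + Z \<omega>) \<in> borel_measurable M"
    using Z \<xi>(1) by (auto dest: L2_measurable)
  ultimately show "(\<lambda>\<omega>. indicator E \<omega> * (\<xi> \<omega> + Z \<omega>)) \<in> L2 M"
    and "expectation (\<lambda>\<omega>. (indicator E \<omega> * (\<xi> \<omega> + Z \<omega>))\<^sup>2) \<le>
      (1 + \<mu>) * second_moment \<xi> + (1 / \<mu> + 2) * ((t - s)\<^sup>2 * \<delta>) + 2 * ((t - s) * \<gamma>)"
    using L2_limit_on_event[OF E _ u] by auto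
qed

end

section \<open>A priori moment bounds\<close>

text \<open>The stochastic equation enters through \<open>riemann_ito_approx\<close> alone: each
  pair s < t has partitions of its own along which the sums converge almost surely to the increment
  of X. Continuity is asked of every path, so that bounds over a whole time interval are measurable
  events; a solution is changed on a null set to achieve it.\<close>

locale pantograph_process = wiener_filtration M F B
  for M :: "'a measure" and F and B :: "real \<Rightarrow> 'a \<Rightarrow> real" +
  fixes X :: "real \<Rightarrow> 'a \<Rightarrow> real" and a b \<sigma> \<rho> q :: real
  assumes q: "0 < q" "q < 1"
    and X_adapted: "0 \<le> t \<Longrightarrow> X t \<in> borel_measurable (F t)"
    and X_cont: "\<omega> \<in> space M \<Longrightarrow> continuous_on {0..} (\<lambda>t. X t \<omega>)"
    and X0_L2: "X 0 \<in> L2 M"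
    and riemann_ito_approx: "0 \<le> s \<Longrightarrow> s < t \<Longrightarrow> \<exists>m p. (\<forall>k. time_partition s t (m k) (p k)) \<and>
      (AE \<omega> in M. (\<lambda>k. \<Sum>i<m k. (a * X (p k i) \<omega> + b * X (q * p k i) \<omega>) * (p k (Suc i) - p k i) +
         (\<sigma> * X (p k i) \<omega> + \<rho> * X (q * p k i) \<omega>) * (B (p k (Suc i)) \<omega> - B (p k i) \<omega>))
       \<longlonglongrightarrow> X t \<omega> - X s \<omega>)"
begin

definition drift :: "real \<Rightarrow> 'a \<Rightarrow> real" where
  "drift u \<omega> = a * X u \<omega> + b * X (q * u) \<omega>"

definition noise :: "real \<Rightarrow> 'a \<Rightarrow> real" where
  "noise u \<omega> = \<sigma> * X u \<omega> + \<rho> * X (q * u) \<omega>"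

lemma delay_bounds: "0 \<le> u \<Longrightarrow> 0 \<le> q * u" "0 \<le> u \<Longrightarrow> q * u \<le> u"
  using q by (auto simp: mult_left_le_one_le)

lemma X_measurable [measurable]: "0 \<le> t \<Longrightarrow> X t \<in> borel_measurable M"
  using X_adapted adapted_measurable by blast

lemma X_delay_adapted: "0 \<le> u \<Longrightarrow> X (q * u) \<in> borel_measurable (F u)"
  using adapted_mono[OF delay_bounds(1) delay_bounds(2) X_adapted] delay_bounds by blast

lemma drift_adapted: "0 \<le> u \<Longrightarrow> drift u \<in> borel_measurable (F u)"
  and noise_adapted: "0 \<le> u \<Longrightarrow> noise u \<in> borel_measurable (F u)"
  using X_adapted[of u] X_delay_adapted[of u] unfolding drift_def[abs_def] noise_def[abs_def] by measurable

definition bounded_until :: "real \<Rightarrow> real \<Rightarrow> 'a set" where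
  "bounded_until N u = {\<omega> \<in> space M. \<forall>r\<in>{0..u}. \<bar>X r \<omega>\<bar> \<le> N}"

lemma bounded_until_antimono: "r \<le> u \<Longrightarrow> bounded_until N u \<subseteq> bounded_until N r"
  by (auto simp: bounded_until_def)

text \<open>A violation of the bound persists near its time by continuity, hence occurs at a time x
  * u with rational x in [0, 1]. Scaling by u keeps all test times in [0, u], where X is measurable
  for F u.\<close>

lemma bounded_until_sets:
  assumes u: "0 \<le> u"
  shows "bounded_until N u \<in> sets (F u)"
proof -
  have "bounded_until N u = {\<omega> \<in> space (F u). \<forall>x\<in>\<rat> \<inter> {0..1}. \<bar>X (x * u) \<omega>\<bar> \<le> N}"
    unfolding bounded_until_def space_filtration[OF u]
  proof (rule Collect_cong, rule conj_cong, rule refl)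
    fix \<omega> assume \<omega>: "\<omega> \<in> space M"
    show "(\<forall>r\<in>{0..u}. \<bar>X r \<omega>\<bar> \<le> N) \<longleftrightarrow> (\<forall>x\<in>\<rat> \<inter> {0..1}. \<bar>X (x * u) \<omega>\<bar> \<le> N)"
    proof (intro iffI ballI)
      fix r assume all: "\<forall>x\<in>\<rat> \<inter> {0..1}. \<bar>X (x * u) \<omega>\<bar> \<le> N" and r: "r \<in> {0..u}"
      show "\<bar>X r \<omega>\<bar> \<le> N"
      proof (cases "u = 0")
        case True
        then show ?thesis using all r by force
      next
        case False
        with u have u0: "u > 0" by simp
        show ?thesis
        proof (rule ccontr)
          assume "\<not> \<bar>X r \<omega>\<bar> \<le> N"
          moreover have "((\<lambda>t. \<bar>X t \<omega>\<bar>) \<longlongrightarrow> \<bar>X r \<omega>\<bar>) (at r within {0..})"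
            using X_cont[OF \<omega>] r by (intro tendsto_rabs) (auto simp: continuous_on_def)
          ultimately have "\<forall>\<^sub>F t in at r within {0..}. \<bar>X t \<omega>\<bar> > N"
            by (intro order_tendstoD(1)) auto
          then obtain e where e: "e > 0" "\<And>t. 0 \<le> t \<Longrightarrow> t \<noteq> r \<Longrightarrow> dist t r < e \<Longrightarrow> \<bar>X t \<omega>\<bar> > N"
            by (auto simp: eventually_at)
          then have e': "\<bar>X t \<omega>\<bar> > N" if "0 \<le> t" "dist t r < e" for t
            using that \<open>\<not> \<bar>X r \<omega>\<bar> \<le> N\<close> by (cases "t = r") auto
          have "max 0 (r - e) / u < min u (r + e) / u"
            using e u0 r by (intro divide_strict_right_mono) auto
          then obtain x where x: "x \<in> \<rat>" "max 0 (r - e) / u < x" "x < min u (r + e) / u"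
            using Rats_dense_in_real by blast
          then have "max 0 (r - e) < x * u" "x * u < min u (r + e)"
            using u0 by (auto simp: field_simps)
          moreover from this have "x \<in> {0..1}" using u0 by (auto simp: zero_less_mult_iff)
          ultimately show False
            using all x(1) e'[of "x * u"] by (force simp: dist_real_def)
        qed
      qed
    qed (use u in \<open>auto simp: mult_left_le_one_le\<close>)
  qed
  also have "\<dots> \<in> sets (F u)"
  proof -
    have [measurable]: "X (x * u) \<in> borel_measurable (F u)" if "x \<in> \<rat> \<inter> {0..1}" for x
      using that u by (intro adapted_mono[OF _ _ X_adapted]) (auto simp: mult_left_le_one_le)
    have "countable (\<rat> \<inter> {0..1::real})" by (intro countable_Int1 countable_rat)
    then show ?thesis by measurable
  qed
  finally show ?thesis .
qed

lemma bounded_until_L2: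
  assumes "0 \<le> u" "0 \<le> r" "r \<le> u"
  shows "(\<lambda>\<omega>. indicator (bounded_until N u) \<omega> * X r \<omega>) \<in> L2 M"
    and "expectation (\<lambda>\<omega>. (indicator (bounded_until N u) \<omega> * X r \<omega>)\<^sup>2) \<le> N\<^sup>2"
proof -
  have [measurable]: "bounded_until N u \<in> events"
    using bounded_until_sets filtration_events assms by blast
  have pw: "(indicator (bounded_until N u) \<omega> * X r \<omega>)\<^sup>2 \<le> N\<^sup>2" for \<omega>
  proof (cases "\<omega> \<in> bounded_until N u")
    case True
    then have "\<bar>X r \<omega>\<bar> \<le> N" using assms by (auto simp: bounded_until_def)
    then have "\<bar>X r \<omega>\<bar>\<^sup>2 \<le> N\<^sup>2" by (intro power_mono) auto
    then show ?thesis using True by simp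
  qed simp
  show L2: "(\<lambda>\<omega>. indicator (bounded_until N u) \<omega> * X r \<omega>) \<in> L2 M"
    using assms by (intro L2_bound[of _ _ "\<lambda>_. N\<^sup>2"] pw) measurable
  have "expectation (\<lambda>\<omega>. (indicator (bounded_until N u) \<omega> * X r \<omega>)\<^sup>2) \<le> expectation (\<lambda>\<omega>. N\<^sup>2)"
    using L2 pw by (intro integral_mono) (auto dest: L2_integrable_power2)
  then show "expectation (\<lambda>\<omega>. (indicator (bounded_until N u) \<omega> * X r \<omega>)\<^sup>2) \<le> N\<^sup>2"
    by (simp add: prob_space)
qed

text \<open>The process stopped at level \<open>N\<close> is replaced by its restriction to the decreasing events
  \<open>bounded_until N u\<close>: they are adapted, and on \<open>bounded_until N t\<close> the cut-off integrands
  produce the same sums as the original ones.\<close>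

lemma truncated_moment_step:
  defines "L \<equiv> \<lambda>N u. expectation (\<lambda>\<omega>. (indicator (bounded_until N u) \<omega> * X u \<omega>)\<^sup>2)"
  defines "h0 \<equiv> 1 / (1 + 8 * (6 * (a\<^sup>2 + b\<^sup>2) + 4 * (\<sigma>\<^sup>2 + \<rho>\<^sup>2)))"
  assumes s: "0 \<le> s" and K: "0 \<le> K" "\<And>u. 0 \<le> u \<Longrightarrow> u \<le> s \<Longrightarrow> L N u \<le> K"
    and u: "0 \<le> u" "u \<le> s + h0"
  shows "L N u \<le> 4 * K"
proof -
  \<comment> \<open>6 = 3 * 2 and 4 = 2 * 2: the first factors 3 and 2 come from
    \<open>drift_noise_limit_bound\<close> with \<mu> = 1, the second from (x + y)^2 <= 2 x^2 + 2
    y^2 in the coefficients. With h0 c <= 1 / 8 the increment contributes at most S / 4 to the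
    moment.\<close>
  define c where "c = 6 * (a\<^sup>2 + b\<^sup>2) + 4 * (\<sigma>\<^sup>2 + \<rho>\<^sup>2)"
  have c: "0 \<le> c" by (simp add: c_def)
  have h0: "0 < h0" "h0 \<le> 1" "h0 * c \<le> 1 / 8"
    using c unfolding h0_def c_def[symmetric] by (auto simp: field_simps)
  \<comment> \<open>The supremum runs over all of [0, s + h0], because the coefficients at time u
    also involve time q u. It is finite since cut-off moments are at most N^2; this justifies
    absorbing S / 4 into the left-hand side at the end, and N does not enter the result.\<close>
  define S where "S = (SUP u\<in>{0..s + h0}. L N u)"
  have bdd: "bdd_above (L N ` {0..s + h0})"
    using bounded_until_L2(2) by (intro bdd_aboveI2[of _ _ "N\<^sup>2"]) (auto simp: L_def)
  have LS: "L N u \<le> S" if "0 \<le> u" "u \<le> s + h0" for u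
    unfolding S_def using that by (intro cSUP_upper bdd) auto
  have S0: "0 \<le> S" using LS[of 0] s h0 by (rule_tac order_trans[of _ "L N 0"]) (auto simp: L_def)
  have step: "L N t \<le> 2 * K + S / 4" if t: "0 \<le> t" "t \<le> s + h0" for t
  proof (cases "t \<le> s")
    case True
    then show ?thesis using K(2)[of t] t K(1) S0 by simp
  next
    case False
    then have st: "s < t" by simp
    obtain m p where part: "\<And>k. time_partition s t (m k) (p k)" and
      lim: "AE \<omega> in M. (\<lambda>k. riemann_ito_sum (m k) (p k) drift noise \<omega>) \<longlonglongrightarrow> X t \<omega> - X s \<omega>"
      using riemann_ito_approx[OF s st] unfolding drift_def noise_def by blast
    define A where "A = bounded_until N"
    have A_sets: "A u \<in> sets (F u)" "A u \<in> events" if "0 \<le> u" for u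
      using bounded_until_sets[OF that] filtration_events[OF that] by (auto simp: A_def)
    have dom: "(\<lambda>\<omega>. indicator (A u) \<omega> * (c1 * X u \<omega> + c2 * X (q * u) \<omega>)) \<in> L2 M"
      "expectation (\<lambda>\<omega>. (indicator (A u) \<omega> * (c1 * X u \<omega> + c2 * X (q * u) \<omega>))\<^sup>2) \<le> 2 * (c1\<^sup>2 + c2\<^sup>2) * S"
      if "0 \<le> u" "u \<le> t" for u c1 c2
    proof -
      let ?f = "\<lambda>\<omega>. indicator (A u) \<omega> * X u \<omega>" and ?g = "\<lambda>\<omega>. indicator (A u) \<omega> * X (q * u) \<omega>"
      have f: "?f \<in> L2 M" and g: "?g \<in> L2 M" using bounded_until_L2(1)[of u] delay_bounds that by (auto simp: A_def)
      have eq: "indicator (A u) \<omega> * (c1 * X u \<omega> + c2 * X (q * u) \<omega>) = c1 * ?f \<omega> + c2 * ?g \<omega>" for \<omega>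
        by (simp add: algebra_simps)
      have "second_moment ?f \<le> S" using LS[of u] that t by (simp add: L_def A_def)
      moreover have "second_moment ?g \<le> L N (q * u)"
      proof -
        have sub: "A u \<subseteq> A (q * u)" unfolding A_def using delay_bounds that by (intro bounded_until_antimono) auto
        have "(?g \<omega>)\<^sup>2 \<le> (indicator (A (q * u)) \<omega> * X (q * u) \<omega>)\<^sup>2" for \<omega>
          using sub by (auto simp: indicator_def)
        then show ?thesis unfolding L_def A_def[symmetric]
          using g bounded_until_L2(1)[of "q * u" "q * u" N] delay_bounds that
          by (intro integral_mono) (auto simp: A_def dest: L2_integrable_power2)
      qed
      moreover have "L N (q * u) \<le> S" using that t delay_bounds[of u] by (intro LS) linarith+
      ultimately show "expectation (\<lambda>\<omega>. (indicator (A u) \<omega> * (c1 * X u \<omega> + c2 * X (q * u) \<omega>))\<^sup>2) \<le> 2 * (c1\<^sup>2 + c2\<^sup>2) * S"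
        unfolding eq using f g by (intro expectation_sum_power2_le) auto
      show "(\<lambda>\<omega>. indicator (A u) \<omega> * (c1 * X u \<omega> + c2 * X (q * u) \<omega>)) \<in> L2 M"
        unfolding eq using f g by (intro L2_add L2_cmult)
    qed
    define d where "d u \<omega> = indicator (A u) \<omega> * drift u \<omega>" for u \<omega>
    define g where "g u \<omega> = indicator (A u) \<omega> * noise u \<omega>" for u \<omega>
    have lim': "AE \<omega> in M. \<omega> \<in> A t \<longrightarrow> (\<lambda>k. riemann_ito_sum (m k) (p k) d g \<omega>) \<longlonglongrightarrow> X t \<omega> - X s \<omega>"
      using lim
    proof eventually_elim
      case (elim \<omega>)
      show ?case
      proof
        assume \<omega>: "\<omega> \<in> A t"
        have "\<omega> \<in> A (p k i)" if "i < m k" for i k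
          using bounded_until_antimono[of "p k i" t N] time_partition_mono[OF part, of i "m k" k] that \<omega> part[of k]
          by (auto simp: A_def time_partition_def)
        then have "(\<lambda>k. riemann_ito_sum (m k) (p k) d g \<omega>) =
          (\<lambda>k. riemann_ito_sum (m k) (p k) drift noise \<omega>)"
          by (intro ext sum.cong) (auto simp: d_def g_def)
        with elim show "(\<lambda>k. riemann_ito_sum (m k) (p k) d g \<omega>) \<longlonglongrightarrow> X t \<omega> - X s \<omega>" by simp
      qed
    qed
    have g_meas: "g u \<in> borel_measurable (F u)" if "0 \<le> u" for u
      using A_sets(1)[OF that] noise_adapted[OF that] unfolding g_def by measurable
    have "expectation (\<lambda>\<omega>. (indicator (A t) \<omega> * (0 + (X t \<omega> - X s \<omega>)))\<^sup>2) \<le>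
       (1 + 1) * expectation (\<lambda>\<omega>. 0\<^sup>2) + (1 / 1 + 2) * ((t - s)\<^sup>2 * (2 * (a\<^sup>2 + b\<^sup>2) * S)) + 2 * ((t - s) * (2 * (\<sigma>\<^sup>2 + \<rho>\<^sup>2) * S))"
    and L2': "(\<lambda>\<omega>. indicator (A t) \<omega> * (0 + (X t \<omega> - X s \<omega>))) \<in> L2 M"
      using drift_noise_limit_bound[OF s part, of g d "2 * (a\<^sup>2 + b\<^sup>2) * S" "2 * (\<sigma>\<^sup>2 + \<rho>\<^sup>2) * S" "\<lambda>_. 0" 1 "A t" "\<lambda>\<omega>. X t \<omega> - X s \<omega>"]
        lim' g_meas dom[of _ a b] dom[of _ \<sigma> \<rho>] A_sets s t
      unfolding d_def g_def drift_def[symmetric] noise_def[symmetric] by auto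
    then have "expectation (\<lambda>\<omega>. (indicator (A t) \<omega> * (X t \<omega> - X s \<omega>))\<^sup>2) \<le>
        (6 * ((t - s)\<^sup>2 * (a\<^sup>2 + b\<^sup>2)) + 4 * ((t - s) * (\<sigma>\<^sup>2 + \<rho>\<^sup>2))) * S"
      by (simp add: algebra_simps)
    also have "\<dots> \<le> (6 * (h0 * (a\<^sup>2 + b\<^sup>2)) + 4 * (h0 * (\<sigma>\<^sup>2 + \<rho>\<^sup>2))) * S"
    proof -
      have "(t - s)\<^sup>2 \<le> (t - s) * 1" unfolding power2_eq_square
        using st t h0 by (intro mult_left_mono) auto
      then have "(t - s)\<^sup>2 \<le> h0" "t - s \<le> h0" using t by auto
      then show ?thesis using S0 by (intro mult_right_mono add_mono mult_left_mono) auto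
    qed
    also have "\<dots> = (h0 * c) * S" by (simp add: c_def algebra_simps)
    also have "\<dots> \<le> (1 / 8) * S" using h0(3) S0 by (intro mult_right_mono)
    finally have diff: "expectation (\<lambda>\<omega>. (indicator (A t) \<omega> * (X t \<omega> - X s \<omega>))\<^sup>2) \<le> S / 8" by simp
    let ?Y = "\<lambda>\<omega>. indicator (A s) \<omega> * X s \<omega>"
    have Y: "?Y \<in> L2 M" using bounded_until_L2(1)[of s s N] s by (simp add: A_def)
    have "L N t \<le> expectation (\<lambda>\<omega>. 2 * (indicator (A t) \<omega> * (X t \<omega> - X s \<omega>))\<^sup>2 + 2 * (?Y \<omega>)\<^sup>2)"
      unfolding L_def A_def[symmetric]
    proof (rule integral_mono)
      show "integrable M (\<lambda>\<omega>. (indicator (A t) \<omega> * X t \<omega>)\<^sup>2)"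
        using bounded_until_L2(1)[of t t N] t by (auto simp: A_def dest: L2_integrable_power2)
      show "integrable M (\<lambda>\<omega>. 2 * (indicator (A t) \<omega> * (X t \<omega> - X s \<omega>))\<^sup>2 + 2 * (?Y \<omega>)\<^sup>2)"
        using L2' Y by (intro Bochner_Integration.integrable_add integrable_mult_right L2_integrable_power2) auto
      fix \<omega>
      have "(X t \<omega>)\<^sup>2 \<le> 2 * (X t \<omega> - X s \<omega>)\<^sup>2 + 2 * (X s \<omega>)\<^sup>2"
        using sum_power2_le[of 1 "X t \<omega> - X s \<omega>" 1 "X s \<omega>"] by simp
      then show "(indicator (A t) \<omega> * X t \<omega>)\<^sup>2 \<le> 2 * (indicator (A t) \<omega> * (X t \<omega> - X s \<omega>))\<^sup>2 + 2 * (?Y \<omega>)\<^sup>2"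
        using bounded_until_antimono[of s t N] st by (auto simp: indicator_def A_def)
    qed
    also have "\<dots> = 2 * expectation (\<lambda>\<omega>. (indicator (A t) \<omega> * (X t \<omega> - X s \<omega>))\<^sup>2) + 2 * L N s"
      using L2' Y by (simp add: L_def A_def L2_integrable_power2)
    also have "\<dots> \<le> 2 * (S / 8) + 2 * K" using diff K(2)[of s] s by (intro add_mono mult_left_mono) auto
    finally show ?thesis by simp
  qed
  have "S \<le> 2 * K + S / 4" unfolding S_def
    using s h0 step by (intro cSUP_least) (auto simp: S_def)
  then have "S \<le> 4 * K" using K(1) by simp
  with LS[OF u] show ?thesis by simp
qed

text \<open>The step length h0 of \<open>truncated_moment_step\<close> depends on the coefficients
  alone, so finitely many steps reach T, with a bound 4^n * K0 that is the same for all cut-off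
  levels. Each path is bounded on [0, t], so the cut-offs exhaust the space and
  \<open>L2_limit_on_event\<close> removes them.\<close>

lemma moment_bound: "\<exists>K\<ge>0. \<forall>t. 0 \<le> t \<longrightarrow> t \<le> T \<longrightarrow> X t \<in> L2 M \<and> second_moment (X t) \<le> K"
proof -
  define h0 where "h0 = 1 / (1 + 8 * (6 * (a\<^sup>2 + b\<^sup>2) + 4 * (\<sigma>\<^sup>2 + \<rho>\<^sup>2)))"
  have h0: "h0 > 0" unfolding h0_def by (simp add: add_pos_nonneg)
  define K0 where "K0 = second_moment (X 0)"
  have K0: "0 \<le> K0" by (simp add: K0_def)
  have trunc: "expectation (\<lambda>\<omega>. (indicator (bounded_until N u) \<omega> * X u \<omega>)\<^sup>2) \<le> 4 ^ n * K0"
    if "0 \<le> u" "u \<le> real n * h0" for N u n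
    using that
  proof (induction n arbitrary: u)
    case 0
    then have [simp]: "u = 0" by simp
    have "expectation (\<lambda>\<omega>. (indicator (bounded_until N u) \<omega> * X u \<omega>)\<^sup>2) \<le> second_moment (X 0)"
      using X0_L2 bounded_until_L2(1)[of u u N]
      by (intro integral_mono) (auto simp: indicator_def dest: L2_integrable_power2)
    then show ?case by (simp add: K0_def)
  next
    case (Suc n)
    have "expectation (\<lambda>\<omega>. (indicator (bounded_until N u) \<omega> * X u \<omega>)\<^sup>2) \<le> 4 * (4 ^ n * K0)"
    proof (rule truncated_moment_step[where s = "real n * h0"])
      show "u \<le> real n * h0 + 1 / (1 + 8 * (6 * (a\<^sup>2 + b\<^sup>2) + 4 * (\<sigma>\<^sup>2 + \<rho>\<^sup>2)))"
        using Suc.prems unfolding h0_def[symmetric] by (simp add: algebra_simps)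
      show "expectation (\<lambda>\<omega>. (indicator (bounded_until N u) \<omega> * X u \<omega>)\<^sup>2) \<le> 4 ^ n * K0"
        if "0 \<le> u" "u \<le> real n * h0" for u
        using that by (rule Suc.IH)
    qed (use Suc.prems K0 h0 in simp_all)
    then show ?case by simp
  qed
  obtain n where "T / h0 \<le> real n" using real_arch_simple by blast
  then have n: "T \<le> real n * h0" using h0 by (simp add: field_simps)
  show ?thesis
  proof (intro exI[of _ "4 ^ n * K0"] conjI allI impI)
    fix t assume t: "0 \<le> t" "t \<le> T"
    have lim: "AE \<omega> in M. \<omega> \<in> space M \<longrightarrow>
        (\<lambda>k. indicator (bounded_until (real k) t) \<omega> * X t \<omega>) \<longlonglongrightarrow> X t \<omega>"
    proof (intro AE_I2 impI)
      fix \<omega> assume \<omega>: "\<omega> \<in> space M"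
      have "compact ((\<lambda>t. X t \<omega>) ` {0..t})"
        by (intro compact_continuous_image continuous_on_subset[OF X_cont[OF \<omega>]]) auto
      then have "bounded ((\<lambda>t. X t \<omega>) ` {0..t})" by (rule compact_imp_bounded)
      then obtain N where "\<forall>x\<in>(\<lambda>t. X t \<omega>) ` {0..t}. norm x \<le> N"
        unfolding bounded_iff by (elim exE)
      then have N: "\<And>r. r \<in> {0..t} \<Longrightarrow> \<bar>X r \<omega>\<bar> \<le> N" by auto
      obtain k0 where k0: "N \<le> real k0" using real_arch_simple by blast
      have "\<forall>\<^sub>F k in sequentially. indicator (bounded_until (real k) t) \<omega> * X t \<omega> = X t \<omega>"
        using eventually_ge_at_top[of k0]
      proof eventually_elim
        case (elim k)
        then have "N \<le> real k" using k0 by simp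
        then have "\<omega> \<in> bounded_until (real k) t"
          using order_trans[OF N] \<omega> by (auto simp: bounded_until_def)
        then show ?case by simp
      qed
      then show "(\<lambda>k. indicator (bounded_until (real k) t) \<omega> * X t \<omega>) \<longlonglongrightarrow> X t \<omega>"
        by (rule tendsto_eventually)
    qed
    note * = L2_limit_on_event[OF sets.top X_measurable[OF t(1)] bounded_until_L2(1)[OF t(1,1) order_refl] _ lim]
    have b: "expectation (\<lambda>\<omega>. (indicator (bounded_until (real k) t) \<omega> * X t \<omega>)\<^sup>2) \<le> 4 ^ n * K0" for k
      using t n by (intro trunc) auto
    have L2': "(\<lambda>\<omega>. indicator (space M) \<omega> * X t \<omega>) \<in> L2 M"
      and le: "expectation (\<lambda>\<omega>. (indicator (space M) \<omega> * X t \<omega>)\<^sup>2) \<le> 4 ^ n * K0"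
      using *(1)[OF b] *(2)[OF b] by simp_all
    have int: "integrable M (\<lambda>\<omega>. (indicator (space M) \<omega> * X t \<omega>)\<^sup>2) \<longleftrightarrow> integrable M (\<lambda>\<omega>. (X t \<omega>)\<^sup>2)"
      by (intro Bochner_Integration.integrable_cong) auto
    show "X t \<in> L2 M" using L2' int X_measurable[OF t(1)] by (simp add: L2_def)
    have "expectation (\<lambda>\<omega>. (indicator (space M) \<omega> * X t \<omega>)\<^sup>2) = second_moment (X t)"
      by (intro Bochner_Integration.integral_cong) auto
    with le show "second_moment (X t) \<le> 4 ^ n * K0" by simp
  qed (use K0 in auto)
qed

lemma X_L2: "0 \<le> t \<Longrightarrow> X t \<in> L2 M"
  using moment_bound[of t] by auto

lemma drift_L2: "0 \<le> u \<Longrightarrow> drift u \<in> L2 M"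
  and noise_L2: "0 \<le> u \<Longrightarrow> noise u \<in> L2 M"
  unfolding drift_def[abs_def] noise_def[abs_def] using X_L2 delay_bounds by (auto intro!: L2_add L2_cmult)

end

section \<open>Local expansion of the solution\<close>

context pantograph_process
begin

definition remainder :: "real \<Rightarrow> real \<Rightarrow> 'a \<Rightarrow> real" where
  "remainder s t \<omega> = X t \<omega> - X s \<omega> - (t - s) * drift s \<omega> - noise s \<omega> * (B t \<omega> - B s \<omega>)"

lemma remainder_L2: "0 \<le> s \<Longrightarrow> s < t \<Longrightarrow> remainder s t \<in> L2 M"
  unfolding remainder_def[abs_def]
  using X_L2 drift_L2 increment_isometry(1)[OF _ _ noise_adapted noise_L2]
  by (auto intro!: L2_diff L2_cmult)

text \<open>Coefficients frozen at time s can be subtracted inside the step sums: their contribution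
  telescopes to (t - s) d0 + g0 (B t - B s) for every partition. So
  \<open>drift_noise_limit_bound\<close> applies to the differences of coefficients. Since A is
  known at time s, multiplying by its indicator keeps them adapted.\<close>

lemma approximation_bound:
  fixes d g :: "real \<Rightarrow> 'a \<Rightarrow> real"
  assumes st: "0 \<le> s" "s < t" and A: "A \<in> sets (F s)"
    and d0: "d0 \<in> L2 M" "d0 \<in> borel_measurable (F s)"
    and g0: "g0 \<in> L2 M" "g0 \<in> borel_measurable (F s)"
    and \<delta>: "\<And>u. s \<le> u \<Longrightarrow> u \<le> t \<Longrightarrow> expectation (\<lambda>\<omega>. (indicator A \<omega> * (drift u \<omega> - d0 \<omega>))\<^sup>2) \<le> \<delta>"
    and \<gamma>: "\<And>u. s \<le> u \<Longrightarrow> u \<le> t \<Longrightarrow> expectation (\<lambda>\<omega>. (indicator A \<omega> * (noise u \<omega> - g0 \<omega>))\<^sup>2) \<le> \<gamma>"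
    and \<xi>: "\<xi> \<in> L2 M" "\<xi> \<in> borel_measurable (F s)" and \<mu>: "\<mu> > 0"
  shows "expectation (\<lambda>\<omega>. (\<xi> \<omega> + indicator A \<omega> *
      (X t \<omega> - X s \<omega> - (t - s) * d0 \<omega> - g0 \<omega> * (B t \<omega> - B s \<omega>)))\<^sup>2) \<le>
    (1 + \<mu>) * second_moment \<xi> + (1 / \<mu> + 2) * ((t - s)\<^sup>2 * \<delta>) + 2 * ((t - s) * \<gamma>)"
proof -
  have AM: "A \<in> events" using A filtration_events st by auto
  have [measurable]: "A \<in> sets (F u)" "d0 \<in> borel_measurable (F u)" "g0 \<in> borel_measurable (F u)"
    if "s \<le> u" for u
    using that A st filtration_mono adapted_mono d0(2) g0(2) by blast+
  define d where "d u \<omega> = indicator A \<omega> * (drift u \<omega> - d0 \<omega>)" for u \<omega>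
  define g where "g u \<omega> = indicator A \<omega> * (noise u \<omega> - g0 \<omega>)" for u \<omega>
  define Z where "Z \<omega> = indicator A \<omega> * (X t \<omega> - X s \<omega> - (t - s) * d0 \<omega> - g0 \<omega> * (B t \<omega> - B s \<omega>))" for \<omega>
  obtain m p where part: "\<And>k. time_partition s t (m k) (p k)" and
    lim: "AE \<omega> in M. (\<lambda>k. riemann_ito_sum (m k) (p k) drift noise \<omega>) \<longlonglongrightarrow> X t \<omega> - X s \<omega>"
    using riemann_ito_approx[OF st] unfolding drift_def noise_def by blast
  have lim': "AE \<omega> in M. \<omega> \<in> space M \<longrightarrow> (\<lambda>k. riemann_ito_sum (m k) (p k) d g \<omega>) \<longlonglongrightarrow> Z \<omega>"
    using lim
  proof eventually_elim
    case (elim \<omega>)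
    have eq: "(riemann_ito_sum (m k) (p k) d g \<omega>) =
      indicator A \<omega> * ((riemann_ito_sum (m k) (p k) drift noise \<omega>) - (t - s) * d0 \<omega> - g0 \<omega> * (B t \<omega> - B s \<omega>))" for k
    proof -
      have pk: "p k 0 = s" "p k (m k) = t" using part[of k] by (auto simp: time_partition_def)
      have "(\<Sum>i<m k. p k (Suc i) - p k i) = t - s"
        "(\<Sum>i<m k. B (p k (Suc i)) \<omega> - B (p k i) \<omega>) = B t \<omega> - B s \<omega>"
        using sum_lessThan_telescope[of "p k" "m k"] sum_lessThan_telescope[of "\<lambda>i. B (p k i) \<omega>" "m k"]
        by (simp_all add: pk)
      then have lin: "(\<Sum>i<m k. d0 \<omega> * (p k (Suc i) - p k i) + g0 \<omega> * (B (p k (Suc i)) \<omega> - B (p k i) \<omega>)) =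
          (t - s) * d0 \<omega> + g0 \<omega> * (B t \<omega> - B s \<omega>)"
        unfolding sum.distrib sum_distrib_left[symmetric] by simp
      have "(riemann_ito_sum (m k) (p k) d g \<omega>) =
        (\<Sum>i<m k. indicator A \<omega> * ((drift (p k i) \<omega> * (p k (Suc i) - p k i) +
           noise (p k i) \<omega> * (B (p k (Suc i)) \<omega> - B (p k i) \<omega>)) -
          (d0 \<omega> * (p k (Suc i) - p k i) + g0 \<omega> * (B (p k (Suc i)) \<omega> - B (p k i) \<omega>))))"
        by (intro sum.cong refl) (simp add: d_def g_def algebra_simps)
      also have "\<dots> = indicator A \<omega> * ((riemann_ito_sum (m k) (p k) drift noise \<omega>) -
          (\<Sum>i<m k. d0 \<omega> * (p k (Suc i) - p k i) + g0 \<omega> * (B (p k (Suc i)) \<omega> - B (p k i) \<omega>)))"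
        by (simp only: sum_distrib_left[symmetric] sum_subtractf)
      finally show ?thesis unfolding lin by (simp add: diff_diff_eq)
    qed
    show ?case unfolding eq Z_def by (intro impI tendsto_intros elim)
  qed
  have dg: "d u \<in> L2 M" "g u \<in> L2 M" "g u \<in> borel_measurable (F u)" if "s \<le> u" for u
  proof -
    have u: "0 \<le> u" using that st by simp
    show "d u \<in> L2 M" "g u \<in> L2 M" unfolding d_def[abs_def] g_def[abs_def]
      using drift_L2[OF u] noise_L2[OF u] d0 g0 AM by (auto intro!: L2_indicator_mult L2_diff)
    note [measurable] = noise_adapted[OF u]
    show "g u \<in> borel_measurable (F u)" unfolding g_def[abs_def] using that by measurable
  qed
  have Zm: "Z \<in> borel_measurable M"
    using AM d0(1) g0(1) st by (auto simp: Z_def[abs_def] dest: L2_measurable)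
  have "expectation (\<lambda>\<omega>. (indicator (space M) \<omega> * (\<xi> \<omega> + Z \<omega>))\<^sup>2) \<le>
      (1 + \<mu>) * second_moment \<xi> + (1 / \<mu> + 2) * ((t - s)\<^sup>2 * \<delta>) + 2 * ((t - s) * \<gamma>)"
  proof (rule drift_noise_limit_bound(2)[where p = p and m = m and d = d and g = g])
    fix u assume u: "s \<le> u" "u \<le> t"
    show "second_moment (d u) \<le> \<delta>" using \<delta>[OF u] by (simp add: d_def)
    show "second_moment (g u) \<le> \<gamma>" using \<gamma>[OF u] by (simp add: g_def)
    show "g u \<in> borel_measurable (F u)" "g u \<in> L2 M" "d u \<in> L2 M" using dg[OF u(1)] by auto
  next
    show "AE \<omega> in M. \<omega> \<in> space M \<longrightarrow> (\<lambda>k. riemann_ito_sum (m k) (p k) d g \<omega>) \<longlonglongrightarrow> Z \<omega>" by (rule lim')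
  qed (use st part Zm \<xi> \<mu> in auto)
  also have "expectation (\<lambda>\<omega>. (indicator (space M) \<omega> * (\<xi> \<omega> + Z \<omega>))\<^sup>2) = expectation (\<lambda>\<omega>. (\<xi> \<omega> + Z \<omega>)\<^sup>2)"
    by (intro Bochner_Integration.integral_cong) auto
  finally show ?thesis unfolding Z_def .
qed

text \<open>\<open>approximation_bound\<close> with nothing frozen and no past. The event A is kept
  for the estimate near the zeros of X.\<close>

lemma increment_bound:
  assumes st: "0 \<le> s" "s \<le> t" "t - s \<le> 1" and A: "A \<in> sets (F s)"
    and \<delta>: "\<And>u. s \<le> u \<Longrightarrow> u \<le> t \<Longrightarrow> expectation (\<lambda>\<omega>. (indicator A \<omega> * drift u \<omega>)\<^sup>2) \<le> \<delta>"
    and \<gamma>: "\<And>u. s \<le> u \<Longrightarrow> u \<le> t \<Longrightarrow> expectation (\<lambda>\<omega>. (indicator A \<omega> * noise u \<omega>)\<^sup>2) \<le> \<gamma>"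
  shows "expectation (\<lambda>\<omega>. (indicator A \<omega> * (X t \<omega> - X s \<omega>))\<^sup>2) \<le> 3 * ((t - s)\<^sup>2 * \<delta>) + 2 * ((t - s) * \<gamma>)"
proof (cases "s = t")
  case False
  then show ?thesis
    using approximation_bound[of s t A "\<lambda>_. 0" "\<lambda>_. 0" \<delta> \<gamma> "\<lambda>_. 0" 1] assms by simp
qed simp

lemma increment_bound_linear:
  assumes K: "\<And>t. 0 \<le> t \<Longrightarrow> t \<le> T \<Longrightarrow> second_moment (X t) \<le> K" "0 \<le> K"
    and st: "0 \<le> s" "s \<le> t" "t - s \<le> 1" "t \<le> T"
  shows "expectation (\<lambda>\<omega>. (X t \<omega> - X s \<omega>)\<^sup>2) \<le> (6 * (a\<^sup>2 + b\<^sup>2) + 4 * (\<sigma>\<^sup>2 + \<rho>\<^sup>2)) * K * (t - s)"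
proof -
  have dom: "expectation (\<lambda>\<omega>. (indicator (space M) \<omega> * (c1 * X u \<omega> + c2 * X (q * u) \<omega>))\<^sup>2) \<le> 2 * (c1\<^sup>2 + c2\<^sup>2) * K"
    if "s \<le> u" "u \<le> t" for u c1 c2
  proof -
    have "expectation (\<lambda>\<omega>. (indicator (space M) \<omega> * (c1 * X u \<omega> + c2 * X (q * u) \<omega>))\<^sup>2) =
      expectation (\<lambda>\<omega>. (c1 * X u \<omega> + c2 * X (q * u) \<omega>)\<^sup>2)"
      by (intro Bochner_Integration.integral_cong) auto
    also have "\<dots> \<le> 2 * (c1\<^sup>2 + c2\<^sup>2) * K"
      using that st delay_bounds[of u] by (intro expectation_sum_power2_le X_L2 K) linarith+
    finally show ?thesis .
  qed
  have topF: "space M \<in> sets (F s)" using st space_filtration[of s] sets.top[of "F s"] by simp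
  have "expectation (\<lambda>\<omega>. (X t \<omega> - X s \<omega>)\<^sup>2) = expectation (\<lambda>\<omega>. (indicator (space M) \<omega> * (X t \<omega> - X s \<omega>))\<^sup>2)"
    by (intro Bochner_Integration.integral_cong) auto
  also have "\<dots> \<le> 3 * ((t - s)\<^sup>2 * (2 * (a\<^sup>2 + b\<^sup>2) * K)) + 2 * ((t - s) * (2 * (\<sigma>\<^sup>2 + \<rho>\<^sup>2) * K))"
    using dom[of _ a b] dom[of _ \<sigma> \<rho>]
    by (intro increment_bound[OF st(1-3) topF]) (auto simp: drift_def noise_def)
  also have "\<dots> \<le> 3 * ((t - s) * (2 * (a\<^sup>2 + b\<^sup>2) * K)) + 2 * ((t - s) * (2 * (\<sigma>\<^sup>2 + \<rho>\<^sup>2) * K))"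
  proof -
    have "(t - s)\<^sup>2 \<le> t - s" using st by (simp add: power2_eq_square mult_left_le_one_le)
    then show ?thesis using K(2) by (intro add_mono mult_right_mono mult_left_mono) auto
  qed
  finally show ?thesis by (simp add: algebra_simps)
qed

text \<open>Freezing the coefficients at s leaves differences of second moment O(h), h = t - s. This
  gives O(h^2) for the noise part and O(h^3) for the drift part of the remainder R. Cauchy-Schwarz
  would then allow only O(h) for the mixed moment with \<xi>; the gain of sqrt h comes from the
  noise part being orthogonal to the past, exploited by taking \<mu> = h in the bound for the square
  of sqrt h \<xi> + R.\<close>

lemma remainder_estimates:
  obtains C where "0 \<le> C"
    and "\<And>s t. 0 \<le> s \<Longrightarrow> s < t \<Longrightarrow> t \<le> T \<Longrightarrow> t - s \<le> 1 \<Longrightarrow>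
      expectation (\<lambda>\<omega>. (remainder s t \<omega>)\<^sup>2) \<le> C * (t - s)\<^sup>2"
    and "\<And>s t \<xi>. 0 \<le> s \<Longrightarrow> s < t \<Longrightarrow> t \<le> T \<Longrightarrow> t - s \<le> 1 \<Longrightarrow>
      \<xi> \<in> L2 M \<Longrightarrow> \<xi> \<in> borel_measurable (F s) \<Longrightarrow>
      expectation (\<lambda>\<omega>. \<xi> \<omega> * remainder s t \<omega>)
        \<le> (second_moment \<xi> + C) * ((t - s) * sqrt (t - s))"
proof -
  obtain K where K: "0 \<le> K" "\<And>t. 0 \<le> t \<Longrightarrow> t \<le> T \<Longrightarrow> second_moment (X t) \<le> K"
    using moment_bound[of T] by blast
  define C1 where "C1 = (6 * (a\<^sup>2 + b\<^sup>2) + 4 * (\<sigma>\<^sup>2 + \<rho>\<^sup>2)) * K"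
  define c\<^sub>d where "c\<^sub>d = 2 * (a\<^sup>2 + b\<^sup>2) * C1"
  define c\<^sub>g where "c\<^sub>g = 2 * (\<sigma>\<^sup>2 + \<rho>\<^sup>2) * C1"
  have nn: "0 \<le> C1" "0 \<le> c\<^sub>d" "0 \<le> c\<^sub>g" using K(1) by (simp_all add: C1_def c\<^sub>d_def c\<^sub>g_def)
  have est: "expectation (\<lambda>\<omega>. (remainder s t \<omega>)\<^sup>2) \<le> (3 * c\<^sub>d + 2 * c\<^sub>g) * (t - s)\<^sup>2 \<and>
     (\<forall>\<xi>\<in>L2 M. \<xi> \<in> borel_measurable (F s) \<longrightarrow>
        expectation (\<lambda>\<omega>. \<xi> \<omega> * remainder s t \<omega>)
          \<le> (second_moment \<xi> + (3 * c\<^sub>d + 2 * c\<^sub>g)) * ((t - s) * sqrt (t - s)))"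
    if st: "0 \<le> s" "s < t" "t \<le> T" "t - s \<le> 1" for s t
  proof (intro conjI ballI impI)
    define h where "h = t - s"
    define r where "r = sqrt h"
    have h: "0 < h" "h \<le> 1" using st by (auto simp: h_def)
    have r: "0 < r" "r \<le> 1" "h = r\<^sup>2" using h by (auto simp: r_def)
    have dom: "expectation (\<lambda>\<omega>. (indicator (space M) \<omega> *
        ((c1 * X u \<omega> + c2 * X (q * u) \<omega>) - (c1 * X s \<omega> + c2 * X (q * s) \<omega>)))\<^sup>2) \<le> 2 * (c1\<^sup>2 + c2\<^sup>2) * C1 * h"
      if u: "s \<le> u" "u \<le> t" for u c1 c2
    proof -
      have "q * (u - s) \<le> u - s" using u q by (intro mult_left_le_one_le) auto
      then have le: "q * u - q * s \<le> u - s" "q * s \<le> q * u"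
        using u q by (auto simp: algebra_simps)
      have inc: "expectation (\<lambda>\<omega>. (X u' \<omega> - X s' \<omega>)\<^sup>2) \<le> C1 * h"
        if "0 \<le> s'" "s' \<le> u'" "u' - s' \<le> u - s" "u' \<le> T" for s' u'
      proof -
        have "expectation (\<lambda>\<omega>. (X u' \<omega> - X s' \<omega>)\<^sup>2) \<le> C1 * (u' - s')"
          unfolding C1_def using that u st by (intro increment_bound_linear[OF K(2) K(1)]) auto
        also have "\<dots> \<le> C1 * h" using that u nn by (intro mult_left_mono) (auto simp: h_def)
        finally show ?thesis .
      qed
      have qs: "0 \<le> q * s" using q st by simp
      have delay_bounds': "q * u \<le> u" using q u st by (intro mult_left_le_one_le) auto
      have "expectation (\<lambda>\<omega>. (indicator (space M) \<omega> *
        ((c1 * X u \<omega> + c2 * X (q * u) \<omega>) - (c1 * X s \<omega> + c2 * X (q * s) \<omega>)))\<^sup>2) =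
        expectation (\<lambda>\<omega>. (c1 * (X u \<omega> - X s \<omega>) + c2 * (X (q * u) \<omega> - X (q * s) \<omega>))\<^sup>2)"
        by (intro Bochner_Integration.integral_cong) (auto simp: algebra_simps)
      also have "\<dots> \<le> 2 * (c1\<^sup>2 + c2\<^sup>2) * (C1 * h)"
        using u st qs le delay_bounds' by (intro expectation_sum_power2_le L2_diff X_L2 inc) auto
      finally show ?thesis by (simp add: mult.assoc)
    qed
    have topF: "space M \<in> sets (F s)" using st space_filtration[of s] sets.top[of "F s"] by simp
    have main: "expectation (\<lambda>\<omega>. (\<xi> \<omega> + remainder s t \<omega>)\<^sup>2) \<le>
        (1 + \<mu>) * second_moment \<xi> + (1 / \<mu> + 2) * (h\<^sup>2 * (c\<^sub>d * h)) + 2 * (h * (c\<^sub>g * h))"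
      if "\<xi> \<in> L2 M" "\<xi> \<in> borel_measurable (F s)" "\<mu> > 0" for \<xi> \<mu>
    proof -
      have "expectation (\<lambda>\<omega>. (\<xi> \<omega> + remainder s t \<omega>)\<^sup>2) =
        expectation (\<lambda>\<omega>. (\<xi> \<omega> + indicator (space M) \<omega> *
          (X t \<omega> - X s \<omega> - (t - s) * drift s \<omega> - noise s \<omega> * (B t \<omega> - B s \<omega>)))\<^sup>2)"
        by (intro Bochner_Integration.integral_cong) (auto simp: remainder_def)
      also have "\<dots> \<le> (1 + \<mu>) * second_moment \<xi> + (1 / \<mu> + 2) * ((t - s)\<^sup>2 * (c\<^sub>d * h)) + 2 * ((t - s) * (c\<^sub>g * h))"
      proof (rule approximation_bound[OF st(1,2) topF])
        fix u assume u: "s \<le> u" "u \<le> t"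
        show "expectation (\<lambda>\<omega>. (indicator (space M) \<omega> * (drift u \<omega> - drift s \<omega>))\<^sup>2) \<le> c\<^sub>d * h"
          using dom[OF u, of a b] by (simp add: drift_def c\<^sub>d_def)
        show "expectation (\<lambda>\<omega>. (indicator (space M) \<omega> * (noise u \<omega> - noise s \<omega>))\<^sup>2) \<le> c\<^sub>g * h"
          using dom[OF u, of \<sigma> \<rho>] by (simp add: noise_def c\<^sub>g_def)
      qed (use st that drift_adapted noise_adapted drift_L2 noise_L2 in auto)
      finally show ?thesis by (simp add: h_def)
    qed
    have h3: "h\<^sup>2 * (c\<^sub>d * h) \<le> c\<^sub>d * h\<^sup>2" "h * (c\<^sub>g * h) = c\<^sub>g * h\<^sup>2"
      using mult_left_mono[of h 1 "c\<^sub>d * h\<^sup>2"] h nn by (auto simp: power2_eq_square mult_ac)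
    have "expectation (\<lambda>\<omega>. (remainder s t \<omega>)\<^sup>2) \<le> 3 * (h\<^sup>2 * (c\<^sub>d * h)) + 2 * (h * (c\<^sub>g * h))"
      using main[of "\<lambda>_. 0" 1] by simp
    also have "\<dots> \<le> 3 * (c\<^sub>d * h\<^sup>2) + 2 * (c\<^sub>g * h\<^sup>2)" using h3 by linarith
    also have "\<dots> = (3 * c\<^sub>d + 2 * c\<^sub>g) * h\<^sup>2" by (simp add: distrib_right)
    finally show "expectation (\<lambda>\<omega>. (remainder s t \<omega>)\<^sup>2) \<le> (3 * c\<^sub>d + 2 * c\<^sub>g) * (t - s)\<^sup>2" by (simp add: h_def)
    fix \<xi> assume \<xi>: "\<xi> \<in> L2 M" "\<xi> \<in> borel_measurable (F s)"
    let ?E = "second_moment \<xi>" and ?R = "remainder s t"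
    have R: "?R \<in> L2 M" using st by (intro remainder_L2) auto
    \<comment> \<open>The second moment of \<open>r \<xi> + R\<close> with \<open>r = \<surd>h\<close> controls the mixed moment:
      all error terms become \<open>O(r\<^sup>4)\<close>, that is \<open>O(r\<^sup>3)\<close> after division by \<open>r\<close>.\<close>
    have "expectation (\<lambda>\<omega>. (r * \<xi> \<omega> + ?R \<omega>)\<^sup>2) \<le>
        (1 + h) * expectation (\<lambda>\<omega>. (r * \<xi> \<omega>)\<^sup>2) + (1 / h + 2) * (h\<^sup>2 * (c\<^sub>d * h)) + 2 * (h * (c\<^sub>g * h))"
      using \<xi> h by (intro main) auto
    also have "expectation (\<lambda>\<omega>. (r * \<xi> \<omega> + ?R \<omega>)\<^sup>2) =
        expectation (\<lambda>\<omega>. h * (\<xi> \<omega>)\<^sup>2 + 2 * r * (\<xi> \<omega> * ?R \<omega>) + (?R \<omega>)\<^sup>2)"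
      by (intro Bochner_Integration.integral_cong) (auto simp: r(3) power2_eq_square algebra_simps)
    also have "\<dots> = h * ?E + 2 * r * expectation (\<lambda>\<omega>. \<xi> \<omega> * ?R \<omega>) + second_moment ?R"
      using \<xi> R L2_mult_integrable[OF \<xi>(1) R] by (simp add: L2_integrable_power2)
    also have "(1 + h) * expectation (\<lambda>\<omega>. (r * \<xi> \<omega>)\<^sup>2) = h * ?E + h\<^sup>2 * ?E"
      by (simp add: power_mult_distrib flip: r(3)) (simp add: algebra_simps power2_eq_square)
    also have "(1 / h + 2) * (h\<^sup>2 * (c\<^sub>d * h)) = c\<^sub>d * h\<^sup>2 + 2 * (h\<^sup>2 * (c\<^sub>d * h))"
      using h by (simp add: field_simps power2_eq_square)
    finally have mixed: "h * ?E + 2 * r * expectation (\<lambda>\<omega>. \<xi> \<omega> * ?R \<omega>) + second_moment ?R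
          \<le> h * ?E + h\<^sup>2 * ?E + (c\<^sub>d * h\<^sup>2 + 2 * (h\<^sup>2 * (c\<^sub>d * h))) + 2 * (h * (c\<^sub>g * h))" .
    moreover have "0 \<le> second_moment ?R" by simp
    ultimately have "2 * r * expectation (\<lambda>\<omega>. \<xi> \<omega> * ?R \<omega>) \<le> h\<^sup>2 * ?E + c\<^sub>d * h\<^sup>2 + 2 * (c\<^sub>d * h\<^sup>2) + 2 * (c\<^sub>g * h\<^sup>2)"
      using h3 by linarith
    also have "\<dots> \<le> 2 * r * ((?E + (3 * c\<^sub>d + 2 * c\<^sub>g)) * (h * r))"
    proof -
      have "0 \<le> h\<^sup>2 * ?E + (c\<^sub>d + 2 * c\<^sub>d + 2 * c\<^sub>g) * h\<^sup>2" using nn by simp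
      moreover have "2 * r * ((?E + (3 * c\<^sub>d + 2 * c\<^sub>g)) * (h * r)) = 2 * (h\<^sup>2 * ?E + (3 * c\<^sub>d + 2 * c\<^sub>g) * h\<^sup>2)"
        using r by (simp add: power2_eq_square algebra_simps)
      ultimately show ?thesis by (simp add: algebra_simps)
    qed
    finally have "expectation (\<lambda>\<omega>. \<xi> \<omega> * ?R \<omega>) \<le> (?E + (3 * c\<^sub>d + 2 * c\<^sub>g)) * (h * r)"
      using r by simp
    then show "expectation (\<lambda>\<omega>. \<xi> \<omega> * ?R \<omega>) \<le> (?E + (3 * c\<^sub>d + 2 * c\<^sub>g)) * ((t - s) * sqrt (t - s))"
      by (simp add: h_def r_def)
  qed
  show ?thesis
  proof (rule that)
    show "0 \<le> 3 * c\<^sub>d + 2 * c\<^sub>g" using nn by simp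
  qed (use est in \<open>simp_all\<close>)
qed

text \<open>The left-hand side of \<open>AB\<close> is the drift that the Ito formula assigns to
  X^2, with x for X(s) and y for X(q s). Here it arises by squaring the local expansion: X(s) times
  the noise has mean 0, the squared noise has mean h times the second moment of H, and the rest is
  O(h^(3/2)).\<close>

lemma second_moment_step:
  assumes AB: "\<And>x y. 2 * x * (a * x + b * y) + (\<sigma> * x + \<rho> * y)\<^sup>2 \<le> - A * x\<^sup>2 + B' * y\<^sup>2"
  shows "\<exists>C \<delta>. 0 < \<delta> \<and> (\<forall>s t. 0 \<le> s \<longrightarrow> s < t \<longrightarrow> t \<le> T \<longrightarrow> t - s \<le> \<delta> \<longrightarrow>
    second_moment (X t) \<le> second_moment (X s) +
      (t - s) * (- A * second_moment (X s) + B' * second_moment (X (q * s))) +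
      C * ((t - s) * sqrt (t - s)))"
proof -
  obtain K where K: "0 \<le> K" "\<And>t. 0 \<le> t \<Longrightarrow> t \<le> T \<Longrightarrow> second_moment (X t) \<le> K"
    using moment_bound[of T] by blast
  obtain C where C: "0 \<le> C"
    "\<And>s t. 0 \<le> s \<Longrightarrow> s < t \<Longrightarrow> t \<le> T \<Longrightarrow> t - s \<le> 1 \<Longrightarrow> expectation (\<lambda>\<omega>. (remainder s t \<omega>)\<^sup>2) \<le> C * (t - s)\<^sup>2"
    "\<And>s t \<xi>. 0 \<le> s \<Longrightarrow> s < t \<Longrightarrow> t \<le> T \<Longrightarrow> t - s \<le> 1 \<Longrightarrow> \<xi> \<in> L2 M \<Longrightarrow> \<xi> \<in> borel_measurable (F s) \<Longrightarrow>
       expectation (\<lambda>\<omega>. \<xi> \<omega> * remainder s t \<omega>) \<le> (second_moment \<xi> + C) * ((t - s) * sqrt (t - s))"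
    by (rule remainder_estimates[of T]) (rule that)
  define KD where "KD = 2 * (a\<^sup>2 + b\<^sup>2) * K"
  define KH where "KH = 2 * (\<sigma>\<^sup>2 + \<rho>\<^sup>2) * K"
  have nn: "0 \<le> KD" "0 \<le> KH" using K by (auto simp: KD_def KH_def)
  define C' where "C' = 2 * (K + C) + KH + 4 * (KD + C)"
  show ?thesis
  proof (rule exI[of _ C'], rule exI[of _ 1], intro conjI allI impI)
    fix s t assume st: "0 \<le> s" "s < t" "t \<le> T" "t - s \<le> 1"
    define h where "h = t - s"
    define r where "r = sqrt h"
    have h: "0 < h" "h \<le> 1" using st by (auto simp: h_def)
    have r: "0 < r" "r \<le> 1" "h = r\<^sup>2" using h by (auto simp: r_def)
    have qs: "0 \<le> q * s" "q * s \<le> T" using delay_bounds[of s] st by auto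
    define D where "D = drift s"
    define H where "H = noise s"
    define R where "R = remainder s t"
    define W where "W \<omega> = H \<omega> * (B t \<omega> - B s \<omega>)" for \<omega>
    have L: "X s \<in> L2 M" "D \<in> L2 M" "H \<in> L2 M" "R \<in> L2 M" "X (q * s) \<in> L2 M" "X t \<in> L2 M"
      using st qs by (auto simp: D_def H_def R_def intro!: X_L2 drift_L2 noise_L2 remainder_L2)
    have Had: "H \<in> borel_measurable (F s)" "X s \<in> borel_measurable (F s)"
      using noise_adapted X_adapted st by (auto simp: H_def)
    have W: "W \<in> L2 M" "second_moment W = h * second_moment H"
      using increment_isometry[OF st(1,2) Had(1) L(3)] by (simp_all add: W_def[abs_def] h_def)
    have XW: "integrable M (\<lambda>\<omega>. X s \<omega> * W \<omega>)" "expectation (\<lambda>\<omega>. X s \<omega> * W \<omega>) = 0"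
      using increment_orthogonal[OF st(1,2), of "\<lambda>\<omega>. X s \<omega> * H \<omega>"] Had L2_mult_integrable[OF L(1,3)]
      by (simp_all add: W_def mult.assoc)
    note [simp] = L2_integrable_power2[OF L(1)] L2_integrable_power2[OF L(2)] L2_integrable_power2[OF L(3)]
       L2_integrable_power2[OF L(4)] L2_integrable_power2[OF L(5)] L2_integrable_power2[OF L(6)]
       L2_integrable_power2[OF W(1)] XW L2_mult_integrable[OF L(1,2)] L2_mult_integrable[OF L(1,4)]
    \<comment> \<open>The cross term of the noise W, of size sqrt h, with y = h D + R, of size h, is
      split with weight r = sqrt h; then r W^2 and y^2 / r both have mean of order h^(3/2).\<close>
    have pw: "(X t \<omega>)\<^sup>2 \<le> (X s \<omega>)\<^sup>2 + 2 * h * (X s \<omega> * D \<omega>) + 2 * (X s \<omega> * W \<omega>) + 2 * (X s \<omega> * R \<omega>)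
       + (1 + r) * (W \<omega>)\<^sup>2 + (1 + 1 / r) * (2 * (h\<^sup>2 * (D \<omega>)\<^sup>2 + (R \<omega>)\<^sup>2))" for \<omega>
    proof -
      define y where "y = h * D \<omega> + R \<omega>"
      have "X t \<omega> = X s \<omega> + y + W \<omega>"
        by (simp add: R_def remainder_def D_def H_def W_def h_def y_def)
      then have "(X t \<omega>)\<^sup>2 = (X s \<omega>)\<^sup>2 + 2 * h * (X s \<omega> * D \<omega>) + 2 * (X s \<omega> * W \<omega>) + 2 * (X s \<omega> * R \<omega>) + (W \<omega> + y)\<^sup>2"
        by (simp add: y_def power2_eq_square algebra_simps)
      moreover have "(W \<omega> + y)\<^sup>2 \<le> (1 + r) * (W \<omega>)\<^sup>2 + (1 + 1 / r) * y\<^sup>2"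
      proof -
        have "0 \<le> (r * W \<omega> - y)\<^sup>2 / r" using r by simp
        also have "\<dots> = r * (W \<omega>)\<^sup>2 - 2 * W \<omega> * y + y\<^sup>2 / r" using r by (simp add: field_simps power2_eq_square)
        finally show ?thesis by (simp add: power2_eq_square algebra_simps)
      qed
      moreover have "(1 + 1 / r) * y\<^sup>2 \<le> (1 + 1 / r) * (2 * (h\<^sup>2 * (D \<omega>)\<^sup>2 + (R \<omega>)\<^sup>2))"
        using sum_power2_le[of h "D \<omega>" 1 "R \<omega>"] r unfolding y_def by (intro mult_left_mono) auto
      ultimately show ?thesis by linarith
    qed
    have "second_moment (X t) \<le> expectation (\<lambda>\<omega>. (X s \<omega>)\<^sup>2 + 2 * h * (X s \<omega> * D \<omega>) + 2 * (X s \<omega> * W \<omega>) + 2 * (X s \<omega> * R \<omega>)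
       + (1 + r) * (W \<omega>)\<^sup>2 + (1 + 1 / r) * (2 * (h\<^sup>2 * (D \<omega>)\<^sup>2 + (R \<omega>)\<^sup>2)))"
      by (intro integral_mono pw) simp_all
    also have "\<dots> = second_moment (X s) + 2 * h * expectation (\<lambda>\<omega>. X s \<omega> * D \<omega>) + 2 * expectation (\<lambda>\<omega>. X s \<omega> * R \<omega>)
       + (1 + r) * (h * second_moment H) + (1 + 1 / r) * (2 * (h\<^sup>2 * second_moment D + second_moment R))"
      by (simp add: W(2))
    also have "\<dots> \<le> second_moment (X s) + h * (- A * second_moment (X s) + B' * second_moment (X (q * s))) + C' * (h * r)"
    proof -
      have 1: "2 * expectation (\<lambda>\<omega>. X s \<omega> * D \<omega>) + second_moment H
          \<le> - A * second_moment (X s) + B' * second_moment (X (q * s))"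
      proof -
        have "2 * expectation (\<lambda>\<omega>. X s \<omega> * D \<omega>) + second_moment H = expectation (\<lambda>\<omega>. 2 * (X s \<omega> * D \<omega>) + (H \<omega>)\<^sup>2)"
          by simp
        also have "\<dots> \<le> expectation (\<lambda>\<omega>. - A * (X s \<omega>)\<^sup>2 + B' * (X (q * s) \<omega>)\<^sup>2)"
        proof (rule integral_mono)
          fix \<omega> show "2 * (X s \<omega> * D \<omega>) + (H \<omega>)\<^sup>2 \<le> - A * (X s \<omega>)\<^sup>2 + B' * (X (q * s) \<omega>)\<^sup>2"
            using AB[of "X s \<omega>" "X (q * s) \<omega>"] by (simp add: D_def H_def drift_def noise_def mult.assoc)
        qed simp_all
        also have "\<dots> = - A * second_moment (X s) + B' * second_moment (X (q * s))"
          by simp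
        finally show ?thesis .
      qed
      have 2: "expectation (\<lambda>\<omega>. X s \<omega> * R \<omega>) \<le> (K + C) * (h * r)"
      proof -
        have "expectation (\<lambda>\<omega>. X s \<omega> * R \<omega>) \<le> (second_moment (X s) + C) * (h * r)"
          using C(3)[OF st L(1) Had(2)] by (simp add: R_def h_def r_def)
        also have "\<dots> \<le> (K + C) * (h * r)" using K(2)[of s] st h r by (intro mult_right_mono) auto
        finally show ?thesis .
      qed
      have 3: "second_moment H \<le> KH" "second_moment D \<le> KD"
        unfolding KH_def KD_def H_def D_def noise_def drift_def
        using st qs by (intro expectation_sum_power2_le X_L2 K(2); simp)+
      have 4: "second_moment R \<le> C * h\<^sup>2" using C(2)[OF st] by (simp add: R_def h_def)
      have "(1 + 1 / r) * (2 * (h\<^sup>2 * second_moment D + second_moment R))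
          \<le> (1 + 1 / r) * (2 * (h\<^sup>2 * KD + C * h\<^sup>2))"
        using 3 4 r by (intro mult_left_mono add_mono) auto
      also have "\<dots> = 2 * (KD + C) * ((1 + 1 / r) * h\<^sup>2)" by (simp add: algebra_simps)
      also have "\<dots> \<le> 2 * (KD + C) * (2 * (h * r))"
      proof (rule mult_left_mono)
        have "(1 + 1 / r) * h\<^sup>2 = h * r * (r + 1)" using r by (simp add: field_simps power2_eq_square)
        also have "\<dots> \<le> h * r * 2" using r h by (intro mult_left_mono) auto
        finally show "(1 + 1 / r) * h\<^sup>2 \<le> 2 * (h * r)" by simp
      qed (use nn C in auto)
      also have "\<dots> = 4 * (KD + C) * (h * r)" by (simp add: algebra_simps)
      finally have 5: "(1 + 1 / r) * (2 * (h\<^sup>2 * second_moment D + second_moment R)) \<le> 4 * (KD + C) * (h * r)" .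
      have 6: "r * (h * second_moment H) \<le> KH * (h * r)"
        using mult_left_mono[OF 3(1), of "h * r"] h r by (simp add: mult_ac)
      have 7: "2 * h * expectation (\<lambda>\<omega>. X s \<omega> * D \<omega>) + h * second_moment H
          \<le> h * (- A * second_moment (X s) + B' * second_moment (X (q * s)))"
        using mult_left_mono[OF 1, of h] h by (simp add: algebra_simps)
      have 8: "(1 + r) * (h * second_moment H) = h * second_moment H + r * (h * second_moment H)"
        by (simp add: algebra_simps)
      have 9: "C' * (h * r) = 2 * ((K + C) * (h * r)) + KH * (h * r) + 4 * (KD + C) * (h * r)"
        by (simp add: C'_def algebra_simps)
      show ?thesis unfolding 8 9 using 2 5 6 7 by linarith
    qed
    finally show "second_moment (X t) \<le> second_moment (X s) +
      (t - s) * (- A * second_moment (X s) + B' * second_moment (X (q * s))) +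
      C' * ((t - s) * sqrt (t - s))" by (simp add: h_def r_def)
  qed simp
qed

end

section \<open>Continuity in time of the first and second moments\<close>

lemma hoelder_half_continuous_on:
  fixes v :: "real \<Rightarrow> real"
  assumes "\<And>T. \<exists>C. \<forall>s t. 0 \<le> s \<longrightarrow> s < t \<longrightarrow> t \<le> T \<longrightarrow> t - s \<le> 1 \<longrightarrow> \<bar>v t - v s\<bar> \<le> C * sqrt (t - s)"
  shows "continuous_on {0..} v"
  unfolding continuous_on_iff
proof (intro ballI allI impI)
  fix x e :: real assume x: "x \<in> {0..}" and e: "0 < e"
  obtain C where C: "\<And>s t. 0 \<le> s \<Longrightarrow> s < t \<Longrightarrow> t \<le> x + 1 \<Longrightarrow> t - s \<le> 1 \<Longrightarrow> \<bar>v t - v s\<bar> \<le> C * sqrt (t - s)"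
    using assms[of "x + 1"] by blast
  define C' where "C' = \<bar>C\<bar> + 1"
  have C': "0 < C'" "C \<le> C'" by (auto simp: C'_def)
  define d where "d = min 1 ((e / C')\<^sup>2)"
  have d: "0 < d" "d \<le> 1" using e C' by (auto simp: d_def)
  have close: "\<bar>v t - v s\<bar> < e" if "0 \<le> s" "s < t" "t \<le> x + 1" "t - s < d" for s t
  proof -
    have "\<bar>v t - v s\<bar> \<le> C * sqrt (t - s)" using that d by (intro C) auto
    also have "\<dots> \<le> C' * sqrt (t - s)" using that C' by (intro mult_right_mono) auto
    also have "\<dots> < C' * sqrt ((e / C')\<^sup>2)"
      using that C' by (intro mult_strict_left_mono real_sqrt_less_mono) (auto simp: d_def)
    also have "\<dots> = e" using C' e by (simp add: real_sqrt_abs)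
    finally show ?thesis .
  qed
  have "dist (v y) (v x) < e" if "y \<in> {0..}" "dist y x < d" for y
    using close[of x y] close[of y x] that x d e
    by (cases x y rule: linorder_cases) (auto simp: dist_real_def abs_minus_commute)
  then show "\<exists>d>0. \<forall>y\<in>{0..}. dist y x < d \<longrightarrow> dist (v y) (v x) < e" using d(1) by blast
qed

context pantograph_process
begin

text \<open>Both differences are at most the mean of |(X t - X s) Y|, with Y = 1 for the first
  moment and Y = X t + X s for the second. Splitting |x y| <= x^2 / r + r y^2 with r = sqrt (t - s)
  balances the two terms, since the increment has second moment O(r^2).\<close>

lemma moments_hoelder:
  "\<exists>C. \<forall>s t. 0 \<le> s \<longrightarrow> s < t \<longrightarrow> t \<le> T \<longrightarrow> t - s \<le> 1 \<longrightarrow>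
     \<bar>expectation (\<lambda>\<omega>. \<bar>X t \<omega>\<bar>) - expectation (\<lambda>\<omega>. \<bar>X s \<omega>\<bar>)\<bar> \<le> C * sqrt (t - s) \<and>
     \<bar>second_moment (X t) - second_moment (X s)\<bar> \<le> C * sqrt (t - s)"
proof -
  obtain K where K: "0 \<le> K" "\<And>t. 0 \<le> t \<Longrightarrow> t \<le> T \<Longrightarrow> second_moment (X t) \<le> K"
    using moment_bound[of T] by blast
  define C1 where "C1 = (6 * (a\<^sup>2 + b\<^sup>2) + 4 * (\<sigma>\<^sup>2 + \<rho>\<^sup>2)) * K"
  have C1: "0 \<le> C1" using K by (simp add: C1_def)
  show ?thesis
  proof (rule exI[of _ "C1 + 1 + 4 * K"], intro allI impI)
    fix s t assume st: "0 \<le> s" "s < t" "t \<le> T" "t - s \<le> 1"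
    define h where "h = t - s"
    define r where "r = sqrt h"
    have h: "0 < h" "h \<le> 1" using st by (auto simp: h_def)
    have r: "0 < r" "h = r\<^sup>2" using h by (auto simp: r_def)
    have L: "X s \<in> L2 M" "X t \<in> L2 M" using st X_L2 by auto
    have diff: "expectation (\<lambda>\<omega>. (X t \<omega> - X s \<omega>)\<^sup>2) \<le> C1 * h"
      unfolding C1_def h_def using st by (intro increment_bound_linear[OF K(2) K(1)]) auto
    have amgm: "\<bar>x * y\<bar> \<le> x\<^sup>2 / r + r * y\<^sup>2" for x y :: real
    proof -
      have "0 \<le> (\<bar>x\<bar> - r * \<bar>y\<bar>)\<^sup>2 / r" using r by simp
      also have "\<dots> = x\<^sup>2 / r - 2 * \<bar>x * y\<bar> + r * y\<^sup>2" using r by (simp add: power2_eq_square field_simps abs_mult)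
      finally show ?thesis using abs_ge_zero[of "x * y"] by linarith
    qed
    note Ld = L2_diff[OF L(2,1)] and Ls = L2_add[OF L(2,1)]
    have gen: "expectation (\<lambda>\<omega>. \<bar>(X t \<omega> - X s \<omega>) * Y \<omega>\<bar>) \<le> C1 * r + r * c"
      if Y: "Y \<in> L2 M" "second_moment Y \<le> c" for Y c
    proof -
      have "expectation (\<lambda>\<omega>. \<bar>(X t \<omega> - X s \<omega>) * Y \<omega>\<bar>) \<le> expectation (\<lambda>\<omega>. (X t \<omega> - X s \<omega>)\<^sup>2 / r + r * (Y \<omega>)\<^sup>2)"
        using L2_integrable_power2[OF Ld] L2_integrable_power2[OF Y(1)] L2_mult_integrable[OF Ld Y(1)]
        by (intro integral_mono amgm) auto
      also have "\<dots> = expectation (\<lambda>\<omega>. (X t \<omega> - X s \<omega>)\<^sup>2) / r + r * second_moment Y"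
        using L2_integrable_power2[OF Ld] L2_integrable_power2[OF Y(1)] by simp
      also have "\<dots> \<le> C1 * h / r + r * c" using diff r Y by (intro add_mono divide_right_mono mult_left_mono) auto
      also have "C1 * h / r = C1 * r" using r by (simp add: power2_eq_square)
      finally show ?thesis .
    qed
    have S2: "expectation (\<lambda>\<omega>. (X t \<omega> + X s \<omega>)\<^sup>2) \<le> 4 * K"
      using expectation_sum_power2_le[OF L(2,1) K(2) K(2), of 1 1] st by simp
    have iX: "integrable M (X s)" "integrable M (X t)" using L L2_integrable by auto
    have "\<bar>expectation (\<lambda>\<omega>. \<bar>X t \<omega>\<bar>) - expectation (\<lambda>\<omega>. \<bar>X s \<omega>\<bar>)\<bar> \<le> expectation (\<lambda>\<omega>. \<bar>\<bar>X t \<omega>\<bar> - \<bar>X s \<omega>\<bar>\<bar>)"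
      using iX by (intro expectation_abs_diff_le) auto
    also have "\<dots> \<le> expectation (\<lambda>\<omega>. \<bar>X t \<omega> - X s \<omega>\<bar>)"
      using iX by (intro integral_mono) auto
    also have "\<dots> \<le> C1 * r + r * 1"
      using gen[of "\<lambda>_. 1" 1] by (simp add: prob_space)
    finally have 1: "\<bar>expectation (\<lambda>\<omega>. \<bar>X t \<omega>\<bar>) - expectation (\<lambda>\<omega>. \<bar>X s \<omega>\<bar>)\<bar> \<le> C1 * r + r" by simp
    have "\<bar>second_moment (X t) - second_moment (X s)\<bar> \<le> expectation (\<lambda>\<omega>. \<bar>(X t \<omega>)\<^sup>2 - (X s \<omega>)\<^sup>2\<bar>)"
      using L by (intro expectation_abs_diff_le L2_integrable_power2)
    also have "\<dots> \<le> C1 * r + r * (4 * K)"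
      using gen[OF Ls S2] by (simp add: power2_eq_square algebra_simps)
    finally have 2: "\<bar>second_moment (X t) - second_moment (X s)\<bar> \<le> C1 * r + r * (4 * K)" .
    have 3: "0 \<le> r * K" using r K by simp
    have 4: "(C1 + 1 + 4 * K) * sqrt (t - s) = C1 * r + r + 4 * (r * K)"
      by (simp add: r_def h_def algebra_simps)
    have 5: "r * (4 * K) = 4 * (r * K)" by simp
    show "\<bar>expectation (\<lambda>\<omega>. \<bar>X t \<omega>\<bar>) - expectation (\<lambda>\<omega>. \<bar>X s \<omega>\<bar>)\<bar> \<le> (C1 + 1 + 4 * K) * sqrt (t - s) \<and>
     \<bar>second_moment (X t) - second_moment (X s)\<bar> \<le> (C1 + 1 + 4 * K) * sqrt (t - s)"
      unfolding 4 using 1 2 3 5 r(1) by simp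
  qed
qed

lemma first_moment_continuous: "continuous_on {0..} (\<lambda>t. expectation (\<lambda>\<omega>. \<bar>X t \<omega>\<bar>))"
  and second_moment_continuous: "continuous_on {0..} (\<lambda>t. second_moment (X t))"
proof -
  show "continuous_on {0..} (\<lambda>t. expectation (\<lambda>\<omega>. \<bar>X t \<omega>\<bar>))"
  proof (rule hoelder_half_continuous_on)
    fix T
    show "\<exists>C. \<forall>s t. 0 \<le> s \<longrightarrow> s < t \<longrightarrow> t \<le> T \<longrightarrow> t - s \<le> 1 \<longrightarrow>
        \<bar>expectation (\<lambda>\<omega>. \<bar>X t \<omega>\<bar>) - expectation (\<lambda>\<omega>. \<bar>X s \<omega>\<bar>)\<bar> \<le> C * sqrt (t - s)"
      by (rule ex_forward[OF moments_hoelder[of T]]) simp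
  qed
  show "continuous_on {0..} (\<lambda>t. second_moment (X t))"
  proof (rule hoelder_half_continuous_on)
    fix T
    show "\<exists>C. \<forall>s t. 0 \<le> s \<longrightarrow> s < t \<longrightarrow> t \<le> T \<longrightarrow> t - s \<le> 1 \<longrightarrow>
        \<bar>second_moment (X t) - second_moment (X s)\<bar> \<le> C * sqrt (t - s)"
      by (rule ex_forward[OF moments_hoelder[of T]]) simp
  qed
qed

text \<open>Near the zeros of \<open>X\<close> the noise \<open>\<sigma> X dB\<close> is degenerate, which gains the extra factor \<open>t - s\<close>
  over the general remainder estimate.\<close>

lemma remainder_near_zero:
  assumes \<rho>: "\<rho> = 0"
  shows "\<exists>C\<ge>0. \<forall>s t. 0 \<le> s \<longrightarrow> s < t \<longrightarrow> t \<le> T \<longrightarrow> t - s \<le> 1 \<longrightarrow>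
     expectation (\<lambda>\<omega>. (indicator {\<omega> \<in> space M. (X s \<omega>)\<^sup>2 \<le> t - s} \<omega> * remainder s t \<omega>)\<^sup>2) \<le> C * (t - s) ^ 3"
proof -
  have noise: "noise u \<omega> = \<sigma> * X u \<omega>" for u \<omega> unfolding noise_def using \<rho> by simp
  obtain K where K: "0 \<le> K" "\<And>t. 0 \<le> t \<Longrightarrow> t \<le> T \<Longrightarrow> second_moment (X t) \<le> K"
    using moment_bound[of T] by blast
  define C1 where "C1 = (6 * (a\<^sup>2 + b\<^sup>2) + 4 * (\<sigma>\<^sup>2 + \<rho>\<^sup>2)) * K"
  have C1: "0 \<le> C1" using K by (simp add: C1_def)
  define KD where "KD = 2 * (a\<^sup>2 + b\<^sup>2) * K"
  define C2 where "C2 = 3 * KD + 2 * (\<sigma>\<^sup>2 * (2 + 2 * C1))"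
  define C where "C = 3 * (2 * (a\<^sup>2 + b\<^sup>2) * C1) + 2 * (\<sigma>\<^sup>2 * C2)"
  have nn: "0 \<le> KD" "0 \<le> C2" "0 \<le> C" using K C1 by (auto simp: KD_def C2_def C_def)
  have "expectation (\<lambda>\<omega>. (indicator {\<omega> \<in> space M. (X s \<omega>)\<^sup>2 \<le> t - s} \<omega> * remainder s t \<omega>)\<^sup>2) \<le> C * (t - s) ^ 3"
    if st: "0 \<le> s" "s < t" "t \<le> T" "t - s \<le> 1" for s t
  proof -
    define h where "h = t - s"
    have h: "0 < h" "h \<le> 1" using st by (auto simp: h_def)
    define A where "A = {\<omega> \<in> space M. (X s \<omega>)\<^sup>2 \<le> h}"
    have A: "A \<in> sets (F s)"
    proof -
      have [measurable]: "X s \<in> borel_measurable (F s)" using X_adapted st by simp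
      have "{\<omega> \<in> space (F s). (X s \<omega>)\<^sup>2 \<le> h} \<in> sets (F s)" by measurable
      then show ?thesis using st by (simp add: A_def space_filtration)
    qed
    have AM: "A \<in> events" using A st filtration_events by blast
    have drop: "expectation (\<lambda>\<omega>. (indicator A \<omega> * f \<omega>)\<^sup>2) \<le> second_moment f" if "f \<in> L2 M" for f
      using L2_integrable_power2[OF that] L2_integrable_power2[OF L2_indicator_mult[OF AM that]]
      by (intro integral_mono) (auto simp: indicator_def)
    have inc: "expectation (\<lambda>\<omega>. (X u' \<omega> - X s' \<omega>)\<^sup>2) \<le> C1 * h"
      if "0 \<le> s'" "s' \<le> u'" "u' - s' \<le> h" "u' \<le> T" for s' u'
    proof -
      have "expectation (\<lambda>\<omega>. (X u' \<omega> - X s' \<omega>)\<^sup>2) \<le> C1 * (u' - s')"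
        unfolding C1_def using that h by (intro increment_bound_linear[OF K(2) K(1)]) auto
      also have "\<dots> \<le> C1 * h" using that C1 by (intro mult_left_mono) auto
      finally show ?thesis .
    qed
    \<comment> \<open>On A, X s is at most sqrt h in absolute value, and the general increment bound
      adds another O(h). So the noise coefficient \<sigma> X u has second moment O(h) on A
      throughout the interval.\<close>
    have small: "expectation (\<lambda>\<omega>. (indicator A \<omega> * X u \<omega>)\<^sup>2) \<le> (2 + 2 * C1) * h" if u: "s \<le> u" "u \<le> t" for u
    proof -
      have L: "X u \<in> L2 M" "(\<lambda>\<omega>. X u \<omega> - X s \<omega>) \<in> L2 M" using u st by (auto intro!: X_L2 L2_diff)
      have "expectation (\<lambda>\<omega>. (indicator A \<omega> * X u \<omega>)\<^sup>2) \<le> expectation (\<lambda>\<omega>. 2 * h + 2 * (X u \<omega> - X s \<omega>)\<^sup>2)"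
      proof (rule integral_mono)
        fix \<omega>
        have "(X u \<omega>)\<^sup>2 \<le> 2 * (X s \<omega>)\<^sup>2 + 2 * (X u \<omega> - X s \<omega>)\<^sup>2"
          using sum_power2_le[of 1 "X s \<omega>" 1 "X u \<omega> - X s \<omega>"] by simp
        then show "(indicator A \<omega> * X u \<omega>)\<^sup>2 \<le> 2 * h + 2 * (X u \<omega> - X s \<omega>)\<^sup>2"
          using h by (auto simp: indicator_def A_def intro: add_nonneg_nonneg)
      qed (use L2_integrable_power2[OF L(2)] L2_integrable_power2[OF L2_indicator_mult[OF AM L(1)]] in auto)
      also have "\<dots> = 2 * h + 2 * expectation (\<lambda>\<omega>. (X u \<omega> - X s \<omega>)\<^sup>2)"
        using L2_integrable_power2[OF L(2)] by (simp add: prob_space)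
      also have "\<dots> \<le> 2 * h + 2 * (C1 * h)" using inc[of s u] u st by (simp add: h_def)
      finally show ?thesis by (simp add: algebra_simps)
    qed
    \<comment> \<open>Second round: with this smaller noise coefficient the increment bound on A
      improves from O(h) to O(h^2). Fed into \<open>approximation_bound\<close>, it yields h * h^2
      for the noise error, matching h^2 * h for the drift error.\<close>
    have local_inc: "expectation (\<lambda>\<omega>. (indicator A \<omega> * (X u \<omega> - X s \<omega>))\<^sup>2) \<le> C2 * h\<^sup>2" if u: "s \<le> u" "u \<le> t" for u
    proof -
      have us: "u - s \<le> h" using u by (simp add: h_def)
      have "expectation (\<lambda>\<omega>. (indicator A \<omega> * (X u \<omega> - X s \<omega>))\<^sup>2) \<le>
         3 * ((u - s)\<^sup>2 * KD) + 2 * ((u - s) * (\<sigma>\<^sup>2 * ((2 + 2 * C1) * h)))"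
      proof (rule increment_bound[OF st(1) u(1) _ A])
        fix w assume w: "s \<le> w" "w \<le> u"
        have "second_moment (drift w) \<le> KD"
          unfolding drift_def KD_def
          using w u st delay_bounds[of w] by (intro expectation_sum_power2_le X_L2 K(2); simp)
        then show "expectation (\<lambda>\<omega>. (indicator A \<omega> * drift w \<omega>)\<^sup>2) \<le> KD"
          using drop[OF drift_L2, of w] w st by simp
        have "expectation (\<lambda>\<omega>. (indicator A \<omega> * noise w \<omega>)\<^sup>2) = \<sigma>\<^sup>2 * expectation (\<lambda>\<omega>. (indicator A \<omega> * X w \<omega>)\<^sup>2)"
          unfolding noise by (simp add: power_mult_distrib mult.left_commute[of _ "\<sigma>\<^sup>2"])
        also have "\<dots> \<le> \<sigma>\<^sup>2 * ((2 + 2 * C1) * h)" using small[of w] w u by (intro mult_left_mono) auto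
        finally show "expectation (\<lambda>\<omega>. (indicator A \<omega> * noise w \<omega>)\<^sup>2) \<le> \<sigma>\<^sup>2 * ((2 + 2 * C1) * h)" .
      qed (use us h in simp)
      also have "\<dots> \<le> 3 * (h\<^sup>2 * KD) + 2 * (h * (\<sigma>\<^sup>2 * ((2 + 2 * C1) * h)))"
        using us u h nn C1 by (intro add_mono mult_left_mono mult_right_mono power_mono) auto
      also have "\<dots> = C2 * h\<^sup>2" by (simp add: C2_def power2_eq_square algebra_simps)
      finally show ?thesis .
    qed
    have "expectation (\<lambda>\<omega>. (0 + indicator A \<omega> * (X t \<omega> - X s \<omega> - (t - s) * drift s \<omega> - noise s \<omega> * (B t \<omega> - B s \<omega>)))\<^sup>2)
       \<le> (1 + 1) * expectation (\<lambda>\<omega>. 0\<^sup>2) + (1 / 1 + 2) * ((t - s)\<^sup>2 * (2 * (a\<^sup>2 + b\<^sup>2) * (C1 * h))) +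
          2 * ((t - s) * (\<sigma>\<^sup>2 * (C2 * h\<^sup>2)))"
    proof (rule approximation_bound[OF st(1,2) A])
      fix u assume u: "s \<le> u" "u \<le> t"
      have "q * (u - s) \<le> u - s" using u q by (intro mult_left_le_one_le) auto
      then have le: "q * u - q * s \<le> h" "q * s \<le> q * u"
        using u q by (auto simp: algebra_simps h_def)
      have L: "(\<lambda>\<omega>. drift u \<omega> - drift s \<omega>) \<in> L2 M" using u st by (auto intro!: L2_diff drift_L2)
      have "expectation (\<lambda>\<omega>. (drift u \<omega> - drift s \<omega>)\<^sup>2) =
          expectation (\<lambda>\<omega>. (a * (X u \<omega> - X s \<omega>) + b * (X (q * u) \<omega> - X (q * s) \<omega>))\<^sup>2)"
        by (intro Bochner_Integration.integral_cong) (auto simp: drift_def algebra_simps)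
      also have "\<dots> \<le> 2 * (a\<^sup>2 + b\<^sup>2) * (C1 * h)"
        using u st le delay_bounds[of u] delay_bounds[of s] by (intro expectation_sum_power2_le L2_diff X_L2 inc; simp add: h_def)
      finally show "expectation (\<lambda>\<omega>. (indicator A \<omega> * (drift u \<omega> - drift s \<omega>))\<^sup>2) \<le> 2 * (a\<^sup>2 + b\<^sup>2) * (C1 * h)"
        using drop[OF L] by simp
      have "expectation (\<lambda>\<omega>. (indicator A \<omega> * (noise u \<omega> - noise s \<omega>))\<^sup>2) =
          \<sigma>\<^sup>2 * expectation (\<lambda>\<omega>. (indicator A \<omega> * (X u \<omega> - X s \<omega>))\<^sup>2)"
        unfolding noise right_diff_distrib[symmetric]
        by (simp add: power_mult_distrib mult.left_commute[of _ "\<sigma>\<^sup>2"])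
      also have "\<dots> \<le> \<sigma>\<^sup>2 * (C2 * h\<^sup>2)" using local_inc[OF u] by (intro mult_left_mono) auto
      finally show "expectation (\<lambda>\<omega>. (indicator A \<omega> * (noise u \<omega> - noise s \<omega>))\<^sup>2) \<le> \<sigma>\<^sup>2 * (C2 * h\<^sup>2)" .
    qed (use st drift_L2 drift_adapted noise_L2 noise_adapted in auto)
    also have "\<dots> = C * h ^ 3" by (simp add: C_def h_def power2_eq_square power3_eq_cube algebra_simps)
    finally show ?thesis by (simp add: A_def h_def remainder_def)
  qed
  with nn show ?thesis by blast
qed

text \<open>With \<epsilon> the sign of X s, |y| = \<epsilon> y + 2 max 0 (- \<epsilon> y). The
  first part is linear in the expansion and yields the drift a |X s|; the second measures sign
  changes and must have mean O(h^(3/2)). The delayed drift term is kept outside y and enters through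
  the triangle inequality, which produces |b|.\<close>

lemma first_moment_step:
  assumes \<rho>: "\<rho> = 0"
  shows "\<exists>C \<delta>. 0 < \<delta> \<and> (\<forall>s t. 0 \<le> s \<longrightarrow> s < t \<longrightarrow> t \<le> T \<longrightarrow> t - s \<le> \<delta> \<longrightarrow>
    expectation (\<lambda>\<omega>. \<bar>X t \<omega>\<bar>) \<le> expectation (\<lambda>\<omega>. \<bar>X s \<omega>\<bar>) +
      (t - s) * (a * expectation (\<lambda>\<omega>. \<bar>X s \<omega>\<bar>) + \<bar>b\<bar> * expectation (\<lambda>\<omega>. \<bar>X (q * s) \<omega>\<bar>)) +
      C * ((t - s) * sqrt (t - s)))"
proof -
  obtain K where K: "0 \<le> K" "\<And>t. 0 \<le> t \<Longrightarrow> t \<le> T \<Longrightarrow> second_moment (X t) \<le> K"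
    using moment_bound[of T] by blast
  obtain C where C: "0 \<le> C"
    "\<And>s t. 0 \<le> s \<Longrightarrow> s < t \<Longrightarrow> t \<le> T \<Longrightarrow> t - s \<le> 1 \<Longrightarrow> expectation (\<lambda>\<omega>. (remainder s t \<omega>)\<^sup>2) \<le> C * (t - s)\<^sup>2"
    "\<And>s t \<xi>. 0 \<le> s \<Longrightarrow> s < t \<Longrightarrow> t \<le> T \<Longrightarrow> t - s \<le> 1 \<Longrightarrow> \<xi> \<in> L2 M \<Longrightarrow> \<xi> \<in> borel_measurable (F s) \<Longrightarrow>
       expectation (\<lambda>\<omega>. \<xi> \<omega> * remainder s t \<omega>) \<le> (second_moment \<xi> + C) * ((t - s) * sqrt (t - s))"
    by (rule remainder_estimates[of T]) (rule that)
  obtain C3 where C3: "0 \<le> C3"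
    "\<And>s t. 0 \<le> s \<Longrightarrow> s < t \<Longrightarrow> t \<le> T \<Longrightarrow> t - s \<le> 1 \<Longrightarrow>
      expectation (\<lambda>\<omega>. (indicator {\<omega> \<in> space M. (X s \<omega>)\<^sup>2 \<le> t - s} \<omega> * remainder s t \<omega>)\<^sup>2) \<le> C3 * (t - s) ^ 3"
    using remainder_near_zero[OF \<rho>, of T] by blast
  \<comment> \<open>This makes |a h| <= 1 / 4, so that 1 + a h + z can fall below 1 / 2 only if the
    noise term z is below - 1 / 4.\<close>
  define \<delta> where "\<delta> = 1 / (4 * (\<bar>a\<bar> + 1))"
  have \<delta>: "0 < \<delta>" "\<delta> \<le> 1" "\<bar>a\<bar> * \<delta> \<le> 1 / 4" by (auto simp: \<delta>_def field_simps)
  \<comment> \<open>384 = 2 * 64 * 3: the factor 2 of the sign-change term, 64 from bounding |z| by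
    z^4, and 3 from the fourth moment of a normal variable. The other summands come from the mean of
    \<epsilon> R, from R on A, and from R outside A.\<close>
  define C' where "C' = (1 + C) + 384 * \<sigma> ^ 4 * (1 + K) + (1 + C3) + C"
  show ?thesis
  proof (rule exI[of _ C'], rule exI[of _ \<delta>], intro conjI allI impI)
    fix s t assume st: "0 \<le> s" "s < t" "t \<le> T" "t - s \<le> \<delta>"
    then have st1: "t - s \<le> 1" using \<delta> by simp
    define h where "h = t - s"
    define r where "r = sqrt h"
    have h: "0 < h" "h \<le> 1" "h \<le> \<delta>" using st st1 by (auto simp: h_def)
    have r: "0 < r" "r \<le> 1" "h = r\<^sup>2" using h by (auto simp: r_def)
    have qs: "0 \<le> q * s" "q * s \<le> T" using delay_bounds[of s] st by auto
    define \<Delta> where "\<Delta> \<omega> = B t \<omega> - B s \<omega>" for \<omega>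
    define R where "R = remainder s t"
    define A where "A = {\<omega> \<in> space M. (X s \<omega>)\<^sup>2 \<le> h}"
    define \<epsilon> :: "'a \<Rightarrow> real" where "\<epsilon> \<omega> = (if 0 \<le> X s \<omega> then 1 else -1)" for \<omega>
    have Xs: "X s \<in> borel_measurable (F s)" using X_adapted st by simp
    have L: "X s \<in> L2 M" "R \<in> L2 M" "X (q * s) \<in> L2 M" "X t \<in> L2 M"
      using st qs by (auto simp: R_def intro!: X_L2 remainder_L2)
    have AM: "A \<in> events"
      unfolding A_def using L(1)[THEN L2_measurable] by measurable
    have \<epsilon>: "\<epsilon> \<in> borel_measurable (F s)" unfolding \<epsilon>_def[abs_def] using Xs by measurable
    have \<epsilon>L: "\<epsilon> \<in> L2 M" using adapted_measurable[OF st(1) \<epsilon>]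
      by (intro L2_bound[of _ _ "\<lambda>_. 1"]) (auto simp: \<epsilon>_def)
    have iX: "integrable M (X s)" "integrable M (X t)" "integrable M (X (q * s))" using L L2_integrable by auto
    have i1: "integrable M (\<lambda>\<omega>. \<bar>X s \<omega>\<bar> * \<Delta> \<omega>)" "expectation (\<lambda>\<omega>. \<bar>X s \<omega>\<bar> * \<Delta> \<omega>) = 0"
      using increment_orthogonal[OF st(1,2), of "\<lambda>\<omega>. \<bar>X s \<omega>\<bar>"] Xs iX by (auto simp: \<Delta>_def)
    have i2: "integrable M (\<lambda>\<omega>. \<bar>X s \<omega>\<bar> * \<Delta> \<omega> ^ 4)" "expectation (\<lambda>\<omega>. \<bar>X s \<omega>\<bar> * \<Delta> \<omega> ^ 4) = 3 * h\<^sup>2 * expectation (\<lambda>\<omega>. \<bar>X s \<omega>\<bar>)"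
      using adapted_times_increment[OF st(1,2), of "\<lambda>\<omega>. \<bar>X s \<omega>\<bar>" 4] increment_moments(4)[OF st(1,2)] Xs iX
      by (auto simp: \<Delta>_def h_def)
    have i3: "integrable M (\<lambda>\<omega>. \<epsilon> \<omega> * R \<omega>)" by (rule L2_mult_integrable[OF \<epsilon>L L(2)])
    have i4: "integrable M (\<lambda>\<omega>. (indicator A \<omega> * R \<omega>)\<^sup>2)" "integrable M (\<lambda>\<omega>. (R \<omega>)\<^sup>2)"
      using L2_integrable_power2[OF L2_indicator_mult[OF AM L(2)]] L2_integrable_power2[OF L(2)] by auto
    have pw: "\<bar>X t \<omega>\<bar> \<le> (1 + a * h) * \<bar>X s \<omega>\<bar> + \<sigma> * (\<bar>X s \<omega>\<bar> * \<Delta> \<omega>) + \<epsilon> \<omega> * R \<omega> + h * \<bar>b\<bar> * \<bar>X (q * s) \<omega>\<bar>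
       + 128 * \<sigma> ^ 4 * (\<bar>X s \<omega>\<bar> * \<Delta> \<omega> ^ 4) + (r ^ 3 + (indicator A \<omega> * R \<omega>)\<^sup>2 / r ^ 3) + (R \<omega>)\<^sup>2 / r"
      if \<omega>: "\<omega> \<in> space M" for \<omega>
    proof -
      define x where "x = \<bar>X s \<omega>\<bar>"
      define z where "z = \<sigma> * \<Delta> \<omega>"
      define y where "y = X s \<omega> * (1 + a * h + z) + R \<omega>"
      have noise: "noise s \<omega> = \<sigma> * X s \<omega>" unfolding noise_def using \<rho> by simp
      have x: "0 \<le> x" "\<epsilon> \<omega> * X s \<omega> = x" "\<bar>\<epsilon> \<omega>\<bar> = 1" by (auto simp: x_def \<epsilon>_def)
      have "X t \<omega> = y + h * b * X (q * s) \<omega>"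
        unfolding y_def z_def R_def remainder_def noise drift_def \<Delta>_def h_def by (simp add: algebra_simps)
      then have "\<bar>X t \<omega>\<bar> \<le> \<bar>y\<bar> + \<bar>h * b * X (q * s) \<omega>\<bar>" by linarith
      also have "\<bar>h * b * X (q * s) \<omega>\<bar> = h * \<bar>b\<bar> * \<bar>X (q * s) \<omega>\<bar>" using h by (simp add: abs_mult)
      finally have 1: "\<bar>X t \<omega>\<bar> \<le> \<bar>y\<bar> + h * \<bar>b\<bar> * \<bar>X (q * s) \<omega>\<bar>" .
      have ey: "\<epsilon> \<omega> * y = x * (1 + a * h + z) + \<epsilon> \<omega> * R \<omega>"
        using x(2) by (simp add: y_def distrib_left flip: mult.assoc)
      have "\<bar>\<epsilon> \<omega> * y\<bar> = \<bar>y\<bar>" using x by (simp add: abs_mult)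
      then have 2: "\<bar>y\<bar> = \<epsilon> \<omega> * y + 2 * max 0 (- (\<epsilon> \<omega> * y))" by linarith
      have "\<bar>a * h\<bar> \<le> 1 / 4"
        using mult_left_mono[OF h(3), of "\<bar>a\<bar>"] \<delta>(3) h by (simp add: abs_mult)
      then have ah: "- (a * h) \<le> 1 / 4" by linarith
      \<comment> \<open>Beyond 1 / 4 the cube of 4 |z| is at least 1, whence 64 = 4^3. The fourth
        power is chosen because the mean of x z^4 is of order h^2.\<close>
      have z4: "\<bar>z\<bar> - 1 / 4 \<le> 64 * z ^ 4"
      proof (cases "\<bar>z\<bar> \<le> 1 / 4")
        case True
        moreover have "0 \<le> 64 * z ^ 4" by simp
        ultimately show ?thesis by linarith
      next
        case False
        have "\<bar>z\<bar> * (1 / 4) ^ 3 \<le> \<bar>z\<bar> * \<bar>z\<bar> ^ 3" using False by (intro mult_left_mono power_mono) auto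
        also have "\<dots> = \<bar>z ^ 4\<bar>" by (simp add: numeral_eq_Suc abs_mult)
        also have "\<dots> = z ^ 4" by simp
        finally have "\<bar>z\<bar> \<le> 64 * z ^ 4" by (simp add: power3_eq_cube)
        then show ?thesis by simp
      qed
      \<comment> \<open>- (1 + a h + z) <= (|z| - 1 / 4) - 1 / 2. The surplus - x / 2 is kept in
        order to absorb R where x is not small.\<close>
      have "- (\<epsilon> \<omega> * y) \<le> x * (64 * z ^ 4) + (\<bar>R \<omega>\<bar> - x / 2)"
      proof -
        have "- (\<epsilon> \<omega> * R \<omega>) \<le> \<bar>R \<omega>\<bar>" using x(3) abs_ge_minus_self[of "\<epsilon> \<omega> * R \<omega>"] by (simp add: abs_mult)
        moreover have "x * (- (1 + a * h + z)) \<le> x * (64 * z ^ 4 - 1 / 2)"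
          using z4 ah x(1) by (intro mult_left_mono) linarith+
        ultimately show ?thesis unfolding ey by (simp add: algebra_simps)
      qed
      moreover have "0 \<le> x * (64 * z ^ 4)" using x by simp
      \<comment> \<open>On A, R has second moment O(r^6) by \<open>remainder_near_zero\<close>, so
        r^3 is the right weight. Outside A one has x > r, and - x / 2 cancels the r / 2 in |R| <=
        R^2 / (2 r) + r / 2; there the general bound makes the mean of R^2 / r of order r^3.\<close>
      moreover have "\<bar>R \<omega>\<bar> - x / 2 \<le> (r ^ 3 + (indicator A \<omega> * R \<omega>)\<^sup>2 / r ^ 3) / 2 + (R \<omega>)\<^sup>2 / r / 2"
      proof (cases "\<omega> \<in> A")
        case True
        have "0 \<le> (\<bar>R \<omega>\<bar> - r ^ 3)\<^sup>2 / r ^ 3" using r by simp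
        also have "\<dots> = (R \<omega>)\<^sup>2 / r ^ 3 - 2 * \<bar>R \<omega>\<bar> + r ^ 3"
          using r by (simp add: power2_eq_square field_simps)
        finally have "\<bar>R \<omega>\<bar> \<le> (r ^ 3 + (indicator A \<omega> * R \<omega>)\<^sup>2 / r ^ 3) / 2" using True by simp
        moreover have "0 \<le> (R \<omega>)\<^sup>2 / r / 2" using r by simp
        ultimately show ?thesis using x(1) by linarith
      next
        case False
        then have "r\<^sup>2 < x\<^sup>2" using \<omega> r by (auto simp: A_def x_def)
        then have "r < x" using x(1) by (rule power2_less_imp_less)
        have "0 \<le> (\<bar>R \<omega>\<bar> - r)\<^sup>2 / r" using r by simp
        also have "\<dots> = (R \<omega>)\<^sup>2 / r - 2 * \<bar>R \<omega>\<bar> + r"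
          using r by (simp add: power2_eq_square field_simps)
        finally have "\<bar>R \<omega>\<bar> \<le> (R \<omega>)\<^sup>2 / r / 2 + r / 2" by simp
        moreover have "0 \<le> (r ^ 3 + (indicator A \<omega> * R \<omega>)\<^sup>2 / r ^ 3) / 2" using r by simp
        ultimately show ?thesis using \<open>r < x\<close> by linarith
      qed
      moreover have "0 \<le> (r ^ 3 + (indicator A \<omega> * R \<omega>)\<^sup>2 / r ^ 3) / 2 + (R \<omega>)\<^sup>2 / r / 2" using r by simp
      moreover have half: "m \<le> p + (u / 2 + v / 2) \<Longrightarrow> 2 * m \<le> 2 * p + (u + v)" for m p u v :: real
        by linarith
      ultimately have "max 0 (- (\<epsilon> \<omega> * y)) \<le> x * (64 * z ^ 4) + ((r ^ 3 + (indicator A \<omega> * R \<omega>)\<^sup>2 / r ^ 3) / 2 + (R \<omega>)\<^sup>2 / r / 2)"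
        by simp
      then have 3: "2 * max 0 (- (\<epsilon> \<omega> * y)) \<le> 2 * (x * (64 * z ^ 4)) +
          ((r ^ 3 + (indicator A \<omega> * R \<omega>)\<^sup>2 / r ^ 3) + (R \<omega>)\<^sup>2 / r)"
        by (rule half)
      have "\<bar>X t \<omega>\<bar> \<le> x * (1 + a * h + z) + \<epsilon> \<omega> * R \<omega> + 2 * max 0 (- (\<epsilon> \<omega> * y)) + h * \<bar>b\<bar> * \<bar>X (q * s) \<omega>\<bar>"
        using 1 2 unfolding ey by simp
      also have "\<dots> \<le> x * (1 + a * h + z) + \<epsilon> \<omega> * R \<omega> +
          (2 * (x * (64 * z ^ 4)) + ((r ^ 3 + (indicator A \<omega> * R \<omega>)\<^sup>2 / r ^ 3) + (R \<omega>)\<^sup>2 / r)) +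
          h * \<bar>b\<bar> * \<bar>X (q * s) \<omega>\<bar>"
        by (intro add_right_mono add_left_mono 3)
      also have "\<dots> = x * (1 + a * h + z) + \<epsilon> \<omega> * R \<omega> + h * \<bar>b\<bar> * \<bar>X (q * s) \<omega>\<bar> +
         2 * (x * (64 * z ^ 4)) + (r ^ 3 + (indicator A \<omega> * R \<omega>)\<^sup>2 / r ^ 3) + (R \<omega>)\<^sup>2 / r"
        by (simp only: add_ac)
      also have "2 * (x * (64 * z ^ 4)) = 128 * \<sigma> ^ 4 * (x * \<Delta> \<omega> ^ 4)" by (simp add: z_def power_mult_distrib)
      also have "x * (1 + a * h + z) = (1 + a * h) * x + \<sigma> * (x * \<Delta> \<omega>)" by (simp add: z_def algebra_simps)
      finally show ?thesis by (simp add: x_def)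
    qed
    have "expectation (\<lambda>\<omega>. \<bar>X t \<omega>\<bar>) \<le> expectation (\<lambda>\<omega>. (1 + a * h) * \<bar>X s \<omega>\<bar> + \<sigma> * (\<bar>X s \<omega>\<bar> * \<Delta> \<omega>) + \<epsilon> \<omega> * R \<omega> + h * \<bar>b\<bar> * \<bar>X (q * s) \<omega>\<bar>
       + 128 * \<sigma> ^ 4 * (\<bar>X s \<omega>\<bar> * \<Delta> \<omega> ^ 4) + (r ^ 3 + (indicator A \<omega> * R \<omega>)\<^sup>2 / r ^ 3) + (R \<omega>)\<^sup>2 / r)"
      using iX i1(1) i2(1) i3 i4 by (intro integral_mono pw) simp_all
    also have "\<dots> = (1 + a * h) * expectation (\<lambda>\<omega>. \<bar>X s \<omega>\<bar>) + expectation (\<lambda>\<omega>. \<epsilon> \<omega> * R \<omega>) + h * \<bar>b\<bar> * expectation (\<lambda>\<omega>. \<bar>X (q * s) \<omega>\<bar>)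
       + 128 * \<sigma> ^ 4 * (3 * h\<^sup>2 * expectation (\<lambda>\<omega>. \<bar>X s \<omega>\<bar>)) + (r ^ 3 + expectation (\<lambda>\<omega>. (indicator A \<omega> * R \<omega>)\<^sup>2) / r ^ 3) + second_moment R / r"
      using iX i1 i2 i3 i4 by (simp add: prob_space)
    also have "\<dots> \<le> (1 + a * h) * expectation (\<lambda>\<omega>. \<bar>X s \<omega>\<bar>) + (1 + C) * r ^ 3 + h * \<bar>b\<bar> * expectation (\<lambda>\<omega>. \<bar>X (q * s) \<omega>\<bar>)
       + 128 * \<sigma> ^ 4 * (3 * (r ^ 3 * (1 + K))) + (r ^ 3 + C3 * r ^ 3) + C * r ^ 3"
    proof -
      have e1: "expectation (\<lambda>\<omega>. \<epsilon> \<omega> * R \<omega>) \<le> (1 + C) * r ^ 3"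
      proof -
        have "expectation (\<lambda>\<omega>. (\<epsilon> \<omega>)\<^sup>2) = expectation (\<lambda>\<omega>. 1)"
          by (intro Bochner_Integration.integral_cong) (auto simp: \<epsilon>_def)
        then have "expectation (\<lambda>\<omega>. \<epsilon> \<omega> * R \<omega>) \<le> (1 + C) * (h * r)"
          using C(3)[OF st(1-3) st1 \<epsilon>L \<epsilon>] by (simp add: R_def h_def r_def prob_space)
        also have "h * r = r ^ 3" by (simp add: r(3) power2_eq_square power3_eq_cube)
        finally show ?thesis .
      qed
      have e2: "h\<^sup>2 * expectation (\<lambda>\<omega>. \<bar>X s \<omega>\<bar>) \<le> r ^ 3 * (1 + K)"
      proof (rule mult_mono)
        have "h\<^sup>2 = r * r ^ 3" by (simp add: r(3) power2_eq_square power3_eq_cube)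
        also have "\<dots> \<le> 1 * r ^ 3" using r by (intro mult_right_mono) auto
        finally show "h\<^sup>2 \<le> r ^ 3" by simp
        have "\<bar>X s \<omega>\<bar> \<le> 1 + (X s \<omega>)\<^sup>2" for \<omega>
          using zero_le_power2[of "\<bar>X s \<omega>\<bar> - 1"] abs_ge_zero[of "X s \<omega>"] by (simp add: power2_eq_square algebra_simps)
        then have "expectation (\<lambda>\<omega>. \<bar>X s \<omega>\<bar>) \<le> expectation (\<lambda>\<omega>. 1 + (X s \<omega>)\<^sup>2)"
          using iX L2_integrable_power2[OF L(1)] by (intro integral_mono) auto
        also have "\<dots> \<le> 1 + K" using K(2)[of s] st L2_integrable_power2[OF L(1)] by (simp add: prob_space)
        finally show "expectation (\<lambda>\<omega>. \<bar>X s \<omega>\<bar>) \<le> 1 + K" .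
      qed (use r in auto)
      have "expectation (\<lambda>\<omega>. (indicator A \<omega> * R \<omega>)\<^sup>2) \<le> C3 * h ^ 3"
        using C3(2)[OF st(1-3) st1] by (simp add: A_def R_def h_def)
      then have "expectation (\<lambda>\<omega>. (indicator A \<omega> * R \<omega>)\<^sup>2) / r ^ 3 \<le> C3 * h ^ 3 / r ^ 3"
        using r by (intro divide_right_mono) auto
      also have "\<dots> = C3 * r ^ 3" using r by (simp add: power2_eq_square power3_eq_cube)
      finally have e3: "expectation (\<lambda>\<omega>. (indicator A \<omega> * R \<omega>)\<^sup>2) / r ^ 3 \<le> C3 * r ^ 3" .
      have "second_moment R / r \<le> C * h\<^sup>2 / r"
        using C(2)[OF st(1-3) st1] r by (intro divide_right_mono) (auto simp: R_def h_def)
      also have "\<dots> = C * r ^ 3" using r by (simp add: power2_eq_square power3_eq_cube)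
      finally have e4: "second_moment R / r \<le> C * r ^ 3" .
      have "3 * h\<^sup>2 * expectation (\<lambda>\<omega>. \<bar>X s \<omega>\<bar>) \<le> 3 * (r ^ 3 * (1 + K))" using e2 by simp
      then have e2': "128 * \<sigma> ^ 4 * (3 * h\<^sup>2 * expectation (\<lambda>\<omega>. \<bar>X s \<omega>\<bar>)) \<le> 128 * \<sigma> ^ 4 * (3 * (r ^ 3 * (1 + K)))"
        by (intro mult_left_mono) auto
      show ?thesis by (intro add_mono order_refl e1 e2' e3 e4)
    qed
    also have "\<dots> = expectation (\<lambda>\<omega>. \<bar>X s \<omega>\<bar>) +
      h * (a * expectation (\<lambda>\<omega>. \<bar>X s \<omega>\<bar>) + \<bar>b\<bar> * expectation (\<lambda>\<omega>. \<bar>X (q * s) \<omega>\<bar>)) + C' * r ^ 3"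
      by (simp add: C'_def algebra_simps)
    also have "r ^ 3 = h * r" by (simp add: r(3) power2_eq_square power3_eq_cube)
    finally show "expectation (\<lambda>\<omega>. \<bar>X t \<omega>\<bar>) \<le> expectation (\<lambda>\<omega>. \<bar>X s \<omega>\<bar>) +
      (t - s) * (a * expectation (\<lambda>\<omega>. \<bar>X s \<omega>\<bar>) + \<bar>b\<bar> * expectation (\<lambda>\<omega>. \<bar>X (q * s) \<omega>\<bar>)) +
      C' * ((t - s) * sqrt (t - s))" by (simp add: h_def r_def)
  qed (use \<delta> in simp)
qed

section \<open>The two moment bounds and their exponents\<close>

lemma first_moment_bound:
  assumes \<rho>: "\<rho> = 0" and a: "a < 0"
  shows "\<exists>C>0. \<forall>t\<ge>0. expectation (\<lambda>\<omega>. \<bar>X t \<omega>\<bar>)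
    \<le> C * expectation (\<lambda>\<omega>. \<bar>X 0 \<omega>\<bar>) * (1 + t) powr (1 / ln q * ln (- a / \<bar>b\<bar>))"
proof -
  interpret V: pantograph_inequality "\<lambda>t. expectation (\<lambda>\<omega>. \<bar>X t \<omega>\<bar>)" "- a" "\<bar>b\<bar>" q
  proof
    fix T
    show "\<exists>C \<delta>. 0 < \<delta> \<and> (\<forall>s t. 0 \<le> s \<longrightarrow> s < t \<longrightarrow> t \<le> T \<longrightarrow> t - s \<le> \<delta> \<longrightarrow>
      expectation (\<lambda>\<omega>. \<bar>X t \<omega>\<bar>) \<le> expectation (\<lambda>\<omega>. \<bar>X s \<omega>\<bar>) +
       (t - s) * (- (- a) * expectation (\<lambda>\<omega>. \<bar>X s \<omega>\<bar>) + \<bar>b\<bar> * expectation (\<lambda>\<omega>. \<bar>X (q * s) \<omega>\<bar>)) +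
       C * ((t - s) * sqrt (t - s)))"
      using first_moment_step[OF \<rho>, of T] by simp
  qed (use q a first_moment_continuous in auto)
  show ?thesis
  proof (cases "b = 0")
    case True
    \<comment> \<open>Here the exponent is \<open>0\<close>, since \<open>- a / 0 = 0\<close> and \<open>ln 0 = 0\<close>.\<close>
    show ?thesis
    proof (intro exI[of _ 1] conjI allI impI)
      fix t :: real assume "0 \<le> t"
      then show "expectation (\<lambda>\<omega>. \<bar>X t \<omega>\<bar>) \<le> 1 * expectation (\<lambda>\<omega>. \<bar>X 0 \<omega>\<bar>) * (1 + t) powr (1 / ln q * ln (- a / \<bar>b\<bar>))"
        using V.exp_bound[of t] True by simp
    qed simp
  next
    case False
    have "0 < - a / \<bar>b\<bar>" using a False by (simp add: divide_neg_pos)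
    then have "q powr (1 / ln q * ln (- a / \<bar>b\<bar>)) = - a / \<bar>b\<bar>" using q by (simp add: powr_def)
    then have "\<bar>b\<bar> * q powr (1 / ln q * ln (- a / \<bar>b\<bar>)) = - a" using False by simp
    then show ?thesis by (rule V.polynomial_bound)
  qed
qed

lemma second_moment_bound:
  assumes \<rho>: "\<rho> \<noteq> 0" and a: "2 * a + \<sigma>\<^sup>2 < 0"
  shows "\<exists>C>0. \<forall>t\<ge>0. second_moment (X t)
    \<le> C * second_moment (X 0) * (1 + t) powr (2 / ln q *
        ln (1 / \<rho>\<^sup>2 * (sqrt (\<bar>b + \<sigma> * \<rho>\<bar>\<^sup>2 - \<rho>\<^sup>2 * (2 * a + \<sigma>\<^sup>2)) - \<bar>b + \<sigma> * \<rho>\<bar>)))"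
proof -
  define \<beta> where "\<beta> = \<bar>b + \<sigma> * \<rho>\<bar>"
  define w where "w = sqrt (\<beta>\<^sup>2 - \<rho>\<^sup>2 * (2 * a + \<sigma>\<^sup>2))"
  \<comment> \<open>z is q^(\<alpha> / 2). Splitting the mixed term with weight z gives the
    coefficients - (2 a + \<sigma>^2) - \<beta> z for A and \<beta> / z + \<rho>^2 for B'. The
    condition B' z^2 = A on the exponent is then the quadratic equation \<open>quad\<close>, and z
    is its positive root.\<close>
  define z where "z = 1 / \<rho>\<^sup>2 * (w - \<beta>)"
  have \<beta>: "0 \<le> \<beta>" by (simp add: \<beta>_def)
  have \<rho>2: "0 < \<rho>\<^sup>2" using \<rho> by simp
  have neg: "\<rho>\<^sup>2 * (2 * a + \<sigma>\<^sup>2) < 0" using \<rho>2 a by (rule mult_pos_neg)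
  have "\<beta> < w" unfolding w_def using neg \<beta> by (intro real_less_rsqrt) auto
  then have z: "0 < z" using \<rho>2 by (simp add: z_def)
  have "w\<^sup>2 = \<beta>\<^sup>2 - \<rho>\<^sup>2 * (2 * a + \<sigma>\<^sup>2)"
    unfolding w_def using neg \<beta> by (intro real_sqrt_pow2) (smt (verit) zero_le_power2)
  moreover have w: "w = \<rho>\<^sup>2 * z + \<beta>" using \<rho>2 by (simp add: z_def)
  ultimately have "\<rho>\<^sup>2 * (\<rho>\<^sup>2 * z\<^sup>2 + 2 * \<beta> * z + (2 * a + \<sigma>\<^sup>2)) = 0"
    by (simp add: power2_eq_square algebra_simps)
  then have quad: "\<rho>\<^sup>2 * z\<^sup>2 + 2 * \<beta> * z + (2 * a + \<sigma>\<^sup>2) = 0" using \<rho>2 by simp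
  \<comment> \<open>The weight \<open>z\<close> in \<open>2 x y \<le> z x\<^sup>2 + y\<^sup>2 / z\<close> is the one for which the linear inequality
    for the second moment has the exponent given by the quadratic equation.\<close>
  define A where "A = \<beta> * z + \<rho>\<^sup>2 * z\<^sup>2"
  define B' where "B' = \<beta> / z + \<rho>\<^sup>2"
  have A: "0 < A" using \<beta> z \<rho>2 by (simp add: A_def add_nonneg_pos)
  have B': "0 \<le> B'" using \<beta> z by (simp add: B'_def)
  have quad_form: "2 * x * (a * x + b * y) + (\<sigma> * x + \<rho> * y)\<^sup>2 \<le> - A * x\<^sup>2 + B' * y\<^sup>2" for x y :: real
  proof -
    have "2 * x * (a * x + b * y) + (\<sigma> * x + \<rho> * y)\<^sup>2 = (2 * a + \<sigma>\<^sup>2) * x\<^sup>2 + 2 * ((b + \<sigma> * \<rho>) * (x * y)) + \<rho>\<^sup>2 * y\<^sup>2"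
      by (simp add: power2_eq_square algebra_simps)
    moreover have "(b + \<sigma> * \<rho>) * (x * y) \<le> \<beta> * \<bar>x * y\<bar>"
      using abs_ge_self[of "(b + \<sigma> * \<rho>) * (x * y)"] by (simp add: \<beta>_def abs_mult)
    moreover have "\<beta> * (2 * \<bar>x * y\<bar>) \<le> \<beta> * (z * x\<^sup>2 + y\<^sup>2 / z)"
    proof (rule mult_left_mono[OF _ \<beta>])
      have "0 \<le> (z * \<bar>x\<bar> - \<bar>y\<bar>)\<^sup>2 / z" using z by simp
      also have "\<dots> = z * x\<^sup>2 - 2 * \<bar>x * y\<bar> + y\<^sup>2 / z"
        using z by (simp add: power2_eq_square field_simps abs_mult)
      finally show "2 * \<bar>x * y\<bar> \<le> z * x\<^sup>2 + y\<^sup>2 / z" by simp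
    qed
    moreover have "2 * a + \<sigma>\<^sup>2 = - A - \<beta> * z" using quad by (simp add: A_def)
    then have "(2 * a + \<sigma>\<^sup>2) * x\<^sup>2 = - A * x\<^sup>2 - \<beta> * (z * x\<^sup>2)"
      by (simp only: left_diff_distrib mult.assoc)
    moreover have "B' * y\<^sup>2 = \<beta> * (y\<^sup>2 / z) + \<rho>\<^sup>2 * y\<^sup>2" by (simp add: B'_def algebra_simps)
    ultimately show ?thesis by (simp add: distrib_left)
  qed
  interpret V: pantograph_inequality "\<lambda>t. second_moment (X t)" A B' q
    using q A B' second_moment_continuous second_moment_step[OF quad_form]
    by unfold_locales simp_all
  have "q powr (2 / ln q * ln z) = z\<^sup>2"
  proof -
    have "q powr (2 / ln q * ln z) = z powr 2" using q z by (simp add: powr_def)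
    also have "\<dots> = z\<^sup>2" using z by (simp add: powr_numeral)
    finally show ?thesis .
  qed
  then have "B' * q powr (2 / ln q * ln z) = A"
    using z by (simp add: A_def B'_def power2_eq_square field_simps)
  from V.polynomial_bound[OF this] show ?thesis
    unfolding z_def w_def \<beta>_def .
qed

end

section \<open>The augmented natural filtration\<close>

lemma sets_process_sigma:
  "sets (process_sigma M I B) = sigma_sets (space M) (\<Union>s\<in>I. {B s -` A \<inter> space M | A. A \<in> sets borel})"
  unfolding process_sigma_def by (rule sets_measure_of) auto

lemma space_process_sigma [simp]: "space (process_sigma M I B) = space M"
  unfolding process_sigma_def by (rule space_measure_of) auto

lemma process_sigma_mono: "I \<subseteq> J \<Longrightarrow> sets (process_sigma M I B) \<subseteq> sets (process_sigma M J B)"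
  unfolding sets_process_sigma by (intro sigma_sets_mono') auto

lemma process_sigma_measurable: "s \<in> I \<Longrightarrow> B s \<in> borel_measurable (process_sigma M I B)"
  by (rule measurableI) (auto simp: sets_process_sigma intro!: sigma_sets.Basic)

lemma process_sigma_subset_sets:
  assumes "\<And>s. s \<in> I \<Longrightarrow> B s \<in> borel_measurable M"
  shows "sets (process_sigma M I B) \<subseteq> sets M"
  unfolding sets_process_sigma using assms
  by (intro sets.sigma_sets_subset) (auto intro: measurable_sets)

lemma space_natural_filtration [simp]: "space (natural_filtration M X0 B t) = space M"
proof -
  have "sets (vimage_algebra (space M) X0 borel) \<union> sets (process_sigma M {0..t} B) \<union> null_sets M \<subseteq> Pow (space M)"
    using sets.sets_into_space[of _ "vimage_algebra (space M) X0 borel"]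
      sets.sets_into_space[of _ "process_sigma M {0..t} B"] sets.sets_into_space[of _ M] by fastforce
  then show ?thesis unfolding natural_filtration_def by (rule space_measure_of)
qed

lemma sets_natural_filtration:
  "sets (natural_filtration M X0 B t) = sigma_sets (space M)
     (sets (vimage_algebra (space M) X0 borel) \<union> sets (process_sigma M {0..t} B) \<union> null_sets M)"
proof -
  have "sets (vimage_algebra (space M) X0 borel) \<union> sets (process_sigma M {0..t} B) \<union> null_sets M \<subseteq> Pow (space M)"
    using sets.sets_into_space[of _ "vimage_algebra (space M) X0 borel"]
      sets.sets_into_space[of _ "process_sigma M {0..t} B"] sets.sets_into_space[of _ M] by fastforce
  then show ?thesis unfolding natural_filtration_def by (rule sets_measure_of)
qed

lemma null_sets_natural_filtration: "N \<in> null_sets M \<Longrightarrow> N \<in> sets (natural_filtration M X0 B t)"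
  unfolding sets_natural_filtration by auto

text \<open>The work lies in the independence of an increment from the past enlarged by X0 and the
  null sets. For A0 from X0, A1 from B up to time s and D from the increment, the product formula
  takes two moves: A0 is independent of the path event A1 \<inter> D, and D is independent of A1. A
  pi-lambda argument passes to the generated sigma-algebra.\<close>

lemma wiener_filtration_natural_filtration:
  assumes wiener: "wiener_process M B" and X0: "X0 \<in> borel_measurable M"
    and indep: "prob_space.indep_set M (sets (vimage_algebra (space M) X0 borel)) (sets (process_sigma M {0..} B))"
  shows "wiener_filtration M (natural_filtration M X0 B) B"
proof -
  interpret prob_space M using wiener by (simp add: wiener_process_def)
  let ?V = "sets (vimage_algebra (space M) X0 borel)" and ?P = "\<lambda>t. sets (process_sigma M {0..t} B)"
  have B: "B t \<in> borel_measurable M" if "0 \<le> t" for t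
    using wiener that by (simp add: wiener_process_def)
  have V: "?V \<subseteq> events"
    using X0 by (intro sets_image_in_sets) auto
  have P: "?P t \<subseteq> events" for t using B by (intro process_sigma_subset_sets) auto
  show ?thesis
  proof
    fix s :: real assume "0 \<le> s"
    show "subalgebra M (natural_filtration M X0 B s)"
      unfolding subalgebra_def sets_natural_filtration
    proof (intro conjI sets.sigma_sets_subset Un_least V P)
      show "null_sets M \<subseteq> events" by (auto intro: null_setsD2)
    qed simp
    fix t assume "s \<le> t"
    then show "sets (natural_filtration M X0 B s) \<subseteq> sets (natural_filtration M X0 B t)"
      unfolding sets_natural_filtration using process_sigma_mono[of "{0..s}" "{0..t}" M B]
      by (intro sigma_sets_mono') auto
  next
    fix t :: real assume t: "0 \<le> t"
    show "B t \<in> borel_measurable (natural_filtration M X0 B t)"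
      using measurable_sets[OF process_sigma_measurable[of t "{0..t}" B M]] t
      by (intro measurableI) (auto simp: sets_natural_filtration)
  next
    fix s t :: real assume s: "0 \<le> s" "s < t"
    then show "distributed M lborel (\<lambda>\<omega>. B t \<omega> - B s \<omega>) (\<lambda>x. ennreal (normal_density 0 (sqrt (t - s)) x))"
      using wiener by (simp add: wiener_process_def)
    fix A C assume A: "A \<in> sets (natural_filtration M X0 B s)" and C: "C \<in> sets (borel :: real measure)"
    let ?D = "(\<lambda>\<omega>. B t \<omega> - B s \<omega>) -` C \<inter> space M"
    \<comment> \<open>A generator closed under intersection. Null sets form a second kind of member:
      meeting any event with a null set gives a null set, so closure is kept, and the product
      formula holds for them as 0 = 0.\<close>
    define G where "G = {A0 \<inter> A1 | A0 A1. A0 \<in> ?V \<and> A1 \<in> ?P s} \<union> null_sets M"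
    have incr: "indep_set (sets (vimage_algebra (space M) (\<lambda>\<omega>. B t \<omega> - B s \<omega>) borel)) (?P s)"
      using wiener s by (simp add: wiener_process_def)
    have Ddef: "?D \<in> sets (vimage_algebra (space M) (\<lambda>\<omega>. B t \<omega> - B s \<omega>) borel)"
      using C by (rule in_vimage_algebra)
    have Dev: "?D \<in> events" using indep_setD_ev1[OF incr] Ddef by blast
    have Dfull: "?D \<in> sets (process_sigma M {0..} B)"
    proof -
      have [measurable]: "B t \<in> borel_measurable (process_sigma M {0..} B)" "B s \<in> borel_measurable (process_sigma M {0..} B)"
        using s by (auto intro: process_sigma_measurable)
      have "(\<lambda>\<omega>. B t \<omega> - B s \<omega>) \<in> borel_measurable (process_sigma M {0..} B)" by measurable
      from measurable_sets[OF this C] show ?thesis by simp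
    qed
    have Psub: "?P s \<subseteq> sets (process_sigma M {0..} B)" by (intro process_sigma_mono) auto
    have Gev: "G \<subseteq> events" unfolding G_def using V P by (auto intro!: sets.Int)
    have prod: "prob (A' \<inter> ?D) = prob A' * prob ?D" if A': "A' \<in> G" for A'
    proof (cases "A' \<in> null_sets M")
      case True
      then have "A' \<inter> ?D \<in> null_sets M" using Dev by (rule null_set_Int2)
      with True show ?thesis by (simp add: measure_def null_setsD1)
    next
      case False
      then obtain A0 A1 where A01: "A' = A0 \<inter> A1" "A0 \<in> ?V" "A1 \<in> ?P s" using A' by (auto simp: G_def)
      have "prob (A' \<inter> ?D) = prob (A0 \<inter> (A1 \<inter> ?D))" by (simp add: A01 Int_assoc)
      also have "\<dots> = prob A0 * prob (A1 \<inter> ?D)"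
        using A01 Dfull Psub by (intro indep_setD[OF indep]) auto
      also have "prob (A1 \<inter> ?D) = prob ?D * prob A1"
        using indep_setD[OF incr Ddef A01(3)] by (simp add: Int_commute)
      also have "prob A0 * (prob ?D * prob A1) = (prob A0 * prob A1) * prob ?D" by simp
      also have "prob A0 * prob A1 = prob A'"
        unfolding A01(1) using A01 Psub by (intro indep_setD[OF indep, symmetric]) auto
      finally show ?thesis .
    qed
    have Gstable: "Int_stable G"
    proof (rule Int_stableI)
      fix A' A'' assume A': "A' \<in> G" "A'' \<in> G"
      show "A' \<inter> A'' \<in> G"
      proof (cases "A' \<in> null_sets M \<or> A'' \<in> null_sets M")
        case True
        then have "A' \<inter> A'' \<in> null_sets M" using A' Gev by (auto intro: null_set_Int1 null_set_Int2)
        then show ?thesis by (simp add: G_def)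
      next
        case False
        then obtain A0 A1 B0 B1 where *: "A' = A0 \<inter> A1" "A0 \<in> ?V" "A1 \<in> ?P s"
          "A'' = B0 \<inter> B1" "B0 \<in> ?V" "B1 \<in> ?P s" using A' by (auto simp: G_def)
        then have "A' \<inter> A'' = (A0 \<inter> B0) \<inter> (A1 \<inter> B1)" by auto
        moreover have "A0 \<inter> B0 \<in> ?V" "A1 \<inter> B1 \<in> ?P s" using * by auto
        ultimately show ?thesis unfolding G_def by blast
      qed
    qed
    have "indep_set (sigma_sets (space M) G) (sigma_sets (space M) {?D})"
    proof (rule indep_set_sigma_sets[OF _ Gstable])
      show "indep_set G {?D}" using Gev Dev prod by (intro indep_setI) auto
      show "Int_stable {?D}" by (auto simp: Int_stable_def)
    qed
    moreover have "A \<in> sigma_sets (space M) G"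
    proof -
      have "space M \<in> ?V" using sets.top[of "vimage_algebra (space M) X0 borel"] by simp
      have "space M \<in> ?P s" using sets.top[of "process_sigma M {0..s} B"] by simp
      have eq: "A' \<inter> space M = A'" "space M \<inter> A' = A'" if "A' \<in> events" for A'
        using sets.sets_into_space[OF that] by auto
      have GI: "A' \<inter> A'' \<in> G" if "A' \<in> ?V" "A'' \<in> ?P s" for A' A''
        unfolding G_def using that by blast
      have "?V \<subseteq> G"
      proof
        fix A' assume A': "A' \<in> ?V"
        have "A' \<inter> space M = A'" by (rule eq(1)[OF subsetD[OF V A']])
        with GI[OF A' \<open>space M \<in> ?P s\<close>] show "A' \<in> G" by simp
      qed
      moreover have "?P s \<subseteq> G"
      proof
        fix A' assume A': "A' \<in> ?P s"
        have "space M \<inter> A' = A'" by (rule eq(2)[OF subsetD[OF P A']])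
        with GI[OF \<open>space M \<in> ?V\<close> A'] show "A' \<in> G" by simp
      qed
      ultimately have "?V \<union> ?P s \<union> null_sets M \<subseteq> G" by (auto simp: G_def)
      from sigma_sets_mono'[OF this] show ?thesis using A unfolding sets_natural_filtration by (rule subsetD)
    qed
    moreover have "?D \<in> sigma_sets (space M) {?D}" by auto
    ultimately show "prob (A \<inter> ?D) = prob A * prob ?D" by (rule indep_setD)
  qed
qed

section \<open>Convergence in probability\<close>

context prob_space
begin

definition vanishes_in_probability :: "(nat \<Rightarrow> 'a \<Rightarrow> real) \<Rightarrow> bool" where
  "vanishes_in_probability f \<longleftrightarrow> (\<forall>\<epsilon>>0. (\<lambda>k. prob {\<omega> \<in> space M. \<epsilon> < \<bar>f k \<omega>\<bar>}) \<longlonglongrightarrow> 0)"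

lemma vanishes_in_probability_squeeze:
  assumes [measurable]: "\<And>k. f k \<in> borel_measurable M" "\<And>k. g k \<in> borel_measurable M" "\<And>k. h k \<in> borel_measurable M"
    and g: "vanishes_in_probability g" and h: "vanishes_in_probability h"
    and le: "AE \<omega> in M. \<forall>k. \<bar>f k \<omega>\<bar> \<le> \<bar>g k \<omega>\<bar> + \<bar>h k \<omega>\<bar>"
  shows "vanishes_in_probability f"
  unfolding vanishes_in_probability_def
proof (intro allI impI)
  fix \<epsilon> :: real assume \<epsilon>: "0 < \<epsilon>"
  have lim: "(\<lambda>k. prob {\<omega> \<in> space M. \<epsilon> / 2 < \<bar>g k \<omega>\<bar>} + prob {\<omega> \<in> space M. \<epsilon> / 2 < \<bar>h k \<omega>\<bar>}) \<longlonglongrightarrow> 0 + 0"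
    using g[unfolded vanishes_in_probability_def, rule_format, of "\<epsilon> / 2"]
      h[unfolded vanishes_in_probability_def, rule_format, of "\<epsilon> / 2"] \<epsilon>
    by (intro tendsto_add) simp_all
  have le': "prob {\<omega> \<in> space M. \<epsilon> < \<bar>f k \<omega>\<bar>} \<le>
      prob {\<omega> \<in> space M. \<epsilon> / 2 < \<bar>g k \<omega>\<bar>} + prob {\<omega> \<in> space M. \<epsilon> / 2 < \<bar>h k \<omega>\<bar>}" for k
  proof -
    have "prob {\<omega> \<in> space M. \<epsilon> < \<bar>f k \<omega>\<bar>} \<le> prob ({\<omega> \<in> space M. \<epsilon> / 2 < \<bar>g k \<omega>\<bar>} \<union> {\<omega> \<in> space M. \<epsilon> / 2 < \<bar>h k \<omega>\<bar>})"
      using le by (intro finite_measure_mono_AE) (auto elim!: eventually_mono dest!: spec[of _ k])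
    also have "\<dots> \<le> prob {\<omega> \<in> space M. \<epsilon> / 2 < \<bar>g k \<omega>\<bar>} + prob {\<omega> \<in> space M. \<epsilon> / 2 < \<bar>h k \<omega>\<bar>}"
      by (intro measure_Un_le) measurable
    finally show ?thesis .
  qed
  show "(\<lambda>k. prob {\<omega> \<in> space M. \<epsilon> < \<bar>f k \<omega>\<bar>}) \<longlonglongrightarrow> 0"
    by (rule tendsto_sandwich[OF always_eventually always_eventually tendsto_const lim[simplified]]) (use le' in auto)
qed

lemma vanishes_in_probability_AE:
  assumes [measurable]: "\<And>k. f k \<in> borel_measurable M"
    and lim: "AE \<omega> in M. (\<lambda>k. f k \<omega>) \<longlonglongrightarrow> 0"
  shows "vanishes_in_probability f"
  unfolding vanishes_in_probability_def
proof (intro allI impI)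
  fix \<epsilon> :: real assume \<epsilon>: "0 < \<epsilon>"
  define A where "A k = {\<omega> \<in> space M. \<epsilon> < \<bar>f k \<omega>\<bar>}" for k
  have [measurable]: "A k \<in> events" for k unfolding A_def by measurable
  have "(\<lambda>k. expectation (indicator (A k) :: 'a \<Rightarrow> real)) \<longlonglongrightarrow> expectation (\<lambda>\<omega>. 0)"
  proof (rule integral_dominated_convergence[where w = "\<lambda>_. 1"])
    show "AE \<omega> in M. (\<lambda>k. indicator (A k) \<omega> :: real) \<longlonglongrightarrow> 0"
      using lim
    proof eventually_elim
      case (elim \<omega>)
      have "\<forall>\<^sub>F k in sequentially. \<bar>f k \<omega>\<bar> < \<epsilon>"
        using tendsto_rabs[OF elim] \<epsilon> by (intro order_tendstoD(2)) auto
      then have "\<forall>\<^sub>F k in sequentially. (indicator (A k) \<omega> :: real) = 0"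
        by eventually_elim (auto simp: A_def indicator_def)
      then show ?case by (rule tendsto_eventually)
    qed
  qed (auto simp: indicator_def)
  then show "(\<lambda>k. prob {\<omega> \<in> space M. \<epsilon> < \<bar>f k \<omega>\<bar>}) \<longlonglongrightarrow> 0"
    by (simp add: A_def)
qed

text \<open>min 1 |f| is bounded, so convergence in probability makes it converge in mean, and a
  subsequence converges almost surely; once it is below 1, the truncation is invisible.\<close>

lemma vanishes_in_probability_AE_subseq:
  assumes [measurable]: "\<And>k. f k \<in> borel_measurable M" and f: "vanishes_in_probability f"
  shows "\<exists>r::nat \<Rightarrow> nat. strict_mono r \<and> (AE \<omega> in M. (\<lambda>k. f (r k) \<omega>) \<longlonglongrightarrow> 0)"
proof -
  define u where "u k \<omega> = min 1 \<bar>f k \<omega>\<bar>" for k \<omega>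
  have [measurable]: "u k \<in> borel_measurable M" for k unfolding u_def by measurable
  have int: "integrable M (u k)" for k
    by (rule integrable_const_bound[where B = 1]) (auto simp: u_def)
  have "(\<lambda>k. expectation (\<lambda>\<omega>. norm (u k \<omega>))) \<longlonglongrightarrow> 0"
  proof (rule LIMSEQ_I)
    fix e :: real assume e: "0 < e"
    have le: "expectation (\<lambda>\<omega>. norm (u k \<omega>)) \<le> e / 2 + prob {\<omega> \<in> space M. e / 2 < \<bar>f k \<omega>\<bar>}" for k
    proof -
      have "expectation (\<lambda>\<omega>. norm (u k \<omega>)) \<le> expectation (\<lambda>\<omega>. e / 2 + indicator {\<omega> \<in> space M. e / 2 < \<bar>f k \<omega>\<bar>} \<omega>)"
      proof (rule integral_mono)
        show "integrable M (\<lambda>\<omega>. norm (u k \<omega>))" by (intro integrable_norm int)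
        show "integrable M (\<lambda>\<omega>. e / 2 + (indicator {\<omega> \<in> space M. e / 2 < \<bar>f k \<omega>\<bar>} \<omega> :: real))"
          by (intro Bochner_Integration.integrable_add integrable_const integrable_real_indicator) (auto simp: less_top[symmetric])
        fix \<omega> assume "\<omega> \<in> space M"
        then show "norm (u k \<omega>) \<le> e / 2 + indicator {\<omega> \<in> space M. e / 2 < \<bar>f k \<omega>\<bar>} \<omega>"
          using e by (auto simp: u_def indicator_def)
      qed
      also have "\<dots> = e / 2 + prob {\<omega> \<in> space M. e / 2 < \<bar>f k \<omega>\<bar>}"
        by (subst Bochner_Integration.integral_add) (auto simp: prob_space less_top[symmetric])
      finally show ?thesis .
    qed
    have "(\<lambda>k. prob {\<omega> \<in> space M. e / 2 < \<bar>f k \<omega>\<bar>}) \<longlonglongrightarrow> 0"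
      using f[unfolded vanishes_in_probability_def, rule_format, of "e / 2"] e by simp
    then have "\<forall>\<^sub>F k in sequentially. prob {\<omega> \<in> space M. e / 2 < \<bar>f k \<omega>\<bar>} < e / 2"
      using e by (intro order_tendstoD(2)) auto
    then obtain k0 where k0: "\<And>k. k0 \<le> k \<Longrightarrow> prob {\<omega> \<in> space M. e / 2 < \<bar>f k \<omega>\<bar>} < e / 2"
      by (auto simp: eventually_sequentially)
    show "\<exists>no. \<forall>k\<ge>no. norm (expectation (\<lambda>\<omega>. norm (u k \<omega>)) - 0) < e"
    proof (intro exI allI impI)
      fix k assume "k0 \<le> k"
      have "0 \<le> expectation (\<lambda>\<omega>. norm (u k \<omega>))" by simp
      then show "norm (expectation (\<lambda>\<omega>. norm (u k \<omega>)) - 0) < e"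
        using le[of k] k0[OF \<open>k0 \<le> k\<close>] by simp
    qed
  qed
  from tendsto_L1_AE_subseq[OF int this] obtain r where r: "strict_mono r" "AE \<omega> in M. (\<lambda>k. u (r k) \<omega>) \<longlonglongrightarrow> 0"
    by blast
  have "AE \<omega> in M. (\<lambda>k. f (r k) \<omega>) \<longlonglongrightarrow> 0"
    using r(2)
  proof eventually_elim
    case (elim \<omega>)
    have "\<forall>\<^sub>F k in sequentially. u (r k) \<omega> < 1" using elim by (intro order_tendstoD(2)) auto
    then have "\<forall>\<^sub>F k in sequentially. u (r k) \<omega> = \<bar>f (r k) \<omega>\<bar>"
      by eventually_elim (auto simp: u_def)
    with elim have "(\<lambda>k. \<bar>f (r k) \<omega>\<bar>) \<longlonglongrightarrow> 0" by (simp add: filterlim_cong[OF refl refl])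
    then show ?case by (simp add: tendsto_rabs_zero_iff)
  qed
  with r(1) show ?thesis by blast
qed

end

context wiener_filtration
begin

text \<open>Setting the integrand to zero as soon as its running square integral exceeds \<open>\<delta>\<close>
  gives a square integrable step integrand.\<close>

lemma step_integral_prob_bound:
  fixes G :: "nat \<Rightarrow> 'a \<Rightarrow> real"
  assumes s: "0 \<le> s" and part: "time_partition s t m p"
    and G: "\<And>i. i < m \<Longrightarrow> G i \<in> borel_measurable (F (p i))" and \<delta>: "0 < \<delta>" and \<epsilon>: "0 < \<epsilon>"
  shows "prob {\<omega> \<in> space M. \<epsilon> < \<bar>\<Sum>i<m. G i \<omega> * (B (p (Suc i)) \<omega> - B (p i) \<omega>)\<bar>} \<le>
    prob {\<omega> \<in> space M. \<delta> < (\<Sum>i<m. (G i \<omega>)\<^sup>2 * (p (Suc i) - p i))} + \<delta> / \<epsilon>\<^sup>2"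
proof -
  define dp where "dp i = p (Suc i) - p i" for i
  \<comment> \<open>The running sum includes the index i itself, whose term is already known at time
    p i. So the integrand is switched off before the sum passes \<delta>, and the bound \<delta>
    holds without overshoot.\<close>
  define a where "a i \<omega> = (\<Sum>j<Suc i. (G j \<omega>)\<^sup>2 * dp j)" for i \<omega>
  define K where "K i \<omega> = (if a i \<omega> \<le> \<delta> then G i \<omega> else 0)" for i \<omega>
  define I where "I \<omega> = (\<Sum>i<m. K i \<omega> * (B (p (Suc i)) \<omega> - B (p i) \<omega>))" for \<omega>
  have dp: "0 < dp i" if "i < m" for i using part that by (auto simp: time_partition_def dp_def)
  have p0: "0 \<le> p i" if "i \<le> m" for i
    using time_partition_mono[OF part, of 0 i] that s part by (auto simp: time_partition_def)
  have [measurable]: "G i \<in> borel_measurable M" "B (p i) \<in> borel_measurable M" "B (p (Suc i)) \<in> borel_measurable M" if "i < m" for i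
    using that p0[of i] p0[of "Suc i"] adapted_measurable[OF _ G] by auto
  have K_adapted: "K i \<in> borel_measurable (F (p i))" if i: "i < m" for i
  proof -
    have [measurable]: "G j \<in> borel_measurable (F (p i))" if "j < Suc i" for j
      using time_partition_mono[OF part, of j i] that i p0[of j] by (intro adapted_mono[OF _ _ G]) auto
    show ?thesis unfolding K_def[abs_def] a_def by measurable
  qed
  have total: "(\<Sum>i<n. (K i \<omega>)\<^sup>2 * dp i) \<le> \<delta> \<and> (\<Sum>i<n. (K i \<omega>)\<^sup>2 * dp i) \<le> (\<Sum>i<n. (G i \<omega>)\<^sup>2 * dp i)" if "n \<le> m" for n \<omega>
    using that
  proof (induction n)
    case (Suc n)
    then have "0 \<le> (G n \<omega>)\<^sup>2 * dp n" using dp[of n] by simp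
    with Suc show ?case
      by (cases "a n \<omega> \<le> \<delta>") (auto simp: K_def a_def)
  qed (use \<delta> in simp)
  have K_L2: "K i \<in> L2 M" if i: "i < m" for i
  proof (rule L2_bound[where g = "\<lambda>_. \<delta> / dp i"])
    show "K i \<in> borel_measurable M" using K_adapted[OF i] p0[of i] i by (auto intro: adapted_measurable)
    fix \<omega>
    have "(K i \<omega>)\<^sup>2 * dp i \<le> (\<Sum>i<m. (K i \<omega>)\<^sup>2 * dp i)"
      using i dp by (intro member_le_sum) (auto simp: less_imp_le)
    also have "\<dots> \<le> \<delta>" using total[of m] by simp
    finally show "(K i \<omega>)\<^sup>2 \<le> \<delta> / dp i" using dp[OF i] by (simp add: field_simps)
  qed simp
  have mt: "I \<in> L2 M" "second_moment I = (\<Sum>i<m. dp i * second_moment (K i))"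
    using martingale_transform[of p m K] p0[of 0] part K_adapted K_L2 unfolding I_def[abs_def] dp_def time_partition_def by auto
  have "(\<Sum>i<m. dp i * second_moment (K i)) = expectation (\<lambda>\<omega>. \<Sum>i<m. (K i \<omega>)\<^sup>2 * dp i)"
    using K_L2 by (subst Bochner_Integration.integral_sum) (auto simp: mult.commute dest: L2_integrable_power2)
  also have "\<dots> \<le> expectation (\<lambda>\<omega>. \<delta>)"
    using K_L2 total[of m]
    by (intro integral_mono Bochner_Integration.integrable_sum integrable_mult_left L2_integrable_power2) auto
  finally have I2: "second_moment I \<le> \<delta>" using mt(2) by (simp add: prob_space)
  have [measurable]: "I \<in> borel_measurable M" using mt(1) by (rule L2_measurable)
  have "prob {\<omega> \<in> space M. \<epsilon> < \<bar>\<Sum>i<m. G i \<omega> * (B (p (Suc i)) \<omega> - B (p i) \<omega>)\<bar>}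
    \<le> prob ({\<omega> \<in> space M. \<delta> < (\<Sum>i<m. (G i \<omega>)\<^sup>2 * dp i)} \<union> {\<omega> \<in> space M. \<epsilon>\<^sup>2 \<le> (I \<omega>)\<^sup>2})"
  proof (rule finite_measure_mono)
    show "{\<omega> \<in> space M. \<epsilon> < \<bar>\<Sum>i<m. G i \<omega> * (B (p (Suc i)) \<omega> - B (p i) \<omega>)\<bar>}
      \<subseteq> {\<omega> \<in> space M. \<delta> < (\<Sum>i<m. (G i \<omega>)\<^sup>2 * dp i)} \<union> {\<omega> \<in> space M. \<epsilon>\<^sup>2 \<le> (I \<omega>)\<^sup>2}"
    proof safe
      fix \<omega> assume \<omega>: "\<omega> \<in> space M" "\<epsilon> < \<bar>\<Sum>i<m. G i \<omega> * (B (p (Suc i)) \<omega> - B (p i) \<omega>)\<bar>"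
        "\<not> \<epsilon>\<^sup>2 \<le> (I \<omega>)\<^sup>2"
      show "\<delta> < (\<Sum>i<m. (G i \<omega>)\<^sup>2 * dp i)"
      proof (rule ccontr)
        assume small: "\<not> \<delta> < (\<Sum>i<m. (G i \<omega>)\<^sup>2 * dp i)"
        have "a i \<omega> \<le> \<delta>" if "i < m" for i
        proof -
          have "a i \<omega> \<le> (\<Sum>i<m. (G i \<omega>)\<^sup>2 * dp i)" unfolding a_def
            using that dp by (intro sum_mono2) (auto simp: less_imp_le)
          with small show ?thesis by simp
        qed
        then have "I \<omega> = (\<Sum>i<m. G i \<omega> * (B (p (Suc i)) \<omega> - B (p i) \<omega>))"
          unfolding I_def K_def by (intro sum.cong) auto
        then have "\<epsilon>\<^sup>2 \<le> \<bar>I \<omega>\<bar>\<^sup>2" using \<omega>(2) \<epsilon> by (intro power_mono) auto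
        with \<omega>(3) show False by simp
      qed
    qed
  qed measurable
  also have "\<dots> \<le> prob {\<omega> \<in> space M. \<delta> < (\<Sum>i<m. (G i \<omega>)\<^sup>2 * dp i)} + prob {\<omega> \<in> space M. \<epsilon>\<^sup>2 \<le> (I \<omega>)\<^sup>2}"
    by (intro measure_Un_le) measurable
  also have "prob {\<omega> \<in> space M. \<epsilon>\<^sup>2 \<le> (I \<omega>)\<^sup>2} \<le> second_moment I / \<epsilon>\<^sup>2"
    using L2_integrable_power2[OF mt(1)] \<epsilon> by (intro integral_Markov_inequality_measure[of _ _ "{}"]) auto
  also have "\<dots> \<le> \<delta> / \<epsilon>\<^sup>2" using I2 \<epsilon> by (intro divide_right_mono) auto
  finally show ?thesis by (simp add: dp_def)
qed

lemma step_integral_vanishes: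
  fixes G :: "nat \<Rightarrow> nat \<Rightarrow> 'a \<Rightarrow> real"
  assumes s: "0 \<le> s" and part: "\<And>k. time_partition s t (m k) (p k)"
    and G: "\<And>k i. i < m k \<Longrightarrow> G k i \<in> borel_measurable (F (p k i))"
    and sq: "vanishes_in_probability (\<lambda>k \<omega>. \<Sum>i<m k. (G k i \<omega>)\<^sup>2 * (p k (Suc i) - p k i))"
  shows "vanishes_in_probability (\<lambda>k \<omega>. \<Sum>i<m k. G k i \<omega> * (B (p k (Suc i)) \<omega> - B (p k i) \<omega>))"
  unfolding vanishes_in_probability_def
proof (intro allI impI LIMSEQ_I)
  fix \<epsilon> e :: real assume \<epsilon>: "0 < \<epsilon>" and e: "0 < e"
  \<comment> \<open>Makes the Chebyshev term \<delta> / \<epsilon>^2 of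
    \<open>step_integral_prob_bound\<close> equal to e / 2.\<close>
  define \<delta> where "\<delta> = e / 2 * \<epsilon>\<^sup>2"
  have \<delta>: "0 < \<delta>" using \<epsilon> e by (simp add: \<delta>_def)
  have "(\<lambda>k. prob {\<omega> \<in> space M. \<delta> < \<bar>\<Sum>i<m k. (G k i \<omega>)\<^sup>2 * (p k (Suc i) - p k i)\<bar>}) \<longlonglongrightarrow> 0"
    using sq \<delta> by (simp add: vanishes_in_probability_def)
  then have "\<forall>\<^sub>F k in sequentially. prob {\<omega> \<in> space M. \<delta> < \<bar>\<Sum>i<m k. (G k i \<omega>)\<^sup>2 * (p k (Suc i) - p k i)\<bar>} < e / 2"
    using e by (intro order_tendstoD(2)) auto
  then obtain k0 where k0: "\<And>k. k0 \<le> k \<Longrightarrow> prob {\<omega> \<in> space M. \<delta> < \<bar>\<Sum>i<m k. (G k i \<omega>)\<^sup>2 * (p k (Suc i) - p k i)\<bar>} < e / 2"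
    by (auto simp: eventually_sequentially)
  show "\<exists>no. \<forall>k\<ge>no. norm (prob {\<omega> \<in> space M. \<epsilon> < \<bar>\<Sum>i<m k. G k i \<omega> * (B (p k (Suc i)) \<omega> - B (p k i) \<omega>)\<bar>} - 0) < e"
  proof (intro exI allI impI)
    fix k assume k: "k0 \<le> k"
    have "0 \<le> (\<Sum>i<m k. (G k i \<omega>)\<^sup>2 * (p k (Suc i) - p k i))" for \<omega>
      using part[of k] by (intro sum_nonneg mult_nonneg_nonneg) (auto simp: time_partition_def less_imp_le)
    then have "prob {\<omega> \<in> space M. \<delta> < (\<Sum>i<m k. (G k i \<omega>)\<^sup>2 * (p k (Suc i) - p k i))} < e / 2"
      using k0[OF k] by simp
    moreover have "\<delta> / \<epsilon>\<^sup>2 = e / 2" using \<epsilon> by (simp add: \<delta>_def)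
    ultimately show "norm (prob {\<omega> \<in> space M. \<epsilon> < \<bar>\<Sum>i<m k. G k i \<omega> * (B (p k (Suc i)) \<omega> - B (p k i) \<omega>)\<bar>} - 0) < e"
      using step_integral_prob_bound[OF s part[of k] G \<delta> \<epsilon>] by fastforce
  qed
qed

end

section \<open>Riemann sums for the Ito integral\<close>

text \<open>Truncation by t moves a jump time beyond t to the last index, which no block exceeds. So
  whether x lies between two jump times depends only on the index of its block; this works because
  both kinds of interval are open on the left and closed on the right.\<close>

lemma time_partition_index:
  assumes part: "time_partition 0 t m p" and \<alpha>: "\<alpha> \<le> m" "min c t = p \<alpha>" and j: "j < m" and x: "x \<in> {p j<..p (Suc j)}"
  shows "c < x \<longleftrightarrow> \<alpha> \<le> j" and "x \<le> c \<longleftrightarrow> j < \<alpha>"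
proof -
  have xt: "x \<le> t" using time_partition_mono[OF part, of "Suc j" m] j x part by (auto simp: time_partition_def)
  show lt: "c < x \<longleftrightarrow> \<alpha> \<le> j"
  proof
    assume "c < x"
    then have "p \<alpha> < p (Suc j)" using xt \<alpha>(2) x by auto
    show "\<alpha> \<le> j"
    proof (rule ccontr)
      assume "\<not> \<alpha> \<le> j"
      then have "p (Suc j) \<le> p \<alpha>" using \<alpha>(1) by (intro time_partition_mono[OF part]) auto
      with \<open>p \<alpha> < p (Suc j)\<close> show False by simp
    qed
  next
    assume "\<alpha> \<le> j"
    then have "p \<alpha> \<le> p j" using time_partition_mono[OF part, of \<alpha> j] j by simp
    then have "min c t < x" using x \<alpha>(2) by simp
    then show "c < x" using xt by linarith
  qed
  from lt show "x \<le> c \<longleftrightarrow> j < \<alpha>" by linarith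
qed

lemma time_partition_block_unique:
  assumes part: "time_partition s t m p" and "i < m" "j < m" "x \<in> {p i<..p (Suc i)}" "x \<in> {p j<..p (Suc j)}"
  shows "i = j"
proof (rule ccontr)
  assume "i \<noteq> j"
  then consider "Suc i \<le> j" | "Suc j \<le> i" by linarith
  then show False
    using time_partition_mono[OF part, of "Suc i" j] time_partition_mono[OF part, of "Suc j" i] assms(2-) by cases auto
qed

lemma time_partition_of_finite_set:
  assumes P: "finite P" "P \<subseteq> {s..t}" "s \<in> P" "t \<in> P"
  shows "\<exists>m p. time_partition s t m p \<and> p ` {..m} = P"
proof -
  define xs where "xs = sorted_list_of_set P"
  have xs: "set xs = P" "sorted_wrt (<) xs" using P(1) by (auto simp: xs_def)
  then have len: "length xs > 0" using P(3) by auto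
  define m where "m = length xs - 1"
  have nth: "xs ! i < xs ! j" if "i < j" "j \<le> m" for i j
    using sorted_wrt_nth_less[OF xs(2), of i j] that len by (simp add: m_def)
  have img: "(!) xs ` {..m} = P"
  proof -
    have "length xs = Suc m" using len by (simp add: m_def)
    then have "{..m} = {0..<length xs}" by auto
    then show ?thesis using nth_image[of "length xs" xs] xs(1) by simp
  qed
  have first: "xs ! 0 = s"
  proof -
    obtain i where i: "i \<le> m" "s = xs ! i" using img P(3) by force
    have "xs ! 0 \<in> P" using img by auto
    then have "s \<le> xs ! 0" using P(2) by auto
    then show ?thesis using i nth[of 0 i] by (cases "i = 0") auto
  qed
  have last: "xs ! m = t"
  proof -
    obtain i where i: "i \<le> m" "t = xs ! i" using img P(4) by force
    have "xs ! m \<in> P" using img by auto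
    then have "xs ! m \<le> t" using P(2) by auto
    then show ?thesis using i nth[of i m] by (cases "i = m") auto
  qed
  have "time_partition s t m ((!) xs)" using first last nth by (auto simp: time_partition_def)
  with img show ?thesis by blast
qed

text \<open>The first point of the uniform grid after p i is a partition point, hence not before p
  (Suc i), and it is at most one grid length away.\<close>

lemma time_partition_mesh:
  assumes part: "time_partition 0 t m p" and t: "0 < t"
    and grid: "\<And>j. j \<le> Suc k \<Longrightarrow> real j * (t / real (Suc k)) \<in> p ` {..m}" and i: "i < m"
  shows "p (Suc i) - p i \<le> t / real (Suc k)"
proof -
  define h where "h = t / real (Suc k)"
  have h: "0 < h" "real (Suc k) * h = t" using t by (auto simp: h_def)
  have pi: "0 \<le> p i" "p i < p (Suc i)" "p (Suc i) \<le> t"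
    using time_partition_mono[OF part, of 0 i] time_partition_mono[OF part, of "Suc i" m] part i by (auto simp: time_partition_def)
  define j where "j = nat \<lfloor>p i / h\<rfloor>"
  have j: "real j * h \<le> p i" "p i < real (Suc j) * h"
  proof -
    have "real j = of_int \<lfloor>p i / h\<rfloor>" using pi h by (simp add: j_def)
    then have "real j \<le> p i / h" "p i / h < real j + 1" by linarith+
    then show "real j * h \<le> p i" "p i < real (Suc j) * h" using h by (auto simp: field_simps)
  qed
  have "real j * h < real (Suc k) * h" using j(1) pi h(2) by linarith
  then have "j < Suc k" using h(1) by simp
  then have "real (Suc j) * h \<in> p ` {..m}" unfolding h_def by (intro grid) simp
  then obtain l where l: "l \<le> m" "real (Suc j) * h = p l" by auto
  have "Suc i \<le> l"
  proof (rule ccontr)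
    assume "\<not> Suc i \<le> l"
    then have "p l \<le> p i" using time_partition_mono[OF part, of l i] i by simp
    with j(2) l(2) show False by simp
  qed
  then have "p (Suc i) \<le> real (Suc j) * h" using time_partition_mono[OF part, of "Suc i" l] l by simp
  moreover have "real (Suc j) * h = real j * h + h" by (simp add: algebra_simps)
  ultimately show ?thesis using j(1) unfolding h_def[symmetric] by linarith
qed

lemma riemann_sum_error:
  fixes f :: "real \<Rightarrow> real"
  assumes part: "time_partition s t m p" and f: "continuous_on {s..t} f"
    and e: "\<And>i u. i < m \<Longrightarrow> u \<in> {p i..p (Suc i)} \<Longrightarrow> \<bar>f u - f (p i)\<bar> \<le> e"
  shows "\<bar>(\<Sum>i<m. f (p i) * (p (Suc i) - p i)) - integral {s..t} f\<bar> \<le> e * (t - s)"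
proof -
  have range: "s \<le> p i" "p i \<le> t" if "i \<le> m" for i
    using time_partition_mono[OF part, of 0 i] time_partition_mono[OF part, of i m] part that by (auto simp: time_partition_def)
  have "\<bar>(\<Sum>i<n. f (p i) * (p (Suc i) - p i)) - integral {s..p n} f\<bar> \<le> e * (p n - s)" if "n \<le> m" for n
    using that
  proof (induction n)
    case 0
    then show ?case using part by (simp add: time_partition_def)
  next
    case (Suc n)
    have lt: "p n < p (Suc n)" using part Suc.prems by (simp add: time_partition_def)
    have cont: "continuous_on {x..y} f" if "s \<le> x" "y \<le> t" for x y
      using that by (intro continuous_on_subset[OF f]) auto
    have int: "f integrable_on {s..p (Suc n)}" "f integrable_on {p n..p (Suc n)}"
      using range[of n] range[of "Suc n"] Suc.prems by (auto intro!: integrable_continuous_real cont)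
    have comb: "integral {s..p (Suc n)} f = integral {s..p n} f + integral {p n..p (Suc n)} f"
      using int range[of n] lt Suc.prems by (intro Henstock_Kurzweil_Integration.integral_combine[symmetric]) auto
    have "integral {p n..p (Suc n)} f - f (p n) * (p (Suc n) - p n) = integral {p n..p (Suc n)} (\<lambda>u. f u - f (p n))"
      using int(2) lt by (subst integral_diff) (auto simp: mult.commute)
    moreover have "norm (integral {p n..p (Suc n)} (\<lambda>u. f u - f (p n))) \<le> e * (p (Suc n) - p n)"
      using lt range[of n] range[of "Suc n"] Suc.prems e[of n]
      by (intro integral_bound continuous_on_diff cont) (auto intro: continuous_on_const)
    ultimately have "\<bar>integral {p n..p (Suc n)} f - f (p n) * (p (Suc n) - p n)\<bar> \<le> e * (p (Suc n) - p n)" by simp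
    moreover have "\<bar>(\<Sum>i<n. f (p i) * (p (Suc i) - p i)) - integral {s..p n} f\<bar> \<le> e * (p n - s)"
      using Suc by simp
    moreover have "(\<Sum>i<Suc n. f (p i) * (p (Suc i) - p i)) - integral {s..p (Suc n)} f =
        ((\<Sum>i<n. f (p i) * (p (Suc i) - p i)) - integral {s..p n} f) -
        (integral {p n..p (Suc n)} f - f (p n) * (p (Suc n) - p n))"
      unfolding comb by simp
    moreover have "e * (p (Suc n) - s) = e * (p n - s) + e * (p (Suc n) - p n)"
      by (simp add: algebra_simps)
    ultimately show ?case by linarith
  qed
  from this[of m] part show ?thesis by (simp add: time_partition_def)
qed

text \<open>The right end point represents the block because the intervals in
  \<open>simple_process\<close> are open on the left. The value is nevertheless known at the left
  end point, as \<open>simple_process_adapted\<close> shows.\<close>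

lemma simple_process_on_block:
  assumes part: "time_partition 0 t m p" and \<tau>: "\<And>i. i \<le> n \<Longrightarrow> min (\<tau> i) t \<in> p ` {..m}"
    and j: "j < m" and u: "u \<in> {p j<..p (Suc j)}"
  shows "simple_process n \<tau> \<xi> u \<omega> = simple_process n \<tau> \<xi> (p (Suc j)) \<omega>"
  unfolding simple_process_def
proof (intro sum.cong refl arg_cong2[where f = "(*)"])
  fix i assume i: "i \<in> {..<n}"
  obtain \<alpha> \<beta> where \<alpha>: "\<alpha> \<le> m" "min (\<tau> i) t = p \<alpha>" and \<beta>: "\<beta> \<le> m" "min (\<tau> (Suc i)) t = p \<beta>"
    using \<tau>[of i] \<tau>[of "Suc i"] i by auto
  have last: "p (Suc j) \<in> {p j<..p (Suc j)}" using part j by (auto simp: time_partition_def)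
  show "(indicator {\<tau> i<..\<tau> (Suc i)} u :: real) = indicator {\<tau> i<..\<tau> (Suc i)} (p (Suc j))"
    by (simp add: indicator_def time_partition_index[OF part \<alpha> j u] time_partition_index[OF part \<beta> j u]
      time_partition_index[OF part \<alpha> j last] time_partition_index[OF part \<beta> j last])
qed

text \<open>Each interval between jump times, cut at t, is a union of consecutive blocks, over which
  the increments of B telescope; the two sums are then exchanged.\<close>

lemma simple_ito_integral_on_partition:
  assumes part: "time_partition 0 t m p" and \<tau>: "\<And>i. i \<le> n \<Longrightarrow> min (\<tau> i) t \<in> p ` {..m}"
    and mono: "\<And>i. i < n \<Longrightarrow> \<tau> i \<le> \<tau> (Suc i)"
  shows "simple_ito_integral B n \<tau> \<xi> t \<omega> =
    (\<Sum>j<m. simple_process n \<tau> \<xi> (p (Suc j)) \<omega> * (B (p (Suc j)) \<omega> - B (p j) \<omega>))"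
proof -
  have telescoped: "B (min (\<tau> (Suc i)) t) \<omega> - B (min (\<tau> i) t) \<omega> =
    (\<Sum>j<m. indicator {\<tau> i<..\<tau> (Suc i)} (p (Suc j)) * (B (p (Suc j)) \<omega> - B (p j) \<omega>))" if i: "i < n" for i
  proof -
    obtain \<alpha> \<beta> where \<alpha>: "\<alpha> \<le> m" "min (\<tau> i) t = p \<alpha>" and \<beta>: "\<beta> \<le> m" "min (\<tau> (Suc i)) t = p \<beta>"
      using \<tau>[of i] \<tau>[of "Suc i"] i by auto
    have strict: "p x < p y" if "x < y" "y \<le> m" for x y
    proof -
      have "p x < p (Suc x)" using part that by (auto simp: time_partition_def)
      also have "\<dots> \<le> p y" using that by (intro time_partition_mono[OF part]) auto
      finally show ?thesis .
    qed
    have "p \<alpha> \<le> p \<beta>" unfolding \<alpha>(2)[symmetric] \<beta>(2)[symmetric] using mono[OF i] by auto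
    then have \<alpha>\<beta>: "\<alpha> \<le> \<beta>" using strict[of \<beta> \<alpha>] \<alpha> by force
    have ind: "(indicator {\<tau> i<..\<tau> (Suc i)} (p (Suc j)) :: real) = (if j \<in> {\<alpha>..<\<beta>} then 1 else 0)" if j: "j < m" for j
    proof -
      have last: "p (Suc j) \<in> {p j<..p (Suc j)}" using part j by (auto simp: time_partition_def)
      show ?thesis
        by (simp add: indicator_def time_partition_index[OF part \<alpha> j last] time_partition_index[OF part \<beta> j last])
    qed
    have "(\<Sum>j<m. indicator {\<tau> i<..\<tau> (Suc i)} (p (Suc j)) * (B (p (Suc j)) \<omega> - B (p j) \<omega>)) =
      (\<Sum>j<m. if j \<in> {\<alpha>..<\<beta>} then B (p (Suc j)) \<omega> - B (p j) \<omega> else 0)"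
      by (intro sum.cong) (auto simp: ind)
    also have "\<dots> = (\<Sum>j\<in>{..<m} \<inter> {\<alpha>..<\<beta>}. B (p (Suc j)) \<omega> - B (p j) \<omega>)"
      by (simp add: sum.inter_restrict)
    also have "{..<m} \<inter> {\<alpha>..<\<beta>} = {\<alpha>..<\<beta>}" using \<beta>(1) by auto
    also have "(\<Sum>j\<in>{\<alpha>..<\<beta>}. B (p (Suc j)) \<omega> - B (p j) \<omega>) = B (p \<beta>) \<omega> - B (p \<alpha>) \<omega>"
      using sum_Suc_diff'[OF \<alpha>\<beta>, of "\<lambda>j. B (p j) \<omega>"] by simp
    finally show ?thesis by (simp add: \<alpha> \<beta>)
  qed
  have "simple_ito_integral B n \<tau> \<xi> t \<omega> =
      (\<Sum>i<n. \<Sum>j<m. \<xi> i \<omega> * indicator {\<tau> i<..\<tau> (Suc i)} (p (Suc j)) * (B (p (Suc j)) \<omega> - B (p j) \<omega>))"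
    unfolding simple_ito_integral_def
  proof (intro sum.cong refl)
    fix i assume "i \<in> {..<n}"
    then have i: "i < n" by simp
    show "\<xi> i \<omega> * (B (min (\<tau> (Suc i)) t) \<omega> - B (min (\<tau> i) t) \<omega>) =
      (\<Sum>j<m. \<xi> i \<omega> * indicator {\<tau> i<..\<tau> (Suc i)} (p (Suc j)) * (B (p (Suc j)) \<omega> - B (p j) \<omega>))"
      unfolding telescoped[OF i] sum_distrib_left by (simp only: mult.assoc)
  qed
  also have "\<dots> = (\<Sum>j<m. \<Sum>i<n. \<xi> i \<omega> * indicator {\<tau> i<..\<tau> (Suc i)} (p (Suc j)) * (B (p (Suc j)) \<omega> - B (p j) \<omega>))"
    by (rule sum.swap)
  finally show ?thesis unfolding simple_process_def sum_distrib_right .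
qed

text \<open>In the step sum H stands at the left end of each block, in the integral at the running
  time; replacing one by the other costs a factor 2 and the oscillation w. Closeness in L2[0, t] is
  thereby transferred to the quadratic sums that control step integrals.\<close>

lemma step_square_integral_le:
  fixes S H :: "real \<Rightarrow> real"
  assumes part: "time_partition 0 t m p" and H: "continuous_on {0..t} H"
    and S_block: "\<And>j u. j < m \<Longrightarrow> u \<in> {p j<..p (Suc j)} \<Longrightarrow> S u = S (p (Suc j))"
    and S [measurable]: "S \<in> borel_measurable borel" and S_bound: "\<And>u. \<bar>S u\<bar> \<le> K"
    and w: "\<And>j u. j < m \<Longrightarrow> u \<in> {p j..p (Suc j)} \<Longrightarrow> \<bar>H u - H (p j)\<bar> \<le> w"
  shows "(\<Sum>j<m. (S (p (Suc j)) - H (p j))\<^sup>2 * (p (Suc j) - p j)) \<le>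
    2 * enn2real (\<integral>\<^sup>+u\<in>{0..t}. ennreal ((S u - H u)\<^sup>2) \<partial>lborel) + 2 * w\<^sup>2 * t"
proof -
  have t: "0 \<le> t" using time_partition_mono[OF part, of 0 m] part by (simp add: time_partition_def)
  have pos: "p j < p (Suc j)" if "j < m" for j using part that by (simp add: time_partition_def)
  have range: "0 \<le> p j" "p j \<le> t" if "j \<le> m" for j
    using time_partition_mono[OF part, of 0 j] time_partition_mono[OF part, of j m] part that by (auto simp: time_partition_def)
  have "bounded (H ` {0..t})" by (intro compact_imp_bounded compact_continuous_image H) auto
  then obtain c where "\<forall>x\<in>H ` {0..t}. norm x \<le> c" unfolding bounded_iff by (elim exE)
  then have c: "\<bar>H u\<bar> \<le> c" if "u \<in> {0..t}" for u using that by auto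
  define J where "J = (\<integral>\<^sup>+u\<in>{0..t}. ennreal ((S u - H u)\<^sup>2) \<partial>lborel)"
  have Hm [measurable]: "(\<lambda>u. indicator {0..t} u * H u) \<in> borel_measurable borel"
    using borel_measurable_continuous_on_indicator[OF _ H] by simp
  have eqJ: "ennreal ((S u - H u)\<^sup>2) * indicator {0..t} u = ennreal ((S u - indicator {0..t} u * H u)\<^sup>2) * indicator {0..t} u" for u
    by (auto simp: indicator_def)
  \<comment> \<open>\<open>enn2real\<close> sends an infinite integral to 0, which would make the
    bound useless; so finiteness comes first. It holds because S is bounded and H is continuous on a
    compact interval.\<close>
  have "J \<le> (\<integral>\<^sup>+u. ennreal ((K + c)\<^sup>2) * indicator {0..t} u \<partial>lborel)"
    unfolding J_def
  proof (intro nn_integral_mono)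
    fix u
    show "ennreal ((S u - H u)\<^sup>2) * indicator {0..t} u \<le> ennreal ((K + c)\<^sup>2) * indicator {0..t} u"
    proof (cases "u \<in> {0..t}")
      case True
      have "\<bar>S u - H u\<bar> \<le> K + c" using S_bound[of u] c[OF True] by linarith
      then have "\<bar>S u - H u\<bar>\<^sup>2 \<le> (K + c)\<^sup>2" by (intro power_mono) auto
      then show ?thesis using True by (simp add: ennreal_leI)
    qed simp
  qed
  also have "\<dots> = ennreal ((K + c)\<^sup>2) * ennreal t" using t by (subst nn_integral_cmult_indicator) auto
  also have "\<dots> < \<top>" by (simp add: ennreal_mult_less_top)
  finally have Jfin: "J < \<top>" .
  have "ennreal (\<Sum>j<m. (S (p (Suc j)) - H (p j))\<^sup>2 * (p (Suc j) - p j)) =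
      (\<Sum>j<m. \<integral>\<^sup>+u. ennreal ((S (p (Suc j)) - H (p j))\<^sup>2) * indicator {p j<..p (Suc j)} u \<partial>lborel)"
  proof -
    have "ennreal (\<Sum>j<m. (S (p (Suc j)) - H (p j))\<^sup>2 * (p (Suc j) - p j)) =
        (\<Sum>j<m. ennreal ((S (p (Suc j)) - H (p j))\<^sup>2 * (p (Suc j) - p j)))"
      using pos by (intro sum_ennreal[symmetric]) (auto simp: less_imp_le)
    also have "\<dots> = (\<Sum>j<m. \<integral>\<^sup>+u. ennreal ((S (p (Suc j)) - H (p j))\<^sup>2) * indicator {p j<..p (Suc j)} u \<partial>lborel)"
    proof (intro sum.cong refl)
      fix j assume "j \<in> {..<m}"
      then have "p j \<le> p (Suc j)" using pos[of j] by simp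
      then show "ennreal ((S (p (Suc j)) - H (p j))\<^sup>2 * (p (Suc j) - p j)) =
          (\<integral>\<^sup>+u. ennreal ((S (p (Suc j)) - H (p j))\<^sup>2) * indicator {p j<..p (Suc j)} u \<partial>lborel)"
        by (subst nn_integral_cmult_indicator) (simp_all add: ennreal_mult)
    qed
    finally show ?thesis .
  qed
  also have "\<dots> = (\<integral>\<^sup>+u. (\<Sum>j<m. ennreal ((S (p (Suc j)) - H (p j))\<^sup>2) * indicator {p j<..p (Suc j)} u) \<partial>lborel)"
    by (subst nn_integral_sum) auto
  also have "\<dots> \<le> (\<integral>\<^sup>+u. 2 * (ennreal ((S u - H u)\<^sup>2) * indicator {0..t} u) + ennreal (2 * w\<^sup>2) * indicator {0..t} u \<partial>lborel)"
  proof (intro nn_integral_mono)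
    fix u
    show "(\<Sum>j<m. ennreal ((S (p (Suc j)) - H (p j))\<^sup>2) * indicator {p j<..p (Suc j)} u)
        \<le> 2 * (ennreal ((S u - H u)\<^sup>2) * indicator {0..t} u) + ennreal (2 * w\<^sup>2) * indicator {0..t} u"
    proof (cases "\<exists>j<m. u \<in> {p j<..p (Suc j)}")
      case True
      then obtain j where j: "j < m" "u \<in> {p j<..p (Suc j)}" by blast
      have ut: "u \<in> {0..t}" using j range[of j] range[of "Suc j"] by auto
      have "(\<Sum>j<m. ennreal ((S (p (Suc j)) - H (p j))\<^sup>2) * indicator {p j<..p (Suc j)} u) =
        (\<Sum>i\<in>{j}. ennreal ((S (p (Suc i)) - H (p i))\<^sup>2) * indicator {p i<..p (Suc i)} u)"
      proof (rule sum.mono_neutral_right)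
        show "\<forall>i\<in>{..<m} - {j}. ennreal ((S (p (Suc i)) - H (p i))\<^sup>2) * indicator {p i<..p (Suc i)} u = 0"
        proof
          fix i assume i: "i \<in> {..<m} - {j}"
          have "u \<notin> {p i<..p (Suc i)}"
          proof
            assume "u \<in> {p i<..p (Suc i)}"
            from time_partition_block_unique[OF part _ j(1) this j(2)] i show False by simp
          qed
          then show "ennreal ((S (p (Suc i)) - H (p i))\<^sup>2) * indicator {p i<..p (Suc i)} u = 0" by simp
        qed
      qed (use j(1) in auto)
      also have "\<dots> = ennreal ((S u - H (p j))\<^sup>2)" using j S_block[OF j] by simp
      also have "\<dots> \<le> ennreal (2 * (S u - H u)\<^sup>2 + 2 * w\<^sup>2)"
      proof (rule ennreal_leI)
        have "\<bar>H u - H (p j)\<bar>\<^sup>2 \<le> w\<^sup>2" using w[OF j(1), of u] j(2) by (intro power_mono) auto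
        moreover have "(S u - H (p j))\<^sup>2 \<le> 2 * (S u - H u)\<^sup>2 + 2 * (H u - H (p j))\<^sup>2"
          using sum_squares_bound[of "S u - H u" "H u - H (p j)"] by (simp add: power2_eq_square algebra_simps)
        ultimately show "(S u - H (p j))\<^sup>2 \<le> 2 * (S u - H u)\<^sup>2 + 2 * w\<^sup>2" by simp
      qed
      also have "\<dots> = 2 * ennreal ((S u - H u)\<^sup>2) + ennreal (2 * w\<^sup>2)"
        by (simp add: ennreal_mult)
      finally show ?thesis using ut by simp
    next
      case False
      then have "(\<Sum>j<m. ennreal ((S (p (Suc j)) - H (p j))\<^sup>2) * indicator {p j<..p (Suc j)} u) = 0"
        by (intro sum.neutral) auto
      then show ?thesis by simp
    qed
  qed
  also have "\<dots> = 2 * J + ennreal (2 * w\<^sup>2) * ennreal t"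
  proof -
    have [measurable]: "(\<lambda>u. ennreal ((S u - H u)\<^sup>2) * indicator {0..t} u) \<in> borel_measurable lborel"
      unfolding eqJ by measurable
    have "(\<integral>\<^sup>+u. 2 * (ennreal ((S u - H u)\<^sup>2) * indicator {0..t} u) + ennreal (2 * w\<^sup>2) * indicator {0..t} u \<partial>lborel) =
      (\<integral>\<^sup>+u. 2 * (ennreal ((S u - H u)\<^sup>2) * indicator {0..t} u) \<partial>lborel) + (\<integral>\<^sup>+u. ennreal (2 * w\<^sup>2) * indicator {0..t} u \<partial>lborel)"
      by (rule nn_integral_add) measurable
    also have "(\<integral>\<^sup>+u. 2 * (ennreal ((S u - H u)\<^sup>2) * indicator {0..t} u) \<partial>lborel) = 2 * J"
      unfolding J_def by (rule nn_integral_cmult) measurable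
    also have "(\<integral>\<^sup>+u. ennreal (2 * w\<^sup>2) * indicator {0..t} u \<partial>lborel) = ennreal (2 * w\<^sup>2) * ennreal t"
      using t by (subst nn_integral_cmult_indicator) auto
    finally show ?thesis .
  qed
  also have "\<dots> = ennreal (2 * enn2real J + 2 * w\<^sup>2 * t)"
  proof -
    have "ennreal (2 * enn2real J + 2 * w\<^sup>2 * t) = ennreal (2 * enn2real J) + ennreal (2 * w\<^sup>2 * t)"
      using t by (intro ennreal_plus) auto
    also have "ennreal (2 * enn2real J) = 2 * J" using Jfin by (subst ennreal_mult) auto
    also have "ennreal (2 * w\<^sup>2 * t) = ennreal (2 * w\<^sup>2) * ennreal t" using t by (intro ennreal_mult) auto
    finally show ?thesis by (rule sym)
  qed
  finally show ?thesis using t by (subst (asm) ennreal_le_iff) (auto simp: J_def)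
qed

section \<open>Joint measurability, and oscillation along fine partitions\<close>

lemma measurable_simple_process_pair:
  assumes "\<And>i. i < n \<Longrightarrow> \<xi> i \<in> borel_measurable M"
  shows "(\<lambda>x. simple_process n \<tau> \<xi> (fst x) (snd x)) \<in> borel_measurable (restrict_space lborel I \<Otimes>\<^sub>M M)"
  unfolding simple_process_def
proof (rule borel_measurable_sum, rule borel_measurable_times)
  fix i assume "i \<in> {..<n}"
  then show "(\<lambda>x. \<xi> i (snd x)) \<in> borel_measurable (restrict_space lborel I \<Otimes>\<^sub>M M)"
    using assms by (intro measurable_compose[OF measurable_snd]) auto
  have "indicator {\<tau> i<..\<tau> (Suc i)} \<in> borel_measurable (restrict_space lborel I)"
    by (intro measurable_restrict_space1) auto
  then show "(\<lambda>x. indicator {\<tau> i<..\<tau> (Suc i)} (fst x) :: real) \<in> borel_measurable (restrict_space lborel I \<Otimes>\<^sub>M M)"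
    by (intro measurable_compose[OF measurable_fst])
qed

lemma measurable_square_integral:
  fixes f :: "real \<Rightarrow> 'a \<Rightarrow> real"
  assumes f: "(\<lambda>x. f (fst x) (snd x)) \<in> borel_measurable (restrict_space lborel {0..t} \<Otimes>\<^sub>M M)"
  shows "(\<lambda>\<omega>. \<integral>\<^sup>+s\<in>{0..t}. ennreal ((f s \<omega>)\<^sup>2) \<partial>lborel) \<in> borel_measurable M"
proof -
  let ?R = "restrict_space lborel {0..t}"
  interpret R: finite_measure ?R
    by (rule finite_measureI) (auto simp: emeasure_restrict_space space_restrict_space emeasure_lborel_Icc_eq)
  have "(\<lambda>x. ennreal ((f (fst x) (snd x))\<^sup>2)) \<in> borel_measurable (?R \<Otimes>\<^sub>M M)" using f by measurable
  from measurable_compose[OF measurable_pair_swap' this]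
  have "(\<lambda>(\<omega>, s). ennreal ((f s \<omega>)\<^sup>2)) \<in> borel_measurable (M \<Otimes>\<^sub>M ?R)"
    by (simp add: case_prod_beta)
  then have "(\<lambda>\<omega>. \<integral>\<^sup>+s. ennreal ((f s \<omega>)\<^sup>2) \<partial>?R) \<in> borel_measurable M"
    by (rule R.borel_measurable_nn_integral)
  then show ?thesis by (simp add: nn_integral_restrict_space)
qed

lemma continuous_mesh_oscillation:
  fixes f :: "real \<Rightarrow> real"
  assumes f: "continuous_on {0..t} f" and part: "\<And>k. time_partition 0 t (m k) (p k)"
    and mesh: "\<And>k i. i < m k \<Longrightarrow> p k (Suc i) - p k i \<le> c / real (Suc k)" and e: "0 < e"
  shows "\<forall>\<^sub>F k in sequentially. \<forall>i<m k. \<forall>u\<in>{p k i..p k (Suc i)}. \<bar>f u - f (p k i)\<bar> \<le> e"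
proof -
  have "uniformly_continuous_on {0..t} f" by (intro compact_uniformly_continuous f) auto
  then obtain d where d: "0 < d" "\<And>x y. x \<in> {0..t} \<Longrightarrow> y \<in> {0..t} \<Longrightarrow> dist y x < d \<Longrightarrow> dist (f y) (f x) < e"
    using e unfolding uniformly_continuous_on_def by metis
  have "(\<lambda>k. c / real (Suc k)) \<longlonglongrightarrow> 0" by (rule LIMSEQ_Suc[OF lim_const_over_n])
  then have "\<forall>\<^sub>F k in sequentially. c / real (Suc k) < d" using d(1) by (rule order_tendstoD(2))
  then show ?thesis
  proof eventually_elim
    case (elim k)
    show ?case
    proof (intro allI impI ballI)
      fix i u assume i: "i < m k" and u: "u \<in> {p k i..p k (Suc i)}"
      have "0 \<le> p k i" "p k (Suc i) \<le> t"
        using time_partition_mono[OF part, of 0 i k] time_partition_mono[OF part, of "Suc i" "m k" k] part[of k] i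
        by (auto simp: time_partition_def)
      moreover have "u - p k i < d" using mesh[OF i] u elim by auto
      ultimately have "dist (f u) (f (p k i)) < e" using u by (intro d(2)) (auto simp: dist_real_def)
      then show "\<bar>f u - f (p k i)\<bar> \<le> e" by (simp add: dist_real_def)
    qed
  qed
qed

context wiener_filtration
begin

text \<open>At the right end of block j only coefficients \<xi> i with \<tau> i <= p j can be
  switched on: a jump time before p (Suc j) is itself a partition point, hence at most p j.\<close>

lemma simple_process_adapted:
  assumes part: "time_partition 0 t m p" and simple: "simple_integrand M F n \<tau> \<xi>"
    and \<tau>: "\<And>i. i \<le> n \<Longrightarrow> min (\<tau> i) t \<in> p ` {..m}" and j: "j < m" and \<tau>0: "\<And>i. i \<le> n \<Longrightarrow> 0 \<le> \<tau> i"
  shows "simple_process n \<tau> \<xi> (p (Suc j)) \<in> borel_measurable (F (p j))"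
  unfolding simple_process_def[abs_def]
proof (rule borel_measurable_sum)
  fix i assume "i \<in> {..<n}"
  then have i: "i < n" by simp
  obtain \<alpha> where \<alpha>: "\<alpha> \<le> m" "min (\<tau> i) t = p \<alpha>" using \<tau>[of i] i by auto
  have last: "p (Suc j) \<in> {p j<..p (Suc j)}" using part j by (auto simp: time_partition_def)
  have "p (Suc j) \<le> t" using time_partition_mono[OF part, of "Suc j" m] part j by (auto simp: time_partition_def)
  show "(\<lambda>\<omega>. \<xi> i \<omega> * indicator {\<tau> i<..\<tau> (Suc i)} (p (Suc j))) \<in> borel_measurable (F (p j))"
  proof (cases "\<alpha> \<le> j")
    case True
    then have "p \<alpha> \<le> p j" using j by (intro time_partition_mono[OF part]) auto
    then have "\<tau> i \<le> p j" using \<alpha>(2) last \<open>p (Suc j) \<le> t\<close> by auto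
    then have "\<xi> i \<in> borel_measurable (F (p j))"
      using simple i \<tau>0[of i] by (intro adapted_mono[of "\<tau> i" "p j"]) (auto simp: simple_integrand_def)
    then show ?thesis by measurable
  next
    case False
    then have "\<not> \<tau> i < p (Suc j)" using time_partition_index(1)[OF part \<alpha> j last] by simp
    then show ?thesis by simp
  qed
qed

text \<open>The set \<open>Q k\<close> consists of the jump times in \<open>[0, t]\<close> of the \<open>k\<close>-th simple process
  approximating \<open>H\<close>.\<close>

lemma riemann_ito_sums_vanish:
  fixes D H :: "real \<Rightarrow> 'a \<Rightarrow> real"
  assumes t: "0 \<le> t" and ito: "has_ito_integral M F B H t Y"
    and D: "\<And>s. 0 \<le> s \<Longrightarrow> s \<le> t \<Longrightarrow> D s \<in> borel_measurable M"
    and cont: "AE \<omega> in M. continuous_on {0..t} (\<lambda>s. H s \<omega>) \<and> continuous_on {0..t} (\<lambda>s. D s \<omega>)"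
    and Z [measurable]: "Z \<in> borel_measurable M"
    and Z_eq: "AE \<omega> in M. Z \<omega> = (LINT s:{0..t}|lborel. D s \<omega>) + Y \<omega>"
  shows "\<exists>Q. (\<forall>k::nat. finite (Q k) \<and> Q k \<subseteq> {0..t}) \<and>
    (\<forall>m p c. (\<forall>k. time_partition 0 t (m k) (p k) \<and> Q k \<subseteq> p k ` {..m k} \<and>
        (\<forall>i<m k. p k (Suc i) - p k i \<le> c / real (Suc k))) \<longrightarrow>
      vanishes_in_probability (\<lambda>k \<omega>. (riemann_ito_sum (m k) (p k) D H \<omega>) - Z \<omega>))"
proof -
  obtain n \<tau> \<xi> where simple: "\<And>k. simple_integrand M F (n k) (\<tau> k) (\<xi> k)"
    and sq: "\<And>\<epsilon>. 0 < \<epsilon> \<Longrightarrow> (\<lambda>k. measure M {\<omega> \<in> space M. ennreal \<epsilon> <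
            (\<integral>\<^sup>+ s\<in>{0..t}. ennreal ((simple_process (n k) (\<tau> k) (\<xi> k) s \<omega> - H s \<omega>)\<^sup>2) \<partial>lborel)}) \<longlonglongrightarrow> 0"
    and int: "\<And>\<epsilon>. 0 < \<epsilon> \<Longrightarrow> (\<lambda>k. measure M {\<omega> \<in> space M. \<epsilon> <
            \<bar>simple_ito_integral B (n k) (\<tau> k) (\<xi> k) t \<omega> - Y \<omega>\<bar>}) \<longlonglongrightarrow> 0"
    and H_meas: "(\<lambda>(s, \<omega>). H s \<omega>) \<in> borel_measurable (restrict_space lborel {0..t} \<Otimes>\<^sub>M M)"
    and H_adapted: "\<And>s. s \<in> {0..t} \<Longrightarrow> H s \<in> borel_measurable (F s)"
    and Y [measurable]: "Y \<in> borel_measurable M"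
    using ito unfolding has_ito_integral_def ito_integrand_def by blast
  have \<tau>0: "0 \<le> \<tau> k i" if "i \<le> n k" for k i
    using that
  proof (induction i)
    case (Suc i)
    then have "\<tau> k i \<le> \<tau> k (Suc i)" using simple[of k] by (simp add: simple_integrand_def)
    with Suc show ?case by simp
  qed (use simple[of k] in \<open>simp add: simple_integrand_def\<close>)
  define Q where "Q k = (\<lambda>i. min (\<tau> k i) t) ` {..n k}" for k
  have Q: "finite (Q k) \<and> Q k \<subseteq> {0..t}" for k using \<tau>0[of _ k] t by (auto simp: Q_def)
  have "vanishes_in_probability (\<lambda>k \<omega>. (riemann_ito_sum (m k) (p k) D H \<omega>) - Z \<omega>)"
    if part: "\<And>k. time_partition 0 t (m k) (p k)" and refine: "\<And>k. Q k \<subseteq> p k ` {..m k}"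
      and mesh: "\<And>k i. i < m k \<Longrightarrow> p k (Suc i) - p k i \<le> c / real (Suc k)" for m p c
  proof -
    have range: "0 \<le> p k i" "p k i \<le> t" if "i \<le> m k" for k i
      using time_partition_mono[OF part, of 0 i k] time_partition_mono[OF part, of i "m k" k] part[of k] that
      by (auto simp: time_partition_def)
    have \<tau>P: "min (\<tau> k i) t \<in> p k ` {..m k}" if "i \<le> n k" for k i
      using refine[of k] that by (auto simp: Q_def)
    define S where "S k u \<omega> = simple_process (n k) (\<tau> k) (\<xi> k) u \<omega>" for k u \<omega>
    \<comment> \<open>Error integrand on a block: the simple process minus H frozen at the left end.
      The noise sum for H is I minus the step integral of G, where I is the simple Ito integral
      itself and the second sum vanishes in probability as soon as U, the quadratic sum of G,
      does.\<close>
    define G where "G k i \<omega> = S k (p k (Suc i)) \<omega> - H (p k i) \<omega>" for k i \<omega>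
    define I where "I k \<omega> = (\<Sum>i<m k. S k (p k (Suc i)) \<omega> * (B (p k (Suc i)) \<omega> - B (p k i) \<omega>))" for k \<omega>
    define U where "U k \<omega> = (\<Sum>i<m k. (G k i \<omega>)\<^sup>2 * (p k (Suc i) - p k i))" for k \<omega>
    define J where "J k \<omega> = (\<integral>\<^sup>+ s\<in>{0..t}. ennreal ((S k s \<omega> - H s \<omega>)\<^sup>2) \<partial>lborel)" for k \<omega>
    have S_adapted: "S k (p k (Suc i)) \<in> borel_measurable (F (p k i))" if "i < m k" for k i
      unfolding S_def using that \<tau>P \<tau>0 by (intro simple_process_adapted[OF part simple]) auto
    have G_adapted: "G k i \<in> borel_measurable (F (p k i))" if "i < m k" for k i
    proof -
      note [measurable] = S_adapted[OF that]
      have [measurable]: "H (p k i) \<in> borel_measurable (F (p k i))" using range[of i k] that by (intro H_adapted) auto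
      show ?thesis unfolding G_def[abs_def] by measurable
    qed
    have m1 [measurable]: "S k (p k (Suc i)) \<in> borel_measurable M" "G k i \<in> borel_measurable M"
      "H (p k i) \<in> borel_measurable M" "D (p k i) \<in> borel_measurable M"
      "B (p k i) \<in> borel_measurable M" "B (p k (Suc i)) \<in> borel_measurable M" if "i < m k" for k i
      using adapted_measurable[OF _ S_adapted[OF that]] adapted_measurable[OF _ G_adapted[OF that]]
        adapted_measurable[OF _ H_adapted[of "p k i"]] D[of "p k i"] range[of i k] range[of "Suc i" k] that
      by auto
    have \<xi>_meas: "\<xi> k i \<in> borel_measurable M" if "i < n k" for k i
      using simple[of k] that \<tau>0[of i k] adapted_measurable[of "\<tau> k i"] by (auto simp: simple_integrand_def)
    have J_meas [measurable]: "J k \<in> borel_measurable M" for k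
    proof -
      have [measurable]: "(\<lambda>x. S k (fst x) (snd x)) \<in> borel_measurable (restrict_space lborel {0..t} \<Otimes>\<^sub>M M)"
        unfolding S_def using \<xi>_meas by (rule measurable_simple_process_pair)
      have [measurable]: "(\<lambda>x. H (fst x) (snd x)) \<in> borel_measurable (restrict_space lborel {0..t} \<Otimes>\<^sub>M M)"
        using H_meas by (simp add: case_prod_beta')
      have "(\<lambda>x. S k (fst x) (snd x) - H (fst x) (snd x)) \<in> borel_measurable (restrict_space lborel {0..t} \<Otimes>\<^sub>M M)"
        by measurable
      from measurable_square_integral[of "\<lambda>s \<omega>. S k s \<omega> - H s \<omega>", OF this] show ?thesis unfolding J_def[abs_def] .
    qed
    have [measurable]: "U k \<in> borel_measurable M" "I k \<in> borel_measurable M" for k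
      unfolding U_def I_def by measurable
    have U0: "0 \<le> U k \<omega>" for k \<omega>
      unfolding U_def using part[of k] by (intro sum_nonneg mult_nonneg_nonneg) (auto simp: time_partition_def less_imp_le)
    have vJ: "vanishes_in_probability (\<lambda>k \<omega>. 2 * enn2real (J k \<omega>))"
      unfolding vanishes_in_probability_def
    proof (intro allI impI)
      fix \<epsilon> :: real assume \<epsilon>: "0 < \<epsilon>"
      have le: "prob {\<omega> \<in> space M. \<epsilon> < \<bar>2 * enn2real (J k \<omega>)\<bar>} \<le> prob {\<omega> \<in> space M. ennreal (\<epsilon> / 2) < J k \<omega>}" for k
      proof (rule finite_measure_mono, safe)
        fix \<omega> assume "\<epsilon> < \<bar>2 * enn2real (J k \<omega>)\<bar>"
        then have *: "\<epsilon> / 2 < enn2real (J k \<omega>)" by simp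
        then have "J k \<omega> < \<top>" using \<epsilon> by (cases "J k \<omega>") auto
        then have "ennreal (enn2real (J k \<omega>)) = J k \<omega>" by simp
        moreover have "ennreal (\<epsilon> / 2) < ennreal (enn2real (J k \<omega>))"
          using * \<epsilon> by (intro ennreal_lessI) auto
        ultimately show "ennreal (\<epsilon> / 2) < J k \<omega>" by simp
      qed measurable
      have "(\<lambda>k. prob {\<omega> \<in> space M. ennreal (\<epsilon> / 2) < J k \<omega>}) \<longlonglongrightarrow> 0"
        unfolding J_def S_def using \<epsilon> by (intro sq) simp
      then show "(\<lambda>k. prob {\<omega> \<in> space M. \<epsilon> < \<bar>2 * enn2real (J k \<omega>)\<bar>}) \<longlonglongrightarrow> 0"
        by (rule tendsto_sandwich[OF always_eventually always_eventually tendsto_const, rotated -1])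
          (use le in auto)
    qed
    \<comment> \<open>U <= 2 J + 2 w^2 t holds path by path with an oscillation w that tends to 0 at
      a speed depending on the path, whereas J tends to 0 in probability only. The positive part of
      U - 2 J separates the two modes of convergence.\<close>
    have vU: "vanishes_in_probability (\<lambda>k \<omega>. max 0 (U k \<omega> - 2 * enn2real (J k \<omega>)))"
    proof (rule vanishes_in_probability_AE)
      show "AE \<omega> in M. (\<lambda>k. max 0 (U k \<omega> - 2 * enn2real (J k \<omega>))) \<longlonglongrightarrow> 0"
        using cont
      proof eventually_elim
        case (elim \<omega>)
        then have H_cont: "continuous_on {0..t} (\<lambda>s. H s \<omega>)" by simp
        show ?case
        proof (rule LIMSEQ_I)
          fix e :: real assume e: "0 < e"
          define w where "w = sqrt (e / (4 * (t + 1)))"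
          have w: "0 < w" "2 * w\<^sup>2 * t < e" using e t by (auto simp: w_def field_simps intro!: add_pos_nonneg)
          have "\<forall>\<^sub>F k in sequentially. \<forall>i<m k. \<forall>u\<in>{p k i..p k (Suc i)}. \<bar>H u \<omega> - H (p k i) \<omega>\<bar> \<le> w"
            by (rule continuous_mesh_oscillation[OF H_cont part mesh w(1)])
          then obtain k0 where k0: "\<And>k i u. k0 \<le> k \<Longrightarrow> i < m k \<Longrightarrow> u \<in> {p k i..p k (Suc i)} \<Longrightarrow> \<bar>H u \<omega> - H (p k i) \<omega>\<bar> \<le> w"
            unfolding eventually_sequentially by blast
          show "\<exists>k0. \<forall>k\<ge>k0. norm (max 0 (U k \<omega> - 2 * enn2real (J k \<omega>)) - 0) < e"
          proof (intro exI allI impI)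
            fix k assume k: "k0 \<le> k"
            have "U k \<omega> \<le> 2 * enn2real (J k \<omega>) + 2 * w\<^sup>2 * t"
              unfolding U_def G_def J_def
            proof (rule step_square_integral_le[OF part H_cont])
              show "S k u \<omega> = S k (p k (Suc j)) \<omega>" if "j < m k" "u \<in> {p k j<..p k (Suc j)}" for j u
                unfolding S_def using that \<tau>P by (intro simple_process_on_block[OF part])
              show "(\<lambda>u. S k u \<omega>) \<in> borel_measurable borel"
                unfolding S_def simple_process_def by measurable
              show "\<bar>S k u \<omega>\<bar> \<le> (\<Sum>i<n k. \<bar>\<xi> k i \<omega>\<bar>)" for u
              proof -
                have "\<bar>S k u \<omega>\<bar> \<le> (\<Sum>i<n k. \<bar>\<xi> k i \<omega> * indicator {\<tau> k i<..\<tau> k (Suc i)} u\<bar>)"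
                  unfolding S_def simple_process_def by (rule sum_abs)
                also have "\<dots> \<le> (\<Sum>i<n k. \<bar>\<xi> k i \<omega>\<bar>)"
                  by (intro sum_mono) (auto simp: indicator_def)
                finally show ?thesis .
              qed
              show "\<bar>H u \<omega> - H (p k j) \<omega>\<bar> \<le> w" if "j < m k" "u \<in> {p k j..p k (Suc j)}" for j u
                using k0[OF k that] .
            qed
            then show "norm (max 0 (U k \<omega> - 2 * enn2real (J k \<omega>)) - 0) < e" using w(2) e by auto
          qed
        qed
      qed
    qed measurable
    have "vanishes_in_probability U"
    proof (rule vanishes_in_probability_squeeze[OF _ _ _ vJ vU])
      show "AE \<omega> in M. \<forall>k. \<bar>U k \<omega>\<bar> \<le> \<bar>2 * enn2real (J k \<omega>)\<bar> + \<bar>max 0 (U k \<omega> - 2 * enn2real (J k \<omega>))\<bar>"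
        using U0 by (intro AE_I2 allI) (simp add: max_def)
    qed measurable
    then have vG: "vanishes_in_probability (\<lambda>k \<omega>. \<Sum>i<m k. G k i \<omega> * (B (p k (Suc i)) \<omega> - B (p k i) \<omega>))"
      unfolding U_def[abs_def] using G_adapted by (intro step_integral_vanishes[OF _ part]) auto
    have vI: "vanishes_in_probability (\<lambda>k \<omega>. I k \<omega> - Y \<omega>)"
    proof -
      have "simple_ito_integral B (n k) (\<tau> k) (\<xi> k) t \<omega> = I k \<omega>" for k \<omega>
        unfolding I_def S_def
      proof (rule simple_ito_integral_on_partition[OF part \<tau>P])
        show "\<tau> k i \<le> \<tau> k (Suc i)" if "i < n k" for i
          using simple[of k] that by (simp add: simple_integrand_def)
      qed
      then show ?thesis using int by (simp add: vanishes_in_probability_def)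
    qed
    have vN: "vanishes_in_probability (\<lambda>k \<omega>. (\<Sum>i<m k. H (p k i) \<omega> * (B (p k (Suc i)) \<omega> - B (p k i) \<omega>)) - Y \<omega>)"
    proof (rule vanishes_in_probability_squeeze[OF _ _ _ vI vG])
      have eq: "(\<Sum>i<m k. H (p k i) \<omega> * (B (p k (Suc i)) \<omega> - B (p k i) \<omega>)) =
          I k \<omega> - (\<Sum>i<m k. G k i \<omega> * (B (p k (Suc i)) \<omega> - B (p k i) \<omega>))" for k \<omega>
        unfolding I_def G_def by (simp add: left_diff_distrib sum_subtractf)
      show "AE \<omega> in M. \<forall>k. \<bar>(\<Sum>i<m k. H (p k i) \<omega> * (B (p k (Suc i)) \<omega> - B (p k i) \<omega>)) - Y \<omega>\<bar>
          \<le> \<bar>I k \<omega> - Y \<omega>\<bar> + \<bar>\<Sum>i<m k. G k i \<omega> * (B (p k (Suc i)) \<omega> - B (p k i) \<omega>)\<bar>"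
        unfolding eq
      proof (intro AE_I2 allI)
        fix \<omega> k
        show "\<bar>I k \<omega> - (\<Sum>i<m k. G k i \<omega> * (B (p k (Suc i)) \<omega> - B (p k i) \<omega>)) - Y \<omega>\<bar>
          \<le> \<bar>I k \<omega> - Y \<omega>\<bar> + \<bar>\<Sum>i<m k. G k i \<omega> * (B (p k (Suc i)) \<omega> - B (p k i) \<omega>)\<bar>" by linarith
      qed
    qed measurable
    have vD: "vanishes_in_probability (\<lambda>k \<omega>. (\<Sum>i<m k. D (p k i) \<omega> * (p k (Suc i) - p k i)) - (Z \<omega> - Y \<omega>))"
    proof (rule vanishes_in_probability_AE)
      show "AE \<omega> in M. (\<lambda>k. (\<Sum>i<m k. D (p k i) \<omega> * (p k (Suc i) - p k i)) - (Z \<omega> - Y \<omega>)) \<longlonglongrightarrow> 0"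
        using cont Z_eq
      proof eventually_elim
        case (elim \<omega>)
        then have D_cont: "continuous_on {0..t} (\<lambda>s. D s \<omega>)" by simp
        have "set_integrable lborel {0..t} (\<lambda>s. D s \<omega>)"
          by (rule borel_integrable_atLeastAtMost'[OF D_cont])
        then have ZY: "Z \<omega> - Y \<omega> = integral {0..t} (\<lambda>s. D s \<omega>)"
          using elim(2) by (simp add: set_borel_integral_eq_integral(2))
        show ?case
        proof (rule LIMSEQ_I)
          fix e :: real assume e: "0 < e"
          define w where "w = e / (2 * (t + 1))"
          have w: "0 < w" "w * t < e" using e t by (auto simp: w_def field_simps intro!: add_nonneg_pos)
          have "\<forall>\<^sub>F k in sequentially. \<forall>i<m k. \<forall>u\<in>{p k i..p k (Suc i)}. \<bar>D u \<omega> - D (p k i) \<omega>\<bar> \<le> w"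
            by (rule continuous_mesh_oscillation[OF D_cont part mesh w(1)])
          then obtain k0 where k0: "\<And>k i u. k0 \<le> k \<Longrightarrow> i < m k \<Longrightarrow> u \<in> {p k i..p k (Suc i)} \<Longrightarrow> \<bar>D u \<omega> - D (p k i) \<omega>\<bar> \<le> w"
            unfolding eventually_sequentially by blast
          show "\<exists>k0. \<forall>k\<ge>k0. norm ((\<Sum>i<m k. D (p k i) \<omega> * (p k (Suc i) - p k i)) - (Z \<omega> - Y \<omega>) - 0) < e"
          proof (intro exI allI impI)
            fix k assume k: "k0 \<le> k"
            have "\<bar>(\<Sum>i<m k. D (p k i) \<omega> * (p k (Suc i) - p k i)) - integral {0..t} (\<lambda>s. D s \<omega>)\<bar> \<le> w * (t - 0)"
              using k0[OF k] by (intro riemann_sum_error[OF part D_cont])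
            then show "norm ((\<Sum>i<m k. D (p k i) \<omega> * (p k (Suc i) - p k i)) - (Z \<omega> - Y \<omega>) - 0) < e"
              using w(2) by (simp add: ZY)
          qed
        qed
      qed
    qed measurable
    show ?thesis
    proof (rule vanishes_in_probability_squeeze[OF _ _ _ vD vN])
      show "AE \<omega> in M. \<forall>k. \<bar>(riemann_ito_sum (m k) (p k) D H \<omega>) - Z \<omega>\<bar>
        \<le> \<bar>(\<Sum>i<m k. D (p k i) \<omega> * (p k (Suc i) - p k i)) - (Z \<omega> - Y \<omega>)\<bar> +
          \<bar>(\<Sum>i<m k. H (p k i) \<omega> * (B (p k (Suc i)) \<omega> - B (p k i) \<omega>)) - Y \<omega>\<bar>"
        unfolding sum.distrib by (intro AE_I2 allI) linarith
    qed measurable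
  qed
  then show ?thesis by (intro exI[of _ Q] conjI allI impI) (use Q in blast)+
qed

end

section \<open>Solutions of the pantograph equation\<close>

lemma sum_lessThan_split:
  fixes f :: "nat \<Rightarrow> real"
  assumes "l \<le> m"
  shows "(\<Sum>i<m. f i) - (\<Sum>i<l. f i) = (\<Sum>i<m - l. f (l + i))"
proof -
  have "(\<Sum>i<l + n. f i) = (\<Sum>i<l. f i) + (\<Sum>i<n. f (l + i))" for n
    by (induction n) auto
  from this[of "m - l"] assms show ?thesis by simp
qed

lemma pantograph_drift_noise_continuous:
  fixes X :: "real \<Rightarrow> real"
  assumes "0 < q" and X: "continuous_on {0..} X"
  shows "continuous_on {0..t} (\<lambda>u. c * X u + d * X (q * u))"
proof -
  have "continuous_on {0..t} X" by (rule continuous_on_subset[OF X]) auto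
  moreover have "continuous_on {0..t} (\<lambda>u. X (q * u))"
    using assms(1) by (intro continuous_on_compose2[OF X]) (auto intro!: continuous_intros)
  ultimately show ?thesis by (intro continuous_intros)
qed

text \<open>X is set to 0 on a null set containing the discontinuous paths; the filtration contains
  the null sets, so adaptedness is kept. The equation between s and t is the difference of those on
  [0, t] and [0, s], taken along partitions that pass through s and refine the jump times belonging
  to both.\<close>

lemma pantograph_process_of_solution:
  fixes M :: "'a measure" and B X :: "real \<Rightarrow> 'a \<Rightarrow> real"
  assumes q: "0 < q" "q < 1" and wiener: "wiener_process M B" and X0: "X0 \<in> borel_measurable M"
    and indep: "prob_space.indep_set M (sets (vimage_algebra (space M) X0 borel)) (sets (process_sigma M {0..} B))"
    and X: "pantograph_solution M B a b \<sigma> \<rho> q X0 X" and X0_L2: "X0 \<in> L2 M"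
  obtains X' where "pantograph_process M (natural_filtration M X0 B) B X' a b \<sigma> \<rho> q"
    and "AE \<omega> in M. \<forall>t. X' t \<omega> = X t \<omega>"
proof -
  define F where "F = natural_filtration M X0 B"
  interpret wiener_filtration M F B
    unfolding F_def by (rule wiener_filtration_natural_filtration[OF wiener X0 indep])
  have X_adapted: "X t \<in> borel_measurable (F t)" if "0 \<le> t" for t
    using X that by (simp add: pantograph_solution_def F_def)
  have X_meas: "X t \<in> borel_measurable M" if "0 \<le> t" for t
    using X_adapted[OF that] that by (rule adapted_measurable[rotated])
  have X_cont: "AE \<omega> in M. continuous_on {0..} (\<lambda>t. X t \<omega>)" and X_init: "AE \<omega> in M. X 0 \<omega> = X0 \<omega>"
    using X by (simp_all add: pantograph_solution_def)
  obtain N where N: "N \<in> null_sets M" "{\<omega> \<in> space M. \<not> continuous_on {0..} (\<lambda>t. X t \<omega>)} \<subseteq> N"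
    using X_cont by (auto simp: eventually_ae_filter)
  define X' where "X' t \<omega> = (if \<omega> \<in> N then 0 else X t \<omega>)" for t \<omega>
  have X'_eq: "AE \<omega> in M. \<forall>t. X' t \<omega> = X t \<omega>"
    using AE_not_in[OF N(1)] by eventually_elim (auto simp: X'_def)
  define D where "D s \<omega> = a * X s \<omega> + b * X (q * s) \<omega>" for s \<omega>
  define H where "H s \<omega> = \<sigma> * X s \<omega> + \<rho> * X (q * s) \<omega>" for s \<omega>
  let ?R = "\<lambda>(t :: real) (Q :: nat \<Rightarrow> real set).
    (\<forall>k::nat. finite (Q k) \<and> Q k \<subseteq> {0..t}) \<and>
    (\<forall>m p c. (\<forall>k. time_partition 0 t (m k) (p k) \<and> Q k \<subseteq> p k ` {..m k} \<and>
        (\<forall>i<m k. p k (Suc i) - p k i \<le> c / real (Suc k))) \<longrightarrow>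
      vanishes_in_probability (\<lambda>k \<omega>. (riemann_ito_sum (m k) (p k) D H \<omega>) - (X t \<omega> - X 0 \<omega>)))"
  have "\<exists>Q. ?R t Q" if t: "0 \<le> t" for t
  proof -
    obtain Y where Y: "has_ito_integral M F B H t Y"
      "AE \<omega> in M. X t \<omega> = X0 \<omega> + (LINT s:{0..t}|lborel. D s \<omega>) + Y \<omega>"
      using X t unfolding pantograph_solution_def F_def H_def[abs_def] D_def by blast
    show ?thesis
    proof (rule riemann_ito_sums_vanish[OF t Y(1)])
      show "D s \<in> borel_measurable M" if "0 \<le> s" "s \<le> t" for s
      proof -
        have [measurable]: "X s \<in> borel_measurable M" "X (q * s) \<in> borel_measurable M"
          using that q by (auto intro: X_meas)
        show ?thesis unfolding D_def[abs_def] by measurable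
      qed
      show "AE \<omega> in M. continuous_on {0..t} (\<lambda>s. H s \<omega>) \<and> continuous_on {0..t} (\<lambda>s. D s \<omega>)"
        using X_cont by eventually_elim
          (auto simp: H_def D_def intro!: pantograph_drift_noise_continuous[OF q(1)])
      show "(\<lambda>\<omega>. X t \<omega> - X 0 \<omega>) \<in> borel_measurable M" using X_meas[OF t] X_meas[of 0] by measurable
      show "AE \<omega> in M. X t \<omega> - X 0 \<omega> = (LINT s:{0..t}|lborel. D s \<omega>) + Y \<omega>"
        using Y(2) X_init by eventually_elim simp
    qed
  qed
  then have "\<exists>Q. \<forall>t\<in>{0..}. ?R t (Q t)" by (intro bchoice) simp
  then obtain Q where "\<forall>t\<in>{0..}. ?R t (Q t)" by (elim exE)
  then have Q: "?R t (Q t)" if "0 \<le> t" for t using that by (elim ballE) auto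
  have approx: "\<exists>m p. (\<forall>k. time_partition s t (m k) (p k)) \<and>
      (AE \<omega> in M. (\<lambda>k. riemann_ito_sum (m k) (p k) D H \<omega>) \<longlonglongrightarrow> X t \<omega> - X s \<omega>)"
    if s: "0 \<le> s" and st: "s < t" for s t
  proof -
    have t: "0 < t" "0 \<le> t" using s st by auto
    have fin: "finite (Q u k)" "Q u k \<subseteq> {0..u}" if "0 \<le> u" for u k
      using conjunct1[OF Q[OF that]] by auto
    \<comment> \<open>The uniform grid bounds the mesh by t / (k + 1), on [0, s] as well; this is
      why the mesh constant c in \<open>riemann_ito_sums_vanish\<close> is not tied to the length of
      the interval.\<close>
    define P where "P k = {0, s, t} \<union> Q s k \<union> Q t k \<union> (\<lambda>j. real j * (t / real (Suc k))) ` {..Suc k}" for k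
    have "\<exists>m p. time_partition 0 t m p \<and> p ` {..m} = P k" for k
    proof (rule time_partition_of_finite_set)
      show "finite (P k)" using fin(1) s t by (simp add: P_def)
      have "real j * (t / real (Suc k)) \<le> t" if "j \<le> Suc k" for j
      proof -
        have "real j * (t / real (Suc k)) \<le> real (Suc k) * (t / real (Suc k))"
          using that t by (intro mult_right_mono) auto
        then show ?thesis by simp
      qed
      then show "P k \<subseteq> {0..t}" unfolding P_def using s st t fin(2)[OF s, of k] fin(2)[OF t(2), of k] by fastforce
    qed (auto simp: P_def)
    then obtain m p where part: "\<And>k. time_partition 0 t (m k) (p k)" and img: "\<And>k. p k ` {..m k} = P k"
      by metis
    have "\<exists>l\<le>m k. p k l = s" for k
    proof -
      have "s \<in> p k ` {..m k}" unfolding img by (simp add: P_def)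
      then show ?thesis by auto
    qed
    then obtain l where l: "\<And>k. l k \<le> m k" "\<And>k. p k (l k) = s" by metis
    have mesh: "p k (Suc i) - p k i \<le> t / real (Suc k)" if "i < m k" for k i
      using that t by (intro time_partition_mesh[OF part]) (auto simp: img P_def)
    have part_s: "time_partition 0 s (l k) (p k)" for k
      using part[of k] l[of k] by (auto simp: time_partition_def)
    have Qs_img: "Q s k \<subseteq> p k ` {..l k}" for k
    proof
      fix x assume x: "x \<in> Q s k"
      then have "x \<in> p k ` {..m k}" unfolding img by (simp add: P_def)
      then obtain i where i: "i \<le> m k" "x = p k i" by auto
      have "i \<le> l k"
      proof (rule ccontr)
        assume "\<not> i \<le> l k"
        then have li: "Suc (l k) \<le> i" by simp
        have "p k (l k) < p k (Suc (l k))" using part[of k] li i(1) by (auto simp: time_partition_def)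
        also have "\<dots> \<le> p k i" using li i(1) by (intro time_partition_mono[OF part])
        finally show False using fin(2)[OF s, of k] x i l(2)[of k] by auto
      qed
      with i show "x \<in> p k ` {..l k}" by auto
    qed
    define T where "T k i \<omega> = D (p k i) \<omega> * (p k (Suc i) - p k i) + H (p k i) \<omega> * (B (p k (Suc i)) \<omega> - B (p k i) \<omega>)" for k i \<omega>
    have T_meas [measurable]: "T k i \<in> borel_measurable M" if "i < m k" for k i
    proof -
      have "0 \<le> p k i" "0 \<le> p k (Suc i)"
        using time_partition_mono[OF part, of 0 i k] time_partition_mono[OF part, of 0 "Suc i" k] part[of k] that
        by (auto simp: time_partition_def)
      moreover from this have "0 \<le> q * p k i" using q by simp
      ultimately have [measurable]: "X (p k i) \<in> borel_measurable M" "X (q * p k i) \<in> borel_measurable M"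
        "B (p k i) \<in> borel_measurable M" "B (p k (Suc i)) \<in> borel_measurable M" by (auto intro: X_meas)
      show ?thesis unfolding T_def[abs_def] D_def H_def by measurable
    qed
    have [measurable]: "X s \<in> borel_measurable M" "X t \<in> borel_measurable M" "X 0 \<in> borel_measurable M"
      using s t by (auto intro: X_meas)
    have [measurable]: "(\<lambda>\<omega>. \<Sum>i<l k. T k i \<omega>) \<in> borel_measurable M" "(\<lambda>\<omega>. \<Sum>i<m k. T k i \<omega>) \<in> borel_measurable M"
      "(\<lambda>\<omega>. \<Sum>i<m k - l k. T k (l k + i) \<omega>) \<in> borel_measurable M" for k
      using l(1)[of k] by (auto intro!: borel_measurable_sum T_meas)
    have vt: "vanishes_in_probability (\<lambda>k \<omega>. (\<Sum>i<m k. T k i \<omega>) - (X t \<omega> - X 0 \<omega>))"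
      unfolding T_def
    proof (rule conjunct2[OF Q[OF t(2)], rule_format, of m p t], intro conjI allI impI)
      show "time_partition 0 t (m k) (p k)" "Q t k \<subseteq> p k ` {..m k}" for k
        unfolding img by (rule part) (auto simp: P_def)
      show "p k (Suc i) - p k i \<le> t / real (Suc k)" if "i < m k" for k i by (rule mesh[OF that])
    qed
    have vs: "vanishes_in_probability (\<lambda>k \<omega>. (\<Sum>i<l k. T k i \<omega>) - (X s \<omega> - X 0 \<omega>))"
      unfolding T_def
    proof (rule conjunct2[OF Q[OF s], rule_format, of l p t], intro conjI allI impI)
      show "time_partition 0 s (l k) (p k)" "Q s k \<subseteq> p k ` {..l k}" for k
        by (rule part_s) (rule Qs_img)
      show "p k (Suc i) - p k i \<le> t / real (Suc k)" if "i < l k" for k i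
        using that l(1)[of k] by (intro mesh) simp
    qed
    have "vanishes_in_probability (\<lambda>k \<omega>. (\<Sum>i<m k - l k. T k (l k + i) \<omega>) - (X t \<omega> - X s \<omega>))"
    proof (rule vanishes_in_probability_squeeze[OF _ _ _ vt vs])
      show "AE \<omega> in M. \<forall>k. \<bar>(\<Sum>i<m k - l k. T k (l k + i) \<omega>) - (X t \<omega> - X s \<omega>)\<bar> \<le>
        \<bar>(\<Sum>i<m k. T k i \<omega>) - (X t \<omega> - X 0 \<omega>)\<bar> + \<bar>(\<Sum>i<l k. T k i \<omega>) - (X s \<omega> - X 0 \<omega>)\<bar>"
      proof (intro AE_I2 allI)
        fix \<omega> k
        show "\<bar>(\<Sum>i<m k - l k. T k (l k + i) \<omega>) - (X t \<omega> - X s \<omega>)\<bar> \<le>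
          \<bar>(\<Sum>i<m k. T k i \<omega>) - (X t \<omega> - X 0 \<omega>)\<bar> + \<bar>(\<Sum>i<l k. T k i \<omega>) - (X s \<omega> - X 0 \<omega>)\<bar>"
          using sum_lessThan_split[OF l(1)[of k], of "\<lambda>i. T k i \<omega>"] by linarith
      qed
    qed measurable
    \<comment> \<open>Here convergence in probability becomes almost sure convergence, the form used
      by Fatou's lemma. Passing to a subsequence is harmless, since
      \<open>riemann_ito_approx\<close> asks only that some partitions exist.\<close>
    then obtain r where r: "strict_mono r"
      "AE \<omega> in M. (\<lambda>k. (\<Sum>i<m (r k) - l (r k). T (r k) (l (r k) + i) \<omega>) - (X t \<omega> - X s \<omega>)) \<longlonglongrightarrow> 0"
      using vanishes_in_probability_AE_subseq[of "\<lambda>k \<omega>. (\<Sum>i<m k - l k. T k (l k + i) \<omega>) - (X t \<omega> - X s \<omega>)"]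
      by auto
    show ?thesis
    proof (intro exI conjI allI)
      show "time_partition s t (m (r k) - l (r k)) (\<lambda>i. p (r k) (l (r k) + i))" for k
        using part[of "r k"] l[of "r k"] by (auto simp: time_partition_def)
      show "AE \<omega> in M. (\<lambda>k. \<Sum>i<m (r k) - l (r k). D (p (r k) (l (r k) + i)) \<omega> * (p (r k) (l (r k) + Suc i) - p (r k) (l (r k) + i)) +
         H (p (r k) (l (r k) + i)) \<omega> * (B (p (r k) (l (r k) + Suc i)) \<omega> - B (p (r k) (l (r k) + i)) \<omega>)) \<longlonglongrightarrow> X t \<omega> - X s \<omega>"
        using r(2) by eventually_elim (simp add: T_def LIM_zero_iff)
    qed
  qed
  have "pantograph_process M F B X' a b \<sigma> \<rho> q"
  proof
    show "0 < q" "q < 1" by (fact q)+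
    show "X' t \<in> borel_measurable (F t)" if t: "0 \<le> t" for t
    proof -
      have [measurable]: "N \<in> sets (F t)" "X t \<in> borel_measurable (F t)"
        using null_sets_natural_filtration[OF N(1)] X_adapted[OF t] by (auto simp: F_def)
      show ?thesis unfolding X'_def[abs_def] by measurable
    qed
    show "continuous_on {0..} (\<lambda>t. X' t \<omega>)" if "\<omega> \<in> space M" for \<omega>
      using N(2) that by (cases "\<omega> \<in> N") (auto simp: X'_def)
    show "X' 0 \<in> L2 M"
    proof -
      have [measurable]: "X 0 \<in> borel_measurable M" "N \<in> events" using X_meas N(1) by auto
      have m: "X' 0 \<in> borel_measurable M" unfolding X'_def[abs_def] by measurable
      have "AE \<omega> in M. (X0 \<omega>)\<^sup>2 = (X' 0 \<omega>)\<^sup>2" using X_init X'_eq by eventually_elim simp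
      then have "integrable M (\<lambda>\<omega>. (X' 0 \<omega>)\<^sup>2)"
        using X0_L2 m by (subst integrable_cong_AE[where g = "\<lambda>\<omega>. (X0 \<omega>)\<^sup>2"]) (auto simp: L2_def)
      with m show ?thesis by (simp add: L2_def)
    qed
    show "\<exists>m p. (\<forall>k. time_partition s t (m k) (p k)) \<and>
      (AE \<omega> in M. (\<lambda>k. \<Sum>i<m k. (a * X' (p k i) \<omega> + b * X' (q * p k i) \<omega>) * (p k (Suc i) - p k i) +
         (\<sigma> * X' (p k i) \<omega> + \<rho> * X' (q * p k i) \<omega>) * (B (p k (Suc i)) \<omega> - B (p k i) \<omega>))
       \<longlonglongrightarrow> X' t \<omega> - X' s \<omega>)" if st: "0 \<le> s" "s < t" for s t
    proof -
      obtain m p where "\<forall>k. time_partition s t (m k) (p k)" and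
        lim: "AE \<omega> in M. (\<lambda>k. riemann_ito_sum (m k) (p k) D H \<omega>) \<longlonglongrightarrow> X t \<omega> - X s \<omega>"
        using approx[OF st] by blast
      moreover have "AE \<omega> in M. (\<lambda>k. \<Sum>i<m k. (a * X' (p k i) \<omega> + b * X' (q * p k i) \<omega>) * (p k (Suc i) - p k i) +
         (\<sigma> * X' (p k i) \<omega> + \<rho> * X' (q * p k i) \<omega>) * (B (p k (Suc i)) \<omega> - B (p k i) \<omega>))
       \<longlonglongrightarrow> X' t \<omega> - X' s \<omega>"
        using lim X'_eq by eventually_elim (simp add: D_def H_def)
      ultimately show ?thesis by blast
    qed
  qed
  then show thesis using X'_eq unfolding F_def by (rule that)
qed

theorem theorem3:
  fixes M :: "'a measure" and B X :: "real \<Rightarrow> 'a \<Rightarrow> real" and X0 :: "'a \<Rightarrow> real"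
    and a b \<sigma> \<rho> q :: real
  assumes q: "q \<in> {0<..<1}"
    and wiener: "wiener_process M B"
    and X0: "X0 \<in> borel_measurable M"
    and indep: "prob_space.indep_set M (sets (vimage_algebra (space M) X0 borel))
                  (sets (process_sigma M {0..} B))"
    and X: "pantograph_solution M B a b \<sigma> \<rho> q X0 X"
  shows "(\<rho> = 0 \<and> integrable M (\<lambda>\<omega>. \<bar>X0 \<omega>\<bar> ^ 2) \<longrightarrow> a < 0 \<longrightarrow>
            (\<exists>\<alpha> C. \<alpha> = 1 / ln q * ln (- a / \<bar>b\<bar>) \<and> C > 0 \<and>
              (\<forall>t\<ge>0. integrable M (\<lambda>\<omega>. \<bar>X t \<omega>\<bar>) \<and>
                 prob_space.expectation M (\<lambda>\<omega>. \<bar>X t \<omega>\<bar>)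
                   \<le> C * prob_space.expectation M (\<lambda>\<omega>. \<bar>X0 \<omega>\<bar>) * (1 + t) powr \<alpha>)))
       \<and> (\<rho> \<noteq> 0 \<and> integrable M (\<lambda>\<omega>. \<bar>X0 \<omega>\<bar> ^ 4) \<longrightarrow> 2 * a + \<sigma>\<^sup>2 < 0 \<longrightarrow>
            (\<exists>\<alpha> C. \<alpha> = 2 / ln q *
                       ln (1 / \<rho>\<^sup>2 * (sqrt (\<bar>b + \<sigma> * \<rho>\<bar>\<^sup>2 - \<rho>\<^sup>2 * (2 * a + \<sigma>\<^sup>2))
                                    - \<bar>b + \<sigma> * \<rho>\<bar>)) \<and> C > 0 \<and>
              (\<forall>t\<ge>0. integrable M (\<lambda>\<omega>. \<bar>X t \<omega>\<bar> ^ 2) \<and>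
                 prob_space.expectation M (\<lambda>\<omega>. \<bar>X t \<omega>\<bar> ^ 2)
                   \<le> C * prob_space.expectation M (\<lambda>\<omega>. \<bar>X0 \<omega>\<bar> ^ 2) * (1 + t) powr \<alpha>)))"
proof -
  interpret prob_space M using wiener by (simp add: wiener_process_def)
  have q': "0 < q" "q < 1" using q by auto
  have X_meas: "X t \<in> borel_measurable M" if "0 \<le> t" for t
  proof -
    interpret wiener_filtration M "natural_filtration M X0 B" B
      by (rule wiener_filtration_natural_filtration[OF wiener X0 indep])
    show ?thesis using X that by (intro adapted_measurable[OF that]) (simp add: pantograph_solution_def)
  qed
  have X_init: "AE \<omega> in M. X 0 \<omega> = X0 \<omega>" using X by (simp add: pantograph_solution_def)
  \<comment> \<open>The estimates are proved for the modification X', which equals X almost surely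
    at all times simultaneously, with initial value almost surely X0. Integrals do not see the
    difference, so the constants carry over unchanged.\<close>
  have transfer: "integrable M (\<lambda>\<omega>. f (X t \<omega>)) \<and>
      expectation (\<lambda>\<omega>. f (X t \<omega>)) \<le> C * expectation (\<lambda>\<omega>. f (X0 \<omega>)) * (1 + t) powr \<alpha>"
    if f [measurable]: "f \<in> borel_measurable borel" and eq: "AE \<omega> in M. \<forall>t. X' t \<omega> = X t \<omega>"
      and X': "X' t \<in> borel_measurable M" "X' 0 \<in> borel_measurable M"
      and int: "integrable M (\<lambda>\<omega>. f (X' t \<omega>))" and t: "0 \<le> t"
      and le: "expectation (\<lambda>\<omega>. f (X' t \<omega>)) \<le> C * expectation (\<lambda>\<omega>. f (X' 0 \<omega>)) * (1 + t) powr \<alpha>"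
    for f :: "real \<Rightarrow> real" and X' :: "real \<Rightarrow> 'a \<Rightarrow> real" and C t \<alpha>
  proof -
    note [measurable] = X' X_meas[OF t] X0
    have eqt: "AE \<omega> in M. f (X' t \<omega>) = f (X t \<omega>)" using eq by eventually_elim simp
    have eq0: "AE \<omega> in M. f (X' 0 \<omega>) = f (X0 \<omega>)" using eq X_init by eventually_elim simp
    have "integrable M (\<lambda>\<omega>. f (X t \<omega>))"
      using int by (rule integrable_cong_AE_imp) (use eqt in auto)
    moreover have "expectation (\<lambda>\<omega>. f (X t \<omega>)) = expectation (\<lambda>\<omega>. f (X' t \<omega>))"
      by (rule integral_cong_AE) (use eqt in auto)
    moreover have "expectation (\<lambda>\<omega>. f (X0 \<omega>)) = expectation (\<lambda>\<omega>. f (X' 0 \<omega>))"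
      by (rule integral_cong_AE) (use eq0 in auto)
    ultimately show ?thesis using le by simp
  qed
  show ?thesis
  proof (intro conjI impI; elim conjE)
    assume \<rho>: "\<rho> = 0" and int: "integrable M (\<lambda>\<omega>. \<bar>X0 \<omega>\<bar> ^ 2)" and a: "a < 0"
    have "X0 \<in> L2 M" using X0 int by (simp add: L2_def)
    then obtain X' where X': "pantograph_process M (natural_filtration M X0 B) B X' a b \<sigma> \<rho> q"
      "AE \<omega> in M. \<forall>t. X' t \<omega> = X t \<omega>"
      by (rule pantograph_process_of_solution[OF q' wiener X0 indep X])
    interpret P: pantograph_process M "natural_filtration M X0 B" B X' a b \<sigma> \<rho> q by (fact X'(1))
    obtain C where C: "C > 0" "\<And>t. 0 \<le> t \<Longrightarrow> expectation (\<lambda>\<omega>. \<bar>X' t \<omega>\<bar>)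
        \<le> C * expectation (\<lambda>\<omega>. \<bar>X' 0 \<omega>\<bar>) * (1 + t) powr (1 / ln q * ln (- a / \<bar>b\<bar>))"
      using P.first_moment_bound[OF \<rho> a] by blast
    have "integrable M (\<lambda>\<omega>. \<bar>X t \<omega>\<bar>) \<and>
        expectation (\<lambda>\<omega>. \<bar>X t \<omega>\<bar>) \<le> C * expectation (\<lambda>\<omega>. \<bar>X0 \<omega>\<bar>) * (1 + t) powr (1 / ln q * ln (- a / \<bar>b\<bar>))"
      if "0 \<le> t" for t
      using transfer[of abs, OF _ X'(2) _ _ _ that C(2)[OF that]] that
      by (simp add: P.X_measurable L2_integrable P.X_L2)
    with C(1) show "\<exists>\<alpha> C. \<alpha> = 1 / ln q * ln (- a / \<bar>b\<bar>) \<and> C > 0 \<and>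
        (\<forall>t\<ge>0. integrable M (\<lambda>\<omega>. \<bar>X t \<omega>\<bar>) \<and>
           expectation (\<lambda>\<omega>. \<bar>X t \<omega>\<bar>) \<le> C * expectation (\<lambda>\<omega>. \<bar>X0 \<omega>\<bar>) * (1 + t) powr \<alpha>)"
      by blast
  next
    assume \<rho>: "\<rho> \<noteq> 0" and int: "integrable M (\<lambda>\<omega>. \<bar>X0 \<omega>\<bar> ^ 4)" and a: "2 * a + \<sigma>\<^sup>2 < 0"
    have "x\<^sup>2 \<le> 1 + \<bar>x\<bar> ^ 4" for x :: real
    proof -
      have "0 \<le> (x\<^sup>2 - 1)\<^sup>2" by simp
      also have "\<dots> = 1 + \<bar>x\<bar> ^ 4 - 2 * x\<^sup>2" by (simp add: power2_eq_square power4_eq_xxxx algebra_simps)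
      finally show ?thesis using zero_le_power2[of x] by linarith
    qed
    then have "X0 \<in> L2 M" using X0 int by (intro L2_bound[of _ _ "\<lambda>\<omega>. 1 + \<bar>X0 \<omega>\<bar> ^ 4"]) auto
    then obtain X' where X': "pantograph_process M (natural_filtration M X0 B) B X' a b \<sigma> \<rho> q"
      "AE \<omega> in M. \<forall>t. X' t \<omega> = X t \<omega>"
      by (rule pantograph_process_of_solution[OF q' wiener X0 indep X])
    interpret P: pantograph_process M "natural_filtration M X0 B" B X' a b \<sigma> \<rho> q by (fact X'(1))
    let ?\<alpha> = "2 / ln q * ln (1 / \<rho>\<^sup>2 * (sqrt (\<bar>b + \<sigma> * \<rho>\<bar>\<^sup>2 - \<rho>\<^sup>2 * (2 * a + \<sigma>\<^sup>2)) - \<bar>b + \<sigma> * \<rho>\<bar>))"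
    obtain C where C: "C > 0" "\<And>t. 0 \<le> t \<Longrightarrow> second_moment (X' t)
        \<le> C * second_moment (X' 0) * (1 + t) powr ?\<alpha>"
      using P.second_moment_bound[OF \<rho> a] by blast
    have "integrable M (\<lambda>\<omega>. \<bar>X t \<omega>\<bar> ^ 2) \<and>
        expectation (\<lambda>\<omega>. \<bar>X t \<omega>\<bar> ^ 2) \<le> C * expectation (\<lambda>\<omega>. \<bar>X0 \<omega>\<bar> ^ 2) * (1 + t) powr ?\<alpha>" if "0 \<le> t" for t
      using transfer[of "\<lambda>x. x\<^sup>2", OF _ X'(2) _ _ _ that C(2)[OF that]] that
      by (simp add: P.X_measurable L2_integrable_power2 P.X_L2)
    with C(1) show "\<exists>\<alpha> C. \<alpha> = ?\<alpha> \<and> C > 0 \<and>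
        (\<forall>t\<ge>0. integrable M (\<lambda>\<omega>. \<bar>X t \<omega>\<bar> ^ 2) \<and>
           expectation (\<lambda>\<omega>. \<bar>X t \<omega>\<bar> ^ 2) \<le> C * expectation (\<lambda>\<omega>. \<bar>X0 \<omega>\<bar> ^ 2) * (1 + t) powr \<alpha>)"
      by blast
  qed
qed

end
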